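(* There exist $\kappa>0$ and two $\kappa$-strongly log-concave probability measures $\mu_0,\mu_1$ on $\mathbb{R}^2$ such that their Wasserstein midpoint $\mu_{1/2}$ satisfies $$\sqrt{C_P(\mu_{1/2})}>\frac12\sqrt{C_P(\mu_0)}+\frac12\sqrt{C_P(\mu_1)}.$$
   Context: A probability measure $\mu$ on $\mathbb{R}^n$ is $\kappa$-strongly log-concave ($\kappa>0$) if $\mathrm d\mu=e^{-V}\,\mathrm dx$ with $V:\mathbb{R}^n\to(-\infty,+\infty]$ proper and lower semicontinuous and $V-\kappa|x|^2/2$ convex ($V$ may take the value $+\infty$). The Poincaré constant $C_P(\mu)$ is the least $C\in[0,\infty]$ such that $\int|f-\int f\,\mathrm d\mu|^2\,\mathrm d\mu\le C\int|\nabla f|^2\,\mathrm d\mu$ for every $f\in C_c^\infty(\mathbb{R}^n)$. Wasserstein midpoint: let $T$ be the Brenier map, i.e. the ($\mu_0$-a.e. unique) optimal transport map from $\mu_0$ to $\mu_1$ for the cost $|x-y|^2$; then $\mu_{1/2}=(\tfrac12 I+\tfrac12T)_\#\mu_0$, $I$ the identity map. *)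

theory Defs
  imports "HOL-Probability.Probability"
begin

subsection \<open>Strongly log-concave measures\<close>

definition proper_fun :: "('a \<Rightarrow> ereal) \<Rightarrow> bool" where
  "proper_fun V \<longleftrightarrow> (\<forall>x. V x \<noteq> -\<infinity>) \<and> (\<exists>x. V x \<noteq> \<infinity>)"

definition lower_semicontinuous :: "('a::topological_space \<Rightarrow> ereal) \<Rightarrow> bool" where
  "lower_semicontinuous V \<longleftrightarrow> (\<forall>x. V x \<le> Liminf (at x) V)"

text \<open>Only used for functions that never take the value \<open>-\<infinity>\<close>, so that the sum on the
  right-hand side is never of the form \<open>\<infinity> + (-\<infinity>)\<close>.\<close>
definition ereal_convex :: "('a::real_vector \<Rightarrow> ereal) \<Rightarrow> bool" where
  "ereal_convex W \<longleftrightarrow>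
    (\<forall>x y t. 0 < t \<and> t < 1 \<longrightarrow>
      W ((1 - t) *\<^sub>R x + t *\<^sub>R y) \<le> ereal (1 - t) * W x + ereal t * W y)"

text \<open>\<open>exp (-v)\<close> with \<open>exp (-\<infinity>) = 0\<close> and \<open>exp \<infinity> = \<infinity>\<close>.\<close>
definition exp_neg :: "ereal \<Rightarrow> ennreal" where
  "exp_neg v = (case v of ereal r \<Rightarrow> ennreal (exp (- r)) | PInfty \<Rightarrow> 0 | MInfty \<Rightarrow> \<infinity>)"

definition strongly_log_concave :: "real \<Rightarrow> 'a::euclidean_space measure \<Rightarrow> bool" where
  "strongly_log_concave \<kappa> \<mu> \<longleftrightarrow>
    0 < \<kappa> \<and> prob_space \<mu> \<and>
    (\<exists>V::'a \<Rightarrow> ereal. proper_fun V \<and> lower_semicontinuous V \<and>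
       ereal_convex (\<lambda>x. V x - ereal (\<kappa> * (norm x)\<^sup>2 / 2)) \<and>
       \<mu> = density lborel (\<lambda>x. exp_neg (V x)))"

subsection \<open>The Poincare constant\<close>

text \<open>\<open>C_k k f\<close>: all iterated partial derivatives of \<open>f\<close> of order at most \<open>k\<close> exist and are
  continuous.\<close>
primrec C_k :: "nat \<Rightarrow> ('a::euclidean_space \<Rightarrow> real) \<Rightarrow> bool" where
  "C_k 0 f \<longleftrightarrow> continuous_on UNIV f"
| "C_k (Suc k) f \<longleftrightarrow>
     f differentiable_on UNIV \<and> (\<forall>b\<in>Basis. C_k k (\<lambda>x. frechet_derivative f (at x) b))"

definition test_functions :: "('a::euclidean_space \<Rightarrow> real) set" where
  "test_functions = {f. (\<forall>k. C_k k f) \<and> compact (closure {x. f x \<noteq> 0})}"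

definition gradient :: "('a::real_inner \<Rightarrow> real) \<Rightarrow> 'a \<Rightarrow> 'a" where
  "gradient f x = (THE D. GDERIV f x :> D)"

definition poincare_constant :: "'a::euclidean_space measure \<Rightarrow> ennreal" where
  "poincare_constant \<mu> = Inf {C. \<forall>f\<in>test_functions.
     (\<integral>\<^sup>+x. ennreal (\<bar>f x - (\<integral>y. f y \<partial>\<mu>)\<bar>\<^sup>2) \<partial>\<mu>)
       \<le> C * (\<integral>\<^sup>+x. ennreal ((norm (gradient f x))\<^sup>2) \<partial>\<mu>)}"

definition ennreal_sqrt :: "ennreal \<Rightarrow> ennreal" where
  "ennreal_sqrt c = (if c = \<infinity> then \<infinity> else ennreal (sqrt (enn2real c)))"

subsection \<open>Brenier maps and Wasserstein midpoints\<close>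

definition transport_map ::
    "'a::euclidean_space measure \<Rightarrow> 'a measure \<Rightarrow> ('a \<Rightarrow> 'a) \<Rightarrow> bool" where
  "transport_map \<mu> \<nu> T \<longleftrightarrow> T \<in> measurable \<mu> borel \<and> distr \<mu> borel T = \<nu>"

definition transport_cost :: "'a::euclidean_space measure \<Rightarrow> ('a \<Rightarrow> 'a) \<Rightarrow> ennreal" where
  "transport_cost \<mu> T = (\<integral>\<^sup>+x. ennreal ((norm (x - T x))\<^sup>2) \<partial>\<mu>)"

definition optimal_transport_map ::
    "'a::euclidean_space measure \<Rightarrow> 'a measure \<Rightarrow> ('a \<Rightarrow> 'a) \<Rightarrow> bool" where
  "optimal_transport_map \<mu> \<nu> T \<longleftrightarrow>
    transport_map \<mu> \<nu> T \<and> (\<forall>S. transport_map \<mu> \<nu> S \<longrightarrow> transport_cost \<mu> T \<le> transport_cost \<mu> S)"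

definition brenier_map ::
    "'a::euclidean_space measure \<Rightarrow> 'a measure \<Rightarrow> ('a \<Rightarrow> 'a) \<Rightarrow> bool" where
  "brenier_map \<mu> \<nu> T \<longleftrightarrow>
    optimal_transport_map \<mu> \<nu> T \<and>
    (\<forall>S. optimal_transport_map \<mu> \<nu> S \<longrightarrow> (AE x in \<mu>. S x = T x))"

text \<open>The almost everywhere uniqueness in \<open>brenier_map\<close> makes \<open>\<rho>\<close> unique, so this
  relation is the graph of a partial function of \<open>(\<mu>, \<nu>)\<close>.\<close>
definition wasserstein_midpoint ::
    "'a::euclidean_space measure \<Rightarrow> 'a measure \<Rightarrow> 'a measure \<Rightarrow> bool" where
  "wasserstein_midpoint \<mu> \<nu> \<rho> \<longleftrightarrow>
    (\<exists>T. brenier_map \<mu> \<nu> T \<and> \<rho> = distr \<mu> borel (\<lambda>x. (1/2) *\<^sub>R x + (1/2) *\<^sub>R T x))"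

end

theory Submission
  imports Defs
begin

text \<open>
  Up to a Gaussian factor close to 1, \<open>\<mu>0\<close> is uniform on a right isosceles triangle, \<open>\<mu>1\<close> on an equilateral
  triangle with the same base, and the Brenier map is the linear stretching of the height by \<open>sqrt 3\<close>, so
  that \<open>\<mu>half\<close> is uniform on an isosceles triangle of intermediate height. Both endpoint triangles are alcoves
  of affine reflection groups, which makes their Poincare constants explicit: with base 2 they are
  \<open>2 / pi\<^sup>2\<close> and \<open>9 / (4 * pi\<^sup>2)\<close>. A function on the triangle is folded to a periodic (or Neumann) function on
  a square; the one-dimensional Wirtinger inequality bounds the variance along the lines of the two
  (respectively three) reflection directions, and Bessel's inequality for the mutually orthogonal
  averages along these directions bounds the total variance. For the midpoint triangle, a quartic trial
  function gives a Poincare constant whose square root exceeds the mean of the other two by 0.14 percent.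
\<close>

subsection \<open>One-dimensional Wirtinger inequalities\<close>

text \<open>The margin is below 0.2 percent, so both endpoint constants must be essentially sharp;
  the general bound \<open>4 / pi\<^sup>2\<close> for a convex set of diameter 2 is far too weak. A
  uniform law is not \<kappa>-strongly log-concave for any \<kappa> > 0, hence the Gaussian factor.
  It is put on one reference triangle with coordinates (s, t), base 2 and height 1, and all three
  measures are images of that one measure under (s, t) -> (s, a t), where a is 1, sqrt 3 or their
  mean. So the transport map stays exactly linear and no perturbed map has to be estimated. The
  one-dimensional constants are approached rather than attained: the comparison function is a
  tangent that must stay finite on closed intervals, so every inequality is proved for w < pi, and w
  = 3.141 is precise enough in the end. For the equilateral triangle the averages are orthogonal in
  pairs because any two of b, - a and a - b, taken modulo 1, are independent and uniform on the unit
  square.\<close>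

lemma riccati_energy_bound:
  fixes h h' G :: "real \<Rightarrow> real"
  assumes "a \<le> b" and "finite E" and cont: "continuous_on {a..b} h"
    and der: "\<And>x. x \<in> {a<..<b} - E \<Longrightarrow> (h has_real_derivative h' x) (at x)"
    and bnd: "\<And>x. x \<in> {a<..<b} - E \<Longrightarrow> (h' x)\<^sup>2 \<le> G x"
    and G: "G integrable_on {a..b}"
    and arg: "\<And>x. x \<in> {a..b} \<Longrightarrow> \<bar>w * (x - c)\<bar> < pi / 2"
  shows "w\<^sup>2 * integral {a..b} (\<lambda>x. (h x)\<^sup>2) \<le> integral {a..b} G
    + (h b)\<^sup>2 * (w * tan (w * (b - c))) - (h a)\<^sup>2 * (w * tan (w * (a - c)))"
proof -
  \<comment> \<open>\<open>k\<close> solves the Riccati equation k' = w^2 + k^2. Hence (h' + h k)^2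
    >= 0 says that w^2 h^2 - h'^2 <= (h^2 k)', and integration leaves only boundary terms. The bound
    \<open>arg\<close> keeps the tangent away from its poles.\<close>
  define k where "k = (\<lambda>x. w * tan (w * (x - c)))"
  define k' where "k' = (\<lambda>x. w\<^sup>2 + (k x)\<^sup>2)"
  have cosnz: "cos (w * (x - c)) \<noteq> 0" if "x \<in> {a..b}" for x
  proof -
    have "- (pi / 2) < w * (x - c)" "w * (x - c) < pi / 2"
      using arg[OF that] unfolding abs_less_iff by linarith+
    from cos_gt_zero_pi[OF this] show ?thesis by simp
  qed
  have kder: "(k has_real_derivative k' x) (at x)" if "x \<in> {a..b}" for x
  proof -
    let ?C = "cos (w * (x - c))"
    have "(k has_real_derivative w * (inverse (?C\<^sup>2) * w)) (at x)"
      unfolding k_def using cosnz[OF that]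
      by (auto intro!: derivative_eq_intros)
    also have "w * (inverse (?C\<^sup>2) * w) = k' x"
    proof -
      have "w * (inverse (?C\<^sup>2) * w) = w\<^sup>2 * (1 + (tan (w * (x - c)))\<^sup>2)"
        using tan_sec[OF cosnz[OF that]] by (simp add: power2_eq_square power_inverse)
      then show ?thesis
        by (simp add: k'_def k_def power_mult_distrib distrib_left)
    qed
    finally show ?thesis .
  qed
  have kcont: "continuous_on {a..b} k"
    using kder by (meson DERIV_isCont continuous_at_imp_continuous_on)
  \<comment> \<open>At the exceptional points the integrand is given the value of the lower bound,
    so that the pointwise comparison below holds on the whole interval; finitely many points do not
    change the integral.\<close>
  define R where "R = (\<lambda>x. if x \<in> E \<union> {a, b} then w\<^sup>2 * (h x)\<^sup>2 - G x
      else 2 * h x * h' x * k x + (h x)\<^sup>2 * k' x)"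
  have R: "(R has_integral (h b)\<^sup>2 * k b - (h a)\<^sup>2 * k a) {a..b}"
  proof (rule fundamental_theorem_of_calculus_interior_strong[where S = "E \<union> {a, b}"])
    show "((\<lambda>x. (h x)\<^sup>2 * k x) has_vector_derivative R x) (at x)"
      if "x \<in> {a<..<b} - (E \<union> {a, b})" for x
    proof -
      have "x \<in> {a<..<b} - E" "x \<in> {a..b}" using that by auto
      from der[OF this(1)] kder[OF this(2)] show ?thesis
        unfolding has_real_derivative_iff_has_vector_derivative[symmetric]
        using that by (auto intro!: derivative_eq_intros simp: R_def)
    qed
  qed (use assms kcont in \<open>auto intro!: continuous_intros\<close>)
  have h2: "(\<lambda>x. (h x)\<^sup>2) integrable_on {a..b}"
    using cont by (intro integrable_continuous_real continuous_intros)
  have "integral {a..b} (\<lambda>x. w\<^sup>2 * (h x)\<^sup>2 - G x) \<le> integral {a..b} R"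
  proof (rule integral_le)
    show "w\<^sup>2 * (h x)\<^sup>2 - G x \<le> R x" if "x \<in> {a..b}" for x
    proof (cases "x \<in> E \<union> {a, b}")
      case False
      then have "x \<in> {a<..<b} - E" using that by auto
      from bnd[OF this] have "(h' x)\<^sup>2 \<le> G x" .
      moreover have "0 \<le> (h' x + h x * k x)\<^sup>2" by simp
      ultimately show ?thesis using False
        by (simp add: R_def k'_def power2_eq_square algebra_simps)
    qed (simp add: R_def)
  next
    show "R integrable_on {a..b}" using R by blast
  qed (use h2 G in \<open>auto intro!: integrable_diff integrable_on_mult_right\<close>)
  also have "\<dots> = (h b)\<^sup>2 * k b - (h a)\<^sup>2 * k a"
    using R by (rule integral_unique)
  finally show ?thesis
    using h2 G by (simp add: k_def integral_diff integrable_on_mult_right)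
qed

text \<open>A free end costs nothing if the tangent vanishes there, and the midpoint costs nothing
  if the function vanishes there. So \<open>f (1 / 2)\<close> is subtracted, and
  \<open>riccati_energy_bound\<close> is applied on each half with the tangent centred at 0 and at
  1. \<open>G\<close> stands in for the squared derivative because folded functions are
  differentiable only off finitely many points of a slice.\<close>

lemma wirtinger_neumann:
  fixes f f' G :: "real \<Rightarrow> real"
  assumes "finite E" and cont: "continuous_on {0..1} f"
    and der: "\<And>x. x \<in> {0<..<1} - E \<Longrightarrow> (f has_real_derivative f' x) (at x)"
    and bnd: "\<And>x. x \<in> {0<..<1} - E \<Longrightarrow> (f' x)\<^sup>2 \<le> G x"
    and G: "G integrable_on {0..1}"
    and w: "0 < w" "w < pi"
  shows "\<exists>A. w\<^sup>2 * integral {0..1} (\<lambda>x. (f x - A)\<^sup>2) \<le> integral {0..1} G"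
proof -
  define h where "h = (\<lambda>x. f x - f (1 / 2))"
  have hc: "continuous_on {0..1} h"
    unfolding h_def using cont by (intro continuous_intros)
  have hd: "(h has_real_derivative f' x) (at x)" if "x \<in> {0<..<1} - E" for x
    using DERIV_diff[OF der[OF that] DERIV_const, of "f (1 / 2)"] by (simp add: h_def)
  have h2: "(\<lambda>x. (h x)\<^sup>2) integrable_on {0..1}"
    using hc by (intro integrable_continuous_real continuous_intros)
  have arg: "\<bar>w * t\<bar> < pi / 2" if "\<bar>t\<bar> \<le> 1 / 2" for t
  proof -
    have "\<bar>w * t\<bar> \<le> w * (1 / 2)" unfolding abs_mult using that w by (intro mult_mono) auto
    then show ?thesis using w by linarith
  qed
  have step1: "w\<^sup>2 * integral {0..1/2} (\<lambda>x. (h x)\<^sup>2) \<le> integral {0..1/2} G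
    + (h (1/2))\<^sup>2 * (w * tan (w * (1/2 - 0))) - (h 0)\<^sup>2 * (w * tan (w * (0 - 0)))"
  proof (rule riccati_energy_bound[where E = E and h' = f'])
    show "\<bar>w * (x - 0)\<bar> < pi / 2" if "x \<in> {0..1/2}" for x
      by (rule arg) (use that in auto)
  qed (auto intro: \<open>finite E\<close> continuous_on_subset[OF hc] integrable_on_subinterval[OF G] hd bnd)
  have step2: "w\<^sup>2 * integral {1/2..1} (\<lambda>x. (h x)\<^sup>2) \<le> integral {1/2..1} G
    + (h 1)\<^sup>2 * (w * tan (w * (1 - 1))) - (h (1/2))\<^sup>2 * (w * tan (w * (1/2 - 1)))"
  proof (rule riccati_energy_bound[where E = E and h' = f'])
    show "\<bar>w * (x - 1)\<bar> < pi / 2" if "x \<in> {1/2..1}" for x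
      by (rule arg) (use that in auto)
  qed (auto intro: \<open>finite E\<close> continuous_on_subset[OF hc] integrable_on_subinterval[OF G] hd bnd)
  have comb: "integral {0..1/2} (\<lambda>x. (h x)\<^sup>2) + integral {1/2..1} (\<lambda>x. (h x)\<^sup>2)
      = integral {0..1} (\<lambda>x. (h x)\<^sup>2)"
    "integral {0..1/2} G + integral {1/2..1} G = integral {0..1} G"
    using Henstock_Kurzweil_Integration.integral_combine[OF _ _ h2, of "1/2"] Henstock_Kurzweil_Integration.integral_combine[OF _ _ G, of "1/2"] by auto
  have "h (1/2) = 0" by (simp add: h_def)
  with step1 step2 have "w\<^sup>2 * (integral {0..1/2} (\<lambda>x. (h x)\<^sup>2) + integral {1/2..1} (\<lambda>x. (h x)\<^sup>2))
      \<le> integral {0..1/2} G + integral {1/2..1} G"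
    unfolding distrib_left by simp
  then have "w\<^sup>2 * integral {0..1} (\<lambda>x. (h x)\<^sup>2) \<le> integral {0..1} G"
    by (simp only: comb)
  then show ?thesis unfolding h_def by blast
qed

lemma wirtinger_periodic:
  fixes f f' G :: "real \<Rightarrow> real"
  assumes "finite E" and cont: "continuous_on {0..1} f" and per: "f 0 = f 1"
    and der: "\<And>x. x \<in> {0<..<1} - E \<Longrightarrow> (f has_real_derivative f' x) (at x)"
    and bnd: "\<And>x. x \<in> {0<..<1} - E \<Longrightarrow> (f' x)\<^sup>2 \<le> G x"
    and G: "G integrable_on {0..1}"
    and w: "0 < w" "w < 2 * pi"
  shows "\<exists>A. w\<^sup>2 * integral {0..1} (\<lambda>x. (f x - A)\<^sup>2) \<le> integral {0..1} G"
proof -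
  \<comment> \<open>Cut the circle at two antipodal points where \<open>f\<close> takes the same value.\<close>
  obtain p where p: "0 \<le> p" "p \<le> 1 / 2" "f p = f (p + 1 / 2)"
  proof -
    let ?d = "\<lambda>x. f (x + 1 / 2) - f x"
    have dc: "continuous_on {0..1/2} ?d"
      by (intro continuous_intros continuous_on_compose2[OF cont]) auto
    have ends: "?d (1 / 2) = - ?d 0" using per by simp
    consider "?d 0 \<le> 0" | "?d 0 \<ge> 0" by linarith
    then have "\<exists>x\<ge>0. x \<le> 1 / 2 \<and> ?d x = 0"
    proof cases
      case 1
      then show ?thesis using ends IVT'[of ?d 0 0 "1 / 2"] dc by auto
    next
      case 2
      then show ?thesis using ends IVT2'[of ?d "1 / 2" 0 0] dc by auto
    qed
    then show ?thesis using that by force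
  qed
  define h where "h = (\<lambda>x. f x - f p)"
  have hc: "continuous_on {0..1} h"
    unfolding h_def using cont by (intro continuous_intros)
  have hd: "(h has_real_derivative f' x) (at x)" if "x \<in> {0<..<1} - E" for x
    using DERIV_diff[OF der[OF that] DERIV_const, of "f p"] by (simp add: h_def)
  have h2: "(\<lambda>x. (h x)\<^sup>2) integrable_on {0..1}"
    using hc by (intro integrable_continuous_real continuous_intros)
  have arg: "\<bar>w * t\<bar> < pi / 2" if "\<bar>t\<bar> \<le> 1 / 4" for t
  proof -
    have "\<bar>w * t\<bar> \<le> w * (1 / 4)" unfolding abs_mult using that w by (intro mult_mono) auto
    then show ?thesis using w by linarith
  qed
  \<comment> \<open>Boundary terms at \<open>p\<close> and \<open>p + 1/2\<close> vanish with
    \<open>h\<close>, whatever the centre \<open>c\<close>; each arc is centred so that the tangent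
    stays finite on it. The arc through the base point is split at 0 = 1. Its two centres
    \<open>p - 1/4\<close> and \<open>p + 3/4\<close> are the same point of the circle, so the terms
    at 0 and at 1 cancel.\<close>
  define k where "k = (\<lambda>x c. (h x)\<^sup>2 * (w * tan (w * (x - c))))"
  have step: "w\<^sup>2 * integral {a..b} (\<lambda>x. (h x)\<^sup>2) \<le> integral {a..b} G + k b c - k a c"
    if "0 \<le> a" "a \<le> b" "b \<le> 1" "\<bar>a - c\<bar> \<le> 1 / 4" "\<bar>b - c\<bar> \<le> 1 / 4" for a b c
    unfolding k_def
  proof (rule riccati_energy_bound[where E = E and h' = f'])
    show "\<bar>w * (x - c)\<bar> < pi / 2" if "x \<in> {a..b}" for x
    proof (rule arg)
      show "\<bar>x - c\<bar> \<le> 1 / 4"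
        using that \<open>\<bar>a - c\<bar> \<le> 1 / 4\<close> \<open>\<bar>b - c\<bar> \<le> 1 / 4\<close> unfolding abs_le_iff atLeastAtMost_iff by linarith
    qed
  qed (use that(1-3) in \<open>auto intro: \<open>finite E\<close> continuous_on_subset[OF hc] integrable_on_subinterval[OF G] hd bnd\<close>)
  have comb: "integral {0..p} g + integral {p..p+1/2} g + integral {p+1/2..1} g = integral {0..1} g"
    if "g integrable_on {0..1}" for g :: "real \<Rightarrow> real"
  proof -
    have "g integrable_on {0..p + 1/2}"
      using p by (intro integrable_on_subinterval[OF that]) auto
    from Henstock_Kurzweil_Integration.integral_combine[OF _ _ this, of p] Henstock_Kurzweil_Integration.integral_combine[OF _ _ that, of "p + 1/2"] p
    show ?thesis by simp
  qed
  have "h p = 0" "h (p + 1/2) = 0" "h 0 = h 1"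
    using p per by (auto simp: h_def)
  then have "k p (p - 1/4) = 0" "k (p + 1/2) (p + 1/4) = 0" "k p (p + 1/4) = 0"
    "k (p + 1/2) (p + 3/4) = 0"
    by (simp_all add: k_def)
  moreover have "k 0 (p - 1/4) = k 1 (p + 3/4)"
  proof -
    have "0 - (p - 1/4) = 1 - (p + 3/4)" by simp
    then show ?thesis using \<open>h 0 = h 1\<close> unfolding k_def by metis
  qed
  ultimately have "w\<^sup>2 * integral {0..p} (\<lambda>x. (h x)\<^sup>2) \<le> integral {0..p} G - k 0 (p - 1/4)"
    "w\<^sup>2 * integral {p..p+1/2} (\<lambda>x. (h x)\<^sup>2) \<le> integral {p..p+1/2} G"
    "w\<^sup>2 * integral {p+1/2..1} (\<lambda>x. (h x)\<^sup>2) \<le> integral {p+1/2..1} G + k 0 (p - 1/4)"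
    using step[of 0 p "p - 1/4"] step[of p "p + 1/2" "p + 1/4"] step[of "p + 1/2" 1 "p + 3/4"] p
    unfolding abs_le_iff by linarith+
  then have "w\<^sup>2 * integral {0..p} (\<lambda>x. (h x)\<^sup>2) + w\<^sup>2 * integral {p..p+1/2} (\<lambda>x. (h x)\<^sup>2)
      + w\<^sup>2 * integral {p+1/2..1} (\<lambda>x. (h x)\<^sup>2)
    \<le> integral {0..p} G + integral {p..p+1/2} G + integral {p+1/2..1} G"
    by linarith
  then have "w\<^sup>2 * integral {0..1} (\<lambda>x. (h x)\<^sup>2) \<le> integral {0..1} G"
    unfolding comb[OF G] comb[OF h2, symmetric] distrib_left .
  then show ?thesis unfolding h_def by blast
qed

subsection \<open>Variance decompositions on the unit square\<close>

definition unit_measure :: "real measure" where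
  "unit_measure = restrict_space lborel {0..1}"

lemma space_unit_measure [simp]: "space unit_measure = {0..1}"
  by (simp add: unit_measure_def space_restrict_space)

lemma measurable_unit_borel [measurable (raw)]:
  "f \<in> borel_measurable borel \<Longrightarrow> f \<in> borel_measurable unit_measure"
  unfolding unit_measure_def by (intro measurable_restrict_space1) simp

lemma nn_integral_unit:
  "(\<integral>\<^sup>+x. f x \<partial>unit_measure) = (\<integral>\<^sup>+x. f x * indicator {0..1} x \<partial>lborel)"
  unfolding unit_measure_def by (rule nn_integral_restrict_space) simp

interpretation unit: prob_space unit_measure
proof
  show "emeasure unit_measure (space unit_measure) = 1"
    unfolding space_unit_measure by (simp add: unit_measure_def emeasure_restrict_space)
qed

interpretation unit2: pair_prob_space unit_measure unit_measure ..

lemma measurable_into_unit: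
  assumes "f \<in> borel_measurable M" "\<And>x. x \<in> space M \<Longrightarrow> f x \<in> {0..1}"
  shows "f \<in> M \<rightarrow>\<^sub>M unit_measure"
  unfolding unit_measure_def using assms
  by (intro measurable_restrict_space2) auto

lemma unit_integrableI:
  fixes g :: "real \<Rightarrow> real"
  assumes "g \<in> borel_measurable unit_measure" "\<And>x. x \<in> {0..1} \<Longrightarrow> \<bar>g x\<bar> \<le> B"
  shows "integrable unit_measure g"
  using assms by (intro unit.integrable_const_bound[where B = B]) auto

lemma unit_integral_HK:
  fixes g :: "real \<Rightarrow> real"
  assumes [measurable]: "g \<in> borel_measurable borel" and "\<And>x. x \<in> {0..1} \<Longrightarrow> \<bar>g x\<bar> \<le> B"
  shows "g integrable_on {0..1}" "(\<integral>x. g x \<partial>unit_measure) = integral {0..1} g"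
proof -
  have "integrable unit_measure g"
    using assms by (intro unit_integrableI) auto
  then have "set_integrable lborel {0..1} g"
    unfolding unit_measure_def set_integrable_def
    by (subst (asm) integrable_restrict_space) auto
  from set_borel_integral_eq_integral[OF this]
  show "g integrable_on {0..1}" "(\<integral>x. g x \<partial>unit_measure) = integral {0..1} g"
    unfolding unit_measure_def set_lebesgue_integral_def
    by (auto simp: integral_restrict_space)
qed

text \<open>Subtraction on the circle of length 1, with representatives kept in
  \<open>{0..1}\<close>; the convention at the seam a = b matters only on a null set.\<close>

definition circle_diff :: "real \<Rightarrow> real \<Rightarrow> real" where
  "circle_diff a b = (if b \<le> a then a - b else 1 + a - b)"

lemma circle_diff_range:
  "a \<in> {0..1} \<Longrightarrow> b \<in> {0..1} \<Longrightarrow> circle_diff a b \<in> {0..1}"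
  by (auto simp: circle_diff_def)

lemma measurable_circle_diff [measurable]:
  "(\<lambda>p. circle_diff (fst p) (snd p)) \<in> unit_measure \<Otimes>\<^sub>M unit_measure \<rightarrow>\<^sub>M unit_measure"
proof (rule measurable_into_unit)
  have "(\<lambda>x. x) \<in> borel_measurable unit_measure"
    by (rule measurable_unit_borel) simp
  from measurable_compose[OF measurable_fst this] measurable_compose[OF measurable_snd this]
  have [measurable]: "fst \<in> borel_measurable (unit_measure \<Otimes>\<^sub>M unit_measure)"
    "snd \<in> borel_measurable (unit_measure \<Otimes>\<^sub>M unit_measure)"
    by auto
  show "(\<lambda>p. circle_diff (fst p) (snd p)) \<in> borel_measurable (unit_measure \<Otimes>\<^sub>M unit_measure)"
    unfolding circle_diff_def by measurable
  fix p assume "p \<in> space (unit_measure \<Otimes>\<^sub>M unit_measure)"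
  then show "circle_diff (fst p) (snd p) \<in> {0..1}"
    by (intro circle_diff_range) (auto simp: space_pair_measure)
qed

text \<open>The intervals [0, a] and (a, 1] are reflected separately, onto [0, a] and [a, 1), which
  fill the unit interval up to single points.\<close>

lemma circle_diff_preserves_measure:
  assumes a: "a \<in> {0..1}"
  shows "distr unit_measure unit_measure (circle_diff a) = unit_measure"
proof (rule measure_eqI)
  have meas: "circle_diff a \<in> unit_measure \<rightarrow>\<^sub>M unit_measure"
    using a by (intro measurable_into_unit circle_diff_range measurable_unit_borel)
      (auto simp: circle_diff_def[abs_def])
  fix A assume "A \<in> sets (distr unit_measure unit_measure (circle_diff a))"
  then have A: "A \<in> sets unit_measure" by simp
  then have [measurable]: "A \<in> sets borel"
    by (auto simp: unit_measure_def sets_restrict_space)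
  have "emeasure (distr unit_measure unit_measure (circle_diff a)) A
      = (\<integral>\<^sup>+x. indicator A x \<partial>distr unit_measure unit_measure (circle_diff a))"
    using A by simp
  also have "\<dots> = (\<integral>\<^sup>+x. indicator A (circle_diff a x) \<partial>unit_measure)"
    using A meas by (intro nn_integral_distr) auto
  also have "\<dots> = (\<integral>\<^sup>+x. indicator A (a - x) * indicator {0..a} x
      + indicator A (1 + a - x) * indicator {a<..1} x \<partial>lborel)"
    unfolding nn_integral_unit using a
    by (intro nn_integral_cong) (auto simp: circle_diff_def split: split_indicator)
  also have "\<dots> = (\<integral>\<^sup>+x. indicator A (a - x) * indicator {0..a} x \<partial>lborel)
      + (\<integral>\<^sup>+x. indicator A (1 + a - x) * indicator {a<..1} x \<partial>lborel)"
    by (intro nn_integral_add) auto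
  also have "(\<integral>\<^sup>+x. indicator A (a - x) * indicator {0..a} x \<partial>lborel)
      = (\<integral>\<^sup>+x. indicator A x * indicator {0..a} x \<partial>lborel)"
    by (subst nn_integral_real_affine[where c = "-1" and t = a])
       (auto intro!: nn_integral_cong split: split_indicator)
  also have "(\<integral>\<^sup>+x. indicator A (1 + a - x) * indicator {a<..1} x \<partial>lborel)
      = (\<integral>\<^sup>+x. indicator A x * indicator {a..<1} x \<partial>lborel)"
    by (subst nn_integral_real_affine[where c = "-1" and t = "1 + a"])
       (auto intro!: nn_integral_cong split: split_indicator)
  also have "(\<integral>\<^sup>+x. indicator A x * indicator {0..a} x \<partial>lborel)
        + (\<integral>\<^sup>+x. indicator A x * indicator {a..<1} x \<partial>lborel)
      = (\<integral>\<^sup>+x. indicator A x * indicator {0..a} x + indicator A x * indicator {a..<1} x \<partial>lborel)"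
    by (intro nn_integral_add[symmetric]) auto
  also have "\<dots> = (\<integral>\<^sup>+x. indicator A x * indicator {0..1} x \<partial>lborel)"
  proof (rule nn_integral_cong_AE)
    show "AE x in lborel. indicator A x * indicator {0..a} x + indicator A x * indicator {a..<1} x
        = (indicator A x * indicator {0..1} x :: ennreal)"
      using AE_lborel_singleton[of a] AE_lborel_singleton[of 1]
      by eventually_elim (use a in \<open>auto split: split_indicator\<close>)
  qed
  also have "\<dots> = emeasure unit_measure A"
    using A by (simp add: nn_integral_unit[symmetric])
  finally show "emeasure (distr unit_measure unit_measure (circle_diff a)) A = emeasure unit_measure A" .
qed simp

lemma integral_circle_diff:
  fixes h :: "real \<Rightarrow> real"
  assumes [measurable]: "h \<in> borel_measurable unit_measure" and t: "t \<in> {0..1}"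
  shows "(\<integral>b. h (circle_diff t b) \<partial>unit_measure) = (\<integral>b. h b \<partial>unit_measure)"
    and "(\<integral>a. h (circle_diff a t) \<partial>unit_measure) = (\<integral>a. h a \<partial>unit_measure)"
    and "(\<integral>a. h (1 - a) \<partial>unit_measure) = (\<integral>a. h a \<partial>unit_measure)"
proof -
  have right: "(\<integral>b. g (circle_diff s b) \<partial>unit_measure) = (\<integral>b. g b \<partial>unit_measure)"
    if "g \<in> borel_measurable unit_measure" "s \<in> {0..1}" for g :: "real \<Rightarrow> real" and s
  proof -
    have "circle_diff s \<in> unit_measure \<rightarrow>\<^sub>M unit_measure"
      using that(2) by (intro measurable_into_unit circle_diff_range measurable_unit_borel)
        (auto simp: circle_diff_def[abs_def])
    from integral_distr[OF this that(1)] circle_diff_preserves_measure[OF that(2)] show ?thesis by simp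
  qed
  show "(\<integral>b. h (circle_diff t b) \<partial>unit_measure) = (\<integral>b. h b \<partial>unit_measure)"
    using right[OF assms] .
  have minus: "(\<integral>a. g (1 - a) \<partial>unit_measure) = (\<integral>a. g a \<partial>unit_measure)"
    if "g \<in> borel_measurable unit_measure" for g :: "real \<Rightarrow> real"
  proof -
    have "(\<integral>a. g (1 - a) \<partial>unit_measure) = (\<integral>a. g (circle_diff 1 a) \<partial>unit_measure)"
      by (intro Bochner_Integration.integral_cong) (auto simp: circle_diff_def)
    then show ?thesis using right[OF that, of 1] by simp
  qed
  show "(\<integral>a. h (1 - a) \<partial>unit_measure) = (\<integral>a. h a \<partial>unit_measure)"
    by (rule minus) simp
  have flip: "(\<lambda>x. 1 - x) \<in> unit_measure \<rightarrow>\<^sub>M unit_measure"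
    and left: "(\<lambda>a. circle_diff a t) \<in> unit_measure \<rightarrow>\<^sub>M unit_measure"
    and row: "circle_diff t \<in> unit_measure \<rightarrow>\<^sub>M unit_measure"
    using t by (intro measurable_into_unit circle_diff_range measurable_unit_borel;
        auto simp: circle_diff_def[abs_def])+
  have hm: "(\<lambda>x. h (1 - x)) \<in> borel_measurable unit_measure"
    using measurable_compose[OF flip assms(1)] .
  \<comment> \<open>Away from the seam, moving the first argument is the same as moving the second
    and then applying x -> 1 - x.\<close>
  have "AE a in unit_measure. a \<noteq> t"
    unfolding unit_measure_def using AE_lborel_singleton[of t]
    by (subst AE_restrict_space_iff) (auto elim: eventually_mono)
  then have "AE a in unit_measure. h (circle_diff a t) = h (1 - circle_diff t a)"
  proof eventually_elim
    case (elim a)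
    then have "circle_diff a t = 1 - circle_diff t a" by (auto simp: circle_diff_def)
    then show ?case by simp
  qed
  then have "(\<integral>a. h (circle_diff a t) \<partial>unit_measure) = (\<integral>a. h (1 - circle_diff t a) \<partial>unit_measure)"
    using measurable_compose[OF left assms(1)] measurable_compose[OF row hm] by (intro integral_cong_AE)
  also have "\<dots> = (\<integral>a. h a \<partial>unit_measure)"
    using right[OF hm t] minus[OF assms(1)] by simp
  finally show "(\<integral>a. h (circle_diff a t) \<partial>unit_measure) = (\<integral>a. h a \<partial>unit_measure)" .
qed

section \<open>Bounded functions on the unit square and their iterated integrals\<close>

abbreviation square_measure :: "(real \<times> real) measure" where
  "square_measure \<equiv> unit_measure \<Otimes>\<^sub>M unit_measure"

text \<open>A class of curried functions, closed under sums and products, on which every integral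
  below is finite and the order of integration may be exchanged.\<close>

definition square_bounded :: "(real \<Rightarrow> real \<Rightarrow> real) \<Rightarrow> bool" where
  "square_bounded h \<longleftrightarrow> (\<lambda>p. h (fst p) (snd p)) \<in> borel_measurable square_measure \<and>
    (\<exists>B. \<forall>a\<in>{0..1}. \<forall>b\<in>{0..1}. \<bar>h a b\<bar> \<le> B)"

definition square_integral :: "(real \<Rightarrow> real \<Rightarrow> real) \<Rightarrow> real" where
  "square_integral h = (\<integral>p. h (fst p) (snd p) \<partial>square_measure)"

lemma square_bounded_integrable:
  assumes "square_bounded h"
  shows "integrable square_measure (\<lambda>p. h (fst p) (snd p))"
proof -
  from assms obtain B where "\<And>a b. a \<in> {0..1} \<Longrightarrow> b \<in> {0..1} \<Longrightarrow> \<bar>h a b\<bar> \<le> B"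
    unfolding square_bounded_def by blast
  then show ?thesis using assms
    by (intro unit2.P.integrable_const_bound[where B = B])
       (auto simp: square_bounded_def space_pair_measure)
qed

lemma square_bounded_add:
  assumes "square_bounded f" "square_bounded g"
  shows "square_bounded (\<lambda>a b. f a b + g a b)"
proof -
  from assms obtain B C where
    B: "\<And>a b. a \<in> {0..1} \<Longrightarrow> b \<in> {0..1} \<Longrightarrow> \<bar>f a b\<bar> \<le> B" and
    C: "\<And>a b. a \<in> {0..1} \<Longrightarrow> b \<in> {0..1} \<Longrightarrow> \<bar>g a b\<bar> \<le> C"
    unfolding square_bounded_def by blast
  have "\<bar>f a b + g a b\<bar> \<le> B + C" if "a \<in> {0..1}" "b \<in> {0..1}" for a b
    using B[OF that] C[OF that] by linarith
  then show ?thesis using assms by (auto simp: square_bounded_def intro!: exI[of _ "B + C"])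
qed

lemma square_bounded_mult:
  assumes "square_bounded f" "square_bounded g"
  shows "square_bounded (\<lambda>a b. f a b * g a b)"
proof -
  from assms obtain B C where
    B: "\<And>a b. a \<in> {0..1} \<Longrightarrow> b \<in> {0..1} \<Longrightarrow> \<bar>f a b\<bar> \<le> B" and
    C: "\<And>a b. a \<in> {0..1} \<Longrightarrow> b \<in> {0..1} \<Longrightarrow> \<bar>g a b\<bar> \<le> C"
    unfolding square_bounded_def by blast
  have "\<bar>f a b * g a b\<bar> \<le> B * C" if "a \<in> {0..1}" "b \<in> {0..1}" for a b
    unfolding abs_mult using B[OF that] C[OF that] by (intro mult_mono) auto
  then show ?thesis using assms by (auto simp: square_bounded_def intro!: exI[of _ "B * C"])
qed

lemma square_bounded_const: "square_bounded (\<lambda>a b. c)"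
  by (auto simp: square_bounded_def)

lemma square_bounded_diff:
  assumes "square_bounded f" "square_bounded g"
  shows "square_bounded (\<lambda>a b. f a b - g a b)"
  using square_bounded_add[OF assms(1) square_bounded_mult[OF square_bounded_const[of "-1"] assms(2)]]
  by simp

lemma square_bounded_power2:
  "square_bounded f \<Longrightarrow> square_bounded (\<lambda>a b. (f a b)\<^sup>2)"
  using square_bounded_mult[of f f] by (simp add: power2_eq_square)

lemma square_bounded_one_variable:
  assumes [measurable]: "u \<in> borel_measurable unit_measure" and "\<And>x. x \<in> {0..1} \<Longrightarrow> \<bar>u x\<bar> \<le> B"
  shows "square_bounded (\<lambda>a b. u b)" "square_bounded (\<lambda>a b. u (1 - a))"
    "square_bounded (\<lambda>a b. u (circle_diff a b))"
proof -
  have "(\<lambda>x. 1 - x) \<in> unit_measure \<rightarrow>\<^sub>M unit_measure"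
    by (intro measurable_into_unit measurable_unit_borel) auto
  then have "(\<lambda>a. u (1 - a)) \<in> borel_measurable unit_measure"
    by (rule measurable_compose) simp
  then show "square_bounded (\<lambda>a b. u (1 - a))"
    using assms(2) unfolding square_bounded_def by (auto intro!: exI[of _ B])
qed (use assms circle_diff_range in \<open>auto simp: square_bounded_def intro!: exI[of _ B]\<close>)

lemma square_integral_add:
  "square_bounded f \<Longrightarrow> square_bounded g \<Longrightarrow>
    square_integral (\<lambda>a b. f a b + g a b) = square_integral f + square_integral g"
  unfolding square_integral_def
  by (intro Bochner_Integration.integral_add square_bounded_integrable)

lemma square_integral_diff:
  "square_bounded f \<Longrightarrow> square_bounded g \<Longrightarrow>
    square_integral (\<lambda>a b. f a b - g a b) = square_integral f - square_integral g"
  unfolding square_integral_def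
  by (intro Bochner_Integration.integral_diff square_bounded_integrable)

lemma square_integral_cmult:
  "square_integral (\<lambda>a b. c * f a b) = c * square_integral f"
  unfolding square_integral_def by simp

lemma square_integral_const: "square_integral (\<lambda>a b. c) = c"
  unfolding square_integral_def using unit2.P.prob_space by simp

lemma square_integral_nonneg:
  "(\<And>a b. 0 \<le> f a b) \<Longrightarrow> 0 \<le> square_integral f"
  unfolding square_integral_def by (intro Bochner_Integration.integral_nonneg)

lemma square_integral_iterated:
  assumes "square_bounded h"
  shows "square_integral h = (\<integral>a. (\<integral>b. h a b \<partial>unit_measure) \<partial>unit_measure)"
    and "square_integral h = (\<integral>b. (\<integral>a. h a b \<partial>unit_measure) \<partial>unit_measure)"
  using unit2.integral_fst[of h] unit2.integral_snd[of h] square_bounded_integrable[OF assms]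
  by (simp_all add: square_integral_def case_prod_beta')

lemma square_bounded_slice:
  assumes F: "square_bounded F" and b: "b \<in> {0..1}"
  shows "integrable unit_measure (\<lambda>a. F a b)"
proof -
  from F obtain B where B: "\<And>a b. a \<in> {0..1} \<Longrightarrow> b \<in> {0..1} \<Longrightarrow> \<bar>F a b\<bar> \<le> B"
    unfolding square_bounded_def by blast
  have "(\<lambda>a. (a, b)) \<in> unit_measure \<rightarrow>\<^sub>M square_measure"
    using b by (intro measurable_Pair2') simp
  from measurable_compose[OF this, of "\<lambda>p. F (fst p) (snd p)" borel] F
  have "(\<lambda>a. F a b) \<in> borel_measurable unit_measure"
    unfolding square_bounded_def by simp
  then show ?thesis using B b by (intro unit_integrableI) auto
qed

lemma square_slice_mean:
  assumes "square_bounded F"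
  shows "(\<lambda>b. \<integral>a. F a b \<partial>unit_measure) \<in> borel_measurable unit_measure"
    "\<exists>B. \<forall>b\<in>{0..1}. \<bar>\<integral>a. F a b \<partial>unit_measure\<bar> \<le> B"
proof -
  have m [measurable]: "(\<lambda>p. F (fst p) (snd p)) \<in> borel_measurable square_measure"
    using assms by (simp add: square_bounded_def)
  have m': "(\<lambda>p. F (snd p) (fst p)) \<in> borel_measurable square_measure"
    using measurable_compose[OF measurable_pair_swap' m] by (simp add: case_prod_beta')
  then show "(\<lambda>b. \<integral>a. F a b \<partial>unit_measure) \<in> borel_measurable unit_measure"
    by (intro unit.borel_measurable_lebesgue_integral) (simp add: case_prod_beta')
  from assms obtain B where B: "\<And>a b. a \<in> {0..1} \<Longrightarrow> b \<in> {0..1} \<Longrightarrow> \<bar>F a b\<bar> \<le> B"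
    unfolding square_bounded_def by blast
  have "\<bar>\<integral>a. F a b \<partial>unit_measure\<bar> \<le> B" if b: "b \<in> {0..1}" for b
  proof -
    note int = square_bounded_slice[OF assms b]
    have "\<bar>\<integral>a. F a b \<partial>unit_measure\<bar> \<le> (\<integral>a. \<bar>F a b\<bar> \<partial>unit_measure)"
      by (rule integral_abs_bound)
    also have "\<dots> \<le> (\<integral>a. B \<partial>unit_measure)"
      using int B b
      by (intro integral_mono) auto
    also have "\<dots> = B" using unit.prob_space by simp
    finally show ?thesis .
  qed
  then show "\<exists>B. \<forall>b\<in>{0..1}. \<bar>\<integral>a. F a b \<partial>unit_measure\<bar> \<le> B" by blast
qed

section \<open>Orthogonal averages and slice variances\<close>

lemma square_integral_project:
  assumes "square_bounded F" "square_bounded (\<lambda>a b. u b)"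
  shows "square_integral (\<lambda>a b. F a b * u b)
    = (\<integral>b. (\<integral>a. F a b \<partial>unit_measure) * u b \<partial>unit_measure)"
  using square_integral_iterated(2)[OF square_bounded_mult[OF assms]] by simp

text \<open>Bessel's inequality: the assumptions hold if \<open>\<Phi>\<close> is a sum of \<open>n\<close> mutually orthogonal projections of \<open>F\<close>,
  each of them equidistributed with \<open>u\<close>.\<close>

lemma slice_variance_ge:
  assumes F: "square_bounded F" and u: "u = (\<lambda>b. \<integral>a. F a b \<partial>unit_measure)"
    and \<Phi>: "square_bounded \<Phi>"
    and "square_integral (\<lambda>a b. F a b * \<Phi> a b) = n * (\<integral>b. (u b)\<^sup>2 \<partial>unit_measure)"
    and "square_integral (\<lambda>a b. (\<Phi> a b)\<^sup>2) = n * (\<integral>b. (u b)\<^sup>2 \<partial>unit_measure)"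
  shows "(n - 1) * square_integral (\<lambda>a b. (F a b)\<^sup>2) \<le> n * square_integral (\<lambda>a b. (F a b - u b)\<^sup>2)"
proof -
  let ?s = "\<integral>b. (u b)\<^sup>2 \<partial>unit_measure"
  have ub: "square_bounded (\<lambda>a b. u b)"
    using square_slice_mean[OF F] unfolding u by (metis square_bounded_one_variable(1))
  have expand: "square_integral (\<lambda>a b. (F a b - G a b)\<^sup>2)
      = square_integral (\<lambda>a b. (F a b)\<^sup>2) - 2 * square_integral (\<lambda>a b. F a b * G a b)
        + square_integral (\<lambda>a b. (G a b)\<^sup>2)" if G: "square_bounded G" for G
  proof -
    have "square_integral (\<lambda>a b. (F a b - G a b)\<^sup>2)
        = square_integral (\<lambda>a b. ((F a b)\<^sup>2 - 2 * (F a b * G a b)) + (G a b)\<^sup>2)"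
      by (simp add: power2_diff algebra_simps)
    also have "\<dots> = square_integral (\<lambda>a b. (F a b)\<^sup>2) - square_integral (\<lambda>a b. 2 * (F a b * G a b))
        + square_integral (\<lambda>a b. (G a b)\<^sup>2)"
    proof -
      have b: "square_bounded (\<lambda>a b. 2 * (F a b * G a b))"
        by (intro square_bounded_mult square_bounded_const F G)
      show ?thesis
        using square_integral_add[OF square_bounded_diff[OF square_bounded_power2[OF F] b] square_bounded_power2[OF G]]
          square_integral_diff[OF square_bounded_power2[OF F] b] by simp
    qed
    finally show ?thesis by (simp add: square_integral_cmult)
  qed
  have "square_integral (\<lambda>a b. F a b * u b) = ?s"
    using square_integral_project[OF F ub] by (simp add: u power2_eq_square)
  moreover have "square_integral (\<lambda>a b. (u b)\<^sup>2) = ?s"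
    using square_integral_iterated(2)[OF square_bounded_power2[OF ub]] unit.prob_space by simp
  ultimately have slice: "square_integral (\<lambda>a b. (F a b - u b)\<^sup>2) = square_integral (\<lambda>a b. (F a b)\<^sup>2) - ?s"
    using expand[OF ub] by simp
  \<comment> \<open>With the two assumed integrals this reads 0 <= (integral of F^2) - 2 n s + n s,
    where s is the square norm of \<open>u\<close>: the n orthogonal averages fit into F.\<close>
  have "0 \<le> square_integral (\<lambda>a b. (F a b - \<Phi> a b)\<^sup>2)"
    by (rule square_integral_nonneg) simp
  then have "n * ?s \<le> square_integral (\<lambda>a b. (F a b)\<^sup>2)"
    using expand[OF \<Phi>] assms(4,5) by simp
  then show ?thesis unfolding slice by (simp add: algebra_simps)
qed

lemma square_integral_sum3_power2:
  assumes "square_bounded p" "square_bounded q" "square_bounded r"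
    and "square_integral (\<lambda>a b. (p a b)\<^sup>2) = s" "square_integral (\<lambda>a b. (q a b)\<^sup>2) = s"
    "square_integral (\<lambda>a b. (r a b)\<^sup>2) = s" "square_integral (\<lambda>a b. p a b * q a b) = 0"
    "square_integral (\<lambda>a b. p a b * r a b) = 0" "square_integral (\<lambda>a b. q a b * r a b) = 0"
  shows "square_integral (\<lambda>a b. (p a b + q a b + r a b)\<^sup>2) = 3 * s"
proof -
  have "square_integral (\<lambda>a b. (p a b + q a b + r a b)\<^sup>2) = square_integral (\<lambda>a b.
    (((p a b)\<^sup>2 + (q a b)\<^sup>2) + (r a b)\<^sup>2) + 2 * ((p a b * q a b + p a b * r a b) + q a b * r a b))"
    by (simp add: power2_eq_square algebra_simps)
  also have "\<dots> = square_integral (\<lambda>a b. ((p a b)\<^sup>2 + (q a b)\<^sup>2) + (r a b)\<^sup>2)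
      + square_integral (\<lambda>a b. 2 * ((p a b * q a b + p a b * r a b) + q a b * r a b))"
    by (intro square_integral_add square_bounded_add square_bounded_mult square_bounded_power2
        square_bounded_const assms)
  also have "square_integral (\<lambda>a b. ((p a b)\<^sup>2 + (q a b)\<^sup>2) + (r a b)\<^sup>2)
      = square_integral (\<lambda>a b. (p a b)\<^sup>2 + (q a b)\<^sup>2) + square_integral (\<lambda>a b. (r a b)\<^sup>2)"
    by (intro square_integral_add square_bounded_add square_bounded_power2 assms)
  also have "square_integral (\<lambda>a b. (p a b)\<^sup>2 + (q a b)\<^sup>2)
      = square_integral (\<lambda>a b. (p a b)\<^sup>2) + square_integral (\<lambda>a b. (q a b)\<^sup>2)"
    by (intro square_integral_add square_bounded_power2 assms)
  also have "square_integral (\<lambda>a b. 2 * ((p a b * q a b + p a b * r a b) + q a b * r a b))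
      = 2 * square_integral (\<lambda>a b. (p a b * q a b + p a b * r a b) + q a b * r a b)"
    by (rule square_integral_cmult)
  also have "square_integral (\<lambda>a b. (p a b * q a b + p a b * r a b) + q a b * r a b)
      = square_integral (\<lambda>a b. p a b * q a b + p a b * r a b) + square_integral (\<lambda>a b. q a b * r a b)"
    by (intro square_integral_add square_bounded_add square_bounded_mult assms)
  also have "square_integral (\<lambda>a b. p a b * q a b + p a b * r a b)
      = square_integral (\<lambda>a b. p a b * q a b) + square_integral (\<lambda>a b. p a b * r a b)"
    by (intro square_integral_add square_bounded_mult assms)
  finally show ?thesis using assms by simp
qed

lemma slice_variance_shift:
  assumes F: "square_bounded F"
  shows "square_integral (\<lambda>a b. (F a b - c - (\<integral>x. F x b - c \<partial>unit_measure))\<^sup>2)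
    = square_integral (\<lambda>a b. (F a b - (\<integral>x. F x b \<partial>unit_measure))\<^sup>2)"
  unfolding square_integral_def
proof (intro Bochner_Integration.integral_cong refl)
  fix p assume "p \<in> space square_measure"
  then have "snd p \<in> {0..1}" by (auto simp: space_pair_measure)
  from square_bounded_slice[OF F this]
  have "(\<integral>x. F x (snd p) - c \<partial>unit_measure) = (\<integral>x. F x (snd p) \<partial>unit_measure) - c"
    using unit.prob_space by simp
  then show "(F (fst p) (snd p) - c - (\<integral>x. F x (snd p) - c \<partial>unit_measure))\<^sup>2
      = (F (fst p) (snd p) - (\<integral>x. F x (snd p) \<partial>unit_measure))\<^sup>2"
    by simp
qed

text \<open>After centring, the averages u(b) and u(a) over the two axis directions are orthogonal,
  because a and b are independent and u has mean zero; by symmetry they come from the same function.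
  Hence averaging along one direction keeps at most half of the variance.\<close>

lemma variance_le_slice_variance_symmetric:
  assumes F: "square_bounded F"
    and sym: "\<And>a b. a \<in> {0..1} \<Longrightarrow> b \<in> {0..1} \<Longrightarrow> F b a = F a b"
  shows "square_integral (\<lambda>a b. (F a b - square_integral F)\<^sup>2)
    \<le> 2 * square_integral (\<lambda>a b. (F a b - (\<integral>x. F x b \<partial>unit_measure))\<^sup>2)"
proof -
  define H where "H = (\<lambda>a b. F a b - square_integral F)"
  define u where "u = (\<lambda>b. \<integral>a. H a b \<partial>unit_measure)"
  have H: "square_bounded H"
    unfolding H_def by (intro square_bounded_diff square_bounded_const F)
  have H0: "square_integral H = 0"
    unfolding H_def using square_integral_diff[OF F square_bounded_const] by (simp add: square_integral_const)
  obtain B where um [measurable]: "u \<in> borel_measurable unit_measure" and B: "\<And>b. b \<in> {0..1} \<Longrightarrow> \<bar>u b\<bar> \<le> B"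
    using square_slice_mean[OF H] unfolding u_def by blast
  note ub = square_bounded_one_variable[OF um B]
  have ua: "square_bounded (\<lambda>a b. u a)"
    using B by (auto simp: square_bounded_def intro!: exI[of _ B])
  have mean: "(\<integral>b. u b \<partial>unit_measure) = 0"
    using square_integral_iterated(2)[OF H] H0 by (simp add: u_def)
  let ?s = "\<integral>b. (u b)\<^sup>2 \<partial>unit_measure"
  have col: "(\<integral>b. H a b \<partial>unit_measure) = u a" if "a \<in> {0..1}" for a
    unfolding u_def using that by (intro Bochner_Integration.integral_cong) (auto simp: H_def sym)
  have Fb: "square_integral (\<lambda>a b. H a b * u b) = ?s"
    using square_integral_project[OF H ub(1)] by (simp add: u_def power2_eq_square)
  have Fa: "square_integral (\<lambda>a b. H a b * u a) = ?s"
    unfolding square_integral_iterated(1)[OF square_bounded_mult[OF H ua]]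
    by (intro Bochner_Integration.integral_cong) (auto simp: col power2_eq_square)
  have cross: "square_integral (\<lambda>a b. u b * u a) = 0"
    using square_integral_iterated(2)[OF square_bounded_mult[OF ub(1) ua]] mean by simp
  have sq: "square_integral (\<lambda>a b. (u b)\<^sup>2) = ?s" "square_integral (\<lambda>a b. (u a)\<^sup>2) = ?s"
    using square_integral_iterated(2)[OF square_bounded_power2[OF ub(1)]]
      square_integral_iterated(1)[OF square_bounded_power2[OF ua]] unit.prob_space by simp_all
  have "(2 - 1) * square_integral (\<lambda>a b. (H a b)\<^sup>2) \<le> 2 * square_integral (\<lambda>a b. (H a b - u b)\<^sup>2)"
  proof (rule slice_variance_ge[OF H u_def, where \<Phi> = "\<lambda>a b. u b + u a"])
    show "square_integral (\<lambda>a b. H a b * (u b + u a)) = 2 * ?s"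
      using square_integral_add[OF square_bounded_mult[OF H ub(1)] square_bounded_mult[OF H ua]] Fa Fb
      by (simp add: distrib_left)
    have "square_integral (\<lambda>a b. (u b + u a)\<^sup>2)
        = square_integral (\<lambda>a b. ((u b)\<^sup>2 + (u a)\<^sup>2) + 2 * (u b * u a))"
      by (simp add: power2_eq_square algebra_simps)
    also have "\<dots> = square_integral (\<lambda>a b. (u b)\<^sup>2 + (u a)\<^sup>2) + square_integral (\<lambda>a b. 2 * (u b * u a))"
      by (intro square_integral_add square_bounded_add square_bounded_mult square_bounded_power2
        square_bounded_const ub ua)
    also have "\<dots> = 2 * ?s"
      using square_integral_add[OF square_bounded_power2[OF ub(1)] square_bounded_power2[OF ua]]
      by (simp add: sq square_integral_cmult cross)
    finally show "square_integral (\<lambda>a b. (u b + u a)\<^sup>2) = 2 * ?s" .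
  qed (intro square_bounded_add ub ua)
  moreover have "square_integral (\<lambda>a b. (H a b - u b)\<^sup>2)
      = square_integral (\<lambda>a b. (F a b - (\<integral>x. F x b \<partial>unit_measure))\<^sup>2)"
    unfolding H_def u_def by (rule slice_variance_shift[OF F])
  ultimately show ?thesis by (simp add: H_def)
qed

text \<open>The symmetries (a, b) -> (1 - b, 1 - a) and (a, b) -> (a, a - b mod 1) carry the
  coordinate b to 1 - a and to a - b. So the averages over the lines on which b, a or a - b is
  constant are all values of one function u, and after centring they are pairwise orthogonal. Each
  of them carries at most a third of the variance, so at least two thirds remain within the
  slices.\<close>

lemma variance_le_slice_variance_hexagonal:
  assumes F: "square_bounded F"
    and sym1: "\<And>a b. a \<in> {0..1} \<Longrightarrow> b \<in> {0..1} \<Longrightarrow> F (1 - b) (1 - a) = F a b"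
    and sym2: "\<And>a b. a \<in> {0..1} \<Longrightarrow> b \<in> {0..1} \<Longrightarrow> F a (circle_diff a b) = F a b"
  shows "2 * square_integral (\<lambda>a b. (F a b - square_integral F)\<^sup>2)
    \<le> 3 * square_integral (\<lambda>a b. (F a b - (\<integral>x. F x b \<partial>unit_measure))\<^sup>2)"
proof -
  define H where "H = (\<lambda>a b. F a b - square_integral F)"
  define u where "u = (\<lambda>b. \<integral>a. H a b \<partial>unit_measure)"
  have H: "square_bounded H"
    unfolding H_def by (intro square_bounded_diff square_bounded_const F)
  have H0: "square_integral H = 0"
    unfolding H_def using square_integral_diff[OF F square_bounded_const] by (simp add: square_integral_const)
  obtain B where um [measurable]: "u \<in> borel_measurable unit_measure" and B: "\<And>b. b \<in> {0..1} \<Longrightarrow> \<bar>u b\<bar> \<le> B"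
    using square_slice_mean[OF H] unfolding u_def by blast
  note ub = square_bounded_one_variable[OF um B]
  have row_measurable: "(\<lambda>b. H a b) \<in> borel_measurable unit_measure" if "a \<in> {0..1}" for a
  proof -
    have "(\<lambda>b. (a, b)) \<in> unit_measure \<rightarrow>\<^sub>M square_measure"
      using that by (intro measurable_Pair1') simp
    from measurable_compose[OF this, of "\<lambda>p. H (fst p) (snd p)" borel] H
    show ?thesis unfolding square_bounded_def by simp
  qed
  have mean: "(\<integral>b. u b \<partial>unit_measure) = 0"
    using square_integral_iterated(2)[OF H] H0 by (simp add: u_def)
  let ?s = "\<integral>b. (u b)\<^sup>2 \<partial>unit_measure"
  have row: "(\<integral>b. H a b \<partial>unit_measure) = u (1 - a)" if a: "a \<in> {0..1}" for a
  proof -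
    have "(\<integral>b. H a b \<partial>unit_measure) = (\<integral>b. H a (1 - b) \<partial>unit_measure)"
      using integral_circle_diff(3)[OF row_measurable[OF a] a] by simp
    also have "\<dots> = (\<integral>b. H b (1 - a) \<partial>unit_measure)"
    proof (intro Bochner_Integration.integral_cong refl)
      fix b assume "b \<in> space unit_measure"
      then show "H a (1 - b) = H b (1 - a)"
        using sym1[of b "1 - a"] a by (simp add: H_def)
    qed
    finally show ?thesis by (simp add: u_def)
  qed
  have F1: "square_integral (\<lambda>a b. H a b * u b) = ?s"
    using square_integral_project[OF H ub(1)] by (simp add: u_def power2_eq_square)
  have F2: "square_integral (\<lambda>a b. H a b * u (1 - a)) = ?s"
  proof -
    have "square_integral (\<lambda>a b. H a b * u (1 - a))
        = (\<integral>a. (\<integral>b. H a b * u (1 - a) \<partial>unit_measure) \<partial>unit_measure)"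
      by (rule square_integral_iterated(1)[OF square_bounded_mult[OF H ub(2)]])
    also have "\<dots> = (\<integral>a. (u (1 - a))\<^sup>2 \<partial>unit_measure)"
      by (intro Bochner_Integration.integral_cong) (auto simp: row power2_eq_square)
    also have "\<dots> = ?s"
      by (rule integral_circle_diff(3)[where t = 0]) auto
    finally show ?thesis .
  qed
  have F3: "square_integral (\<lambda>a b. H a b * u (circle_diff a b)) = ?s"
  proof -
    have "square_integral (\<lambda>a b. H a b * u (circle_diff a b))
        = (\<integral>a. (\<integral>b. H a b * u (circle_diff a b) \<partial>unit_measure) \<partial>unit_measure)"
      by (rule square_integral_iterated(1)[OF square_bounded_mult[OF H ub(3)]])
    also have "\<dots> = (\<integral>a. (\<integral>b. H a b * u b \<partial>unit_measure) \<partial>unit_measure)"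
    proof (rule Bochner_Integration.integral_cong[OF refl])
      fix a assume "a \<in> space unit_measure"
      then have a: "a \<in> {0..1}" by simp
      have "(\<integral>b. H a b * u (circle_diff a b) \<partial>unit_measure)
          = (\<integral>b. H a (circle_diff a b) * u (circle_diff a b) \<partial>unit_measure)"
        using a by (intro Bochner_Integration.integral_cong) (auto simp: H_def sym2)
      also have "\<dots> = (\<integral>b. H a b * u b \<partial>unit_measure)"
        using row_measurable[OF a] by (intro integral_circle_diff(1)[OF _ a, of "\<lambda>b. H a b * u b"]) simp
      finally show "(\<integral>b. H a b * u (circle_diff a b) \<partial>unit_measure) = (\<integral>b. H a b * u b \<partial>unit_measure)" .
    qed
    also have "\<dots> = square_integral (\<lambda>a b. H a b * u b)"
      by (rule square_integral_iterated(1)[OF square_bounded_mult[OF H ub(1)], symmetric])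
    finally show ?thesis using F1 by simp
  qed
  have sq1: "square_integral (\<lambda>a b. (u b)\<^sup>2) = ?s"
    using square_integral_iterated(2)[OF square_bounded_power2[OF ub(1)]] unit.prob_space by simp
  have sq2: "square_integral (\<lambda>a b. (u (1 - a))\<^sup>2) = ?s"
    using square_integral_iterated(1)[OF square_bounded_power2[OF ub(2)]] unit.prob_space
      integral_circle_diff(3)[of "\<lambda>x. (u x)\<^sup>2" 0] by simp
  have sq3: "square_integral (\<lambda>a b. (u (circle_diff a b))\<^sup>2) = ?s"
  proof -
    have "square_integral (\<lambda>a b. (u (circle_diff a b))\<^sup>2)
        = (\<integral>a. (\<integral>b. (u (circle_diff a b))\<^sup>2 \<partial>unit_measure) \<partial>unit_measure)"
      by (rule square_integral_iterated(1)[OF square_bounded_power2[OF ub(3)]])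
    also have "\<dots> = (\<integral>a. ?s \<partial>unit_measure)"
      by (rule Bochner_Integration.integral_cong[OF refl], rule integral_circle_diff(1)[of "\<lambda>x. (u x)\<^sup>2"]) auto
    finally show ?thesis using unit.prob_space by simp
  qed
  \<comment> \<open>In each of the three cross terms the order of integration is chosen so that the
    inner variable occurs in one factor only; that factor then integrates to the mean of u, which is
    zero.\<close>
  have cross12: "square_integral (\<lambda>a b. u b * u (1 - a)) = 0"
    using square_integral_iterated(1)[OF square_bounded_mult[OF ub(1,2)]] mean by simp
  have cross13: "square_integral (\<lambda>a b. u b * u (circle_diff a b)) = 0"
  proof -
    have "square_integral (\<lambda>a b. u b * u (circle_diff a b))
        = (\<integral>b. (\<integral>a. u b * u (circle_diff a b) \<partial>unit_measure) \<partial>unit_measure)"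
      by (rule square_integral_iterated(2)[OF square_bounded_mult[OF ub(1,3)]])
    also have "\<dots> = (\<integral>b. 0 \<partial>unit_measure)"
      by (rule Bochner_Integration.integral_cong[OF refl]) (simp add: integral_circle_diff(2) mean)
    finally show ?thesis by simp
  qed
  have cross23: "square_integral (\<lambda>a b. u (1 - a) * u (circle_diff a b)) = 0"
  proof -
    have "square_integral (\<lambda>a b. u (1 - a) * u (circle_diff a b))
        = (\<integral>a. (\<integral>b. u (1 - a) * u (circle_diff a b) \<partial>unit_measure) \<partial>unit_measure)"
      by (rule square_integral_iterated(1)[OF square_bounded_mult[OF ub(2,3)]])
    also have "\<dots> = (\<integral>b. 0 \<partial>unit_measure)"
      by (rule Bochner_Integration.integral_cong[OF refl]) (simp add: integral_circle_diff(1) mean)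
    finally show ?thesis by simp
  qed
  have "(3 - 1) * square_integral (\<lambda>a b. (H a b)\<^sup>2) \<le> 3 * square_integral (\<lambda>a b. (H a b - u b)\<^sup>2)"
  proof (rule slice_variance_ge[OF H u_def, where \<Phi> = "\<lambda>a b. u b + u (1 - a) + u (circle_diff a b)"])
    have "square_integral (\<lambda>a b. H a b * (u b + u (1 - a) + u (circle_diff a b)))
        = square_integral (\<lambda>a b. (H a b * u b + H a b * u (1 - a)) + H a b * u (circle_diff a b))"
      by (simp add: distrib_left)
    also have "\<dots> = square_integral (\<lambda>a b. H a b * u b + H a b * u (1 - a))
        + square_integral (\<lambda>a b. H a b * u (circle_diff a b))"
      by (intro square_integral_add square_bounded_add square_bounded_mult H ub)
    also have "square_integral (\<lambda>a b. H a b * u b + H a b * u (1 - a))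
        = square_integral (\<lambda>a b. H a b * u b) + square_integral (\<lambda>a b. H a b * u (1 - a))"
      by (intro square_integral_add square_bounded_mult H ub)
    finally show "square_integral (\<lambda>a b. H a b * (u b + u (1 - a) + u (circle_diff a b))) = 3 * ?s"
      using F1 F2 F3 by simp
    show "square_integral (\<lambda>a b. (u b + u (1 - a) + u (circle_diff a b))\<^sup>2) = 3 * ?s"
      by (intro square_integral_sum3_power2 ub sq1 sq2 sq3 cross12 cross13 cross23)
  qed (intro square_bounded_add ub)
  moreover have "square_integral (\<lambda>a b. (H a b - u b)\<^sup>2)
      = square_integral (\<lambda>a b. (F a b - (\<integral>x. F x b \<partial>unit_measure))\<^sup>2)"
    unfolding H_def u_def by (rule slice_variance_shift[OF F])
  ultimately show ?thesis by (simp add: H_def)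
qed

subsection \<open>Piecewise affine foldings of the square\<close>

lemma square_boundedI:
  assumes "(\<lambda>p. h (fst p) (snd p)) \<in> borel_measurable borel"
    and "\<And>a b. a \<in> {0..1} \<Longrightarrow> b \<in> {0..1} \<Longrightarrow> \<bar>h a b\<bar> \<le> B"
  shows "square_bounded h"
proof -
  have "(\<lambda>x. x) \<in> borel_measurable unit_measure"
    by (rule measurable_unit_borel) simp
  from measurable_compose[OF measurable_fst this] measurable_compose[OF measurable_snd this]
  have "(\<lambda>p. (fst p, snd p)) \<in> square_measure \<rightarrow>\<^sub>M borel"
    by (intro borel_measurable_Pair) auto
  from measurable_compose[OF this assms(1)] assms(2) show ?thesis
    unfolding square_bounded_def by (auto intro!: exI[of _ B])
qed

lemma borel_slice:
  fixes h :: "real \<Rightarrow> real \<Rightarrow> real"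
  assumes "(\<lambda>p. h (fst p) (snd p)) \<in> borel_measurable borel"
  shows "(\<lambda>a. h a b) \<in> borel_measurable (borel :: real measure)"
proof -
  have "(\<lambda>a. (a, b)) \<in> borel_measurable borel"
    by (intro borel_measurable_continuous_onI continuous_intros)
  from measurable_compose[OF this assms] show ?thesis by simp
qed

text \<open>The constant A supplied by a Wirtinger inequality may depend on the slice without any
  measurability in b. The slice mean is the optimal constant and does depend measurably on b, so A
  is replaced by it before integrating. The slices b = 0 and b = 1 form a null set.\<close>

lemma square_slice_variance_le:
  fixes F G :: "real \<Rightarrow> real \<Rightarrow> real"
  assumes F: "(\<lambda>p. F (fst p) (snd p)) \<in> borel_measurable borel"
    and FB: "\<And>a b. a \<in> {0..1} \<Longrightarrow> b \<in> {0..1} \<Longrightarrow> \<bar>F a b\<bar> \<le> B"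
    and G: "(\<lambda>p. G (fst p) (snd p)) \<in> borel_measurable borel"
    and GB: "\<And>a b. a \<in> {0..1} \<Longrightarrow> b \<in> {0..1} \<Longrightarrow> \<bar>G a b\<bar> \<le> C"
    and slice: "\<And>b. b \<in> {0<..<1} \<Longrightarrow>
      \<exists>A. w\<^sup>2 * integral {0..1} (\<lambda>a. (F a b - A)\<^sup>2) \<le> integral {0..1} (\<lambda>a. G a b)"
  shows "w\<^sup>2 * square_integral (\<lambda>a b. (F a b - (\<integral>x. F x b \<partial>unit_measure))\<^sup>2) \<le> square_integral G"
proof -
  have Fsb: "square_bounded F" and Gsb: "square_bounded G"
    using square_boundedI[OF F FB] square_boundedI[OF G GB] by auto
  define u where "u = (\<lambda>b. \<integral>x. F x b \<partial>unit_measure)"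
  have ub: "square_bounded (\<lambda>a b. u b)"
    using square_slice_mean[OF Fsb] unfolding u_def by (metis square_bounded_one_variable(1))
  have V: "square_bounded (\<lambda>a b. (F a b - u b)\<^sup>2)"
    by (intro square_bounded_power2 square_bounded_diff Fsb ub)
  have int: "integrable unit_measure (\<lambda>b. \<integral>a. h a b \<partial>unit_measure)" if "square_bounded h" for h
    using square_slice_mean[OF that] unit_integrableI by blast
  have "w\<^sup>2 * (\<integral>a. (F a b - u b)\<^sup>2 \<partial>unit_measure) \<le> (\<integral>a. G a b \<partial>unit_measure)"
    if b': "b \<in> {0<..<1}" for b
  proof -
    have b: "b \<in> {0..1}" using b' by auto
    obtain A where A: "w\<^sup>2 * integral {0..1} (\<lambda>a. (F a b - A)\<^sup>2) \<le> integral {0..1} (\<lambda>a. G a b)"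
      using slice[OF b'] by blast
    note Fs = borel_slice[of F b, OF F]
    have FAB: "\<bar>(F a b - A)\<^sup>2\<bar> \<le> (B + \<bar>A\<bar>)\<^sup>2" if "a \<in> {0..1}" for a
    proof -
      have "\<bar>F a b - A\<bar> \<le> B + \<bar>A\<bar>" using FB[OF that b] by linarith
      from power_mono[OF this, of 2] show ?thesis by simp
    qed
    have FA: "(\<lambda>a. (F a b - A)\<^sup>2) \<in> borel_measurable borel" using Fs by measurable
    have intF: "integrable unit_measure (\<lambda>a. F a b)"
      using Fs FB b by (intro unit_integrableI) auto
    have intF2: "integrable unit_measure (\<lambda>a. (F a b)\<^sup>2)"
    proof (rule unit_integrableI)
      show "\<bar>(F a b)\<^sup>2\<bar> \<le> B\<^sup>2" if "a \<in> {0..1}" for a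
        using power_mono[OF FB[OF that b], of 2] by simp
    qed (use Fs in measurable)
    have "(\<integral>a. (F a b - A)\<^sup>2 \<partial>unit_measure) - (\<integral>a. (F a b - u b)\<^sup>2 \<partial>unit_measure) = (u b - A)\<^sup>2"
    proof -
      have expand: "(\<integral>a. (F a b - c)\<^sup>2 \<partial>unit_measure) = (\<integral>a. (F a b)\<^sup>2 \<partial>unit_measure) - 2 * c * u b + c\<^sup>2" for c
      proof -
        have "(\<integral>a. (F a b - c)\<^sup>2 \<partial>unit_measure) = (\<integral>a. (F a b)\<^sup>2 - (2 * c) * F a b + c\<^sup>2 \<partial>unit_measure)"
          by (simp add: power2_diff algebra_simps)
        also have "\<dots> = (\<integral>a. (F a b)\<^sup>2 \<partial>unit_measure) - 2 * c * u b + c\<^sup>2"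
          using intF intF2 unit.prob_space by (simp add: u_def)
        finally show ?thesis .
      qed
      show ?thesis unfolding expand by (simp add: power2_eq_square algebra_simps)
    qed
    then have "(\<integral>a. (F a b - u b)\<^sup>2 \<partial>unit_measure) \<le> (\<integral>a. (F a b - A)\<^sup>2 \<partial>unit_measure)"
      using zero_le_power2[of "u b - A"] by linarith
    also have "\<dots> = integral {0..1} (\<lambda>a. (F a b - A)\<^sup>2)"
      by (rule unit_integral_HK(2)[OF FA FAB])
    finally have "w\<^sup>2 * (\<integral>a. (F a b - u b)\<^sup>2 \<partial>unit_measure) \<le> integral {0..1} (\<lambda>a. G a b)"
      using A by (meson mult_left_mono order_trans zero_le_power2)
    also have "\<dots> = (\<integral>a. G a b \<partial>unit_measure)"
      using GB b by (intro unit_integral_HK(2)[symmetric, OF borel_slice[of G b, OF G]]) auto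
    finally show ?thesis .
  qed
  moreover have "AE b in unit_measure. b \<in> {0<..<1}"
  proof -
    have "AE b in lborel. b \<in> {0..1} \<longrightarrow> b \<in> {0<..<1::real}"
      using AE_lborel_singleton[of 0] AE_lborel_singleton[of 1] by eventually_elim auto
    then show ?thesis unfolding unit_measure_def by (subst AE_restrict_space_iff) auto
  qed
  ultimately have "AE b in unit_measure.
      w\<^sup>2 * (\<integral>a. (F a b - u b)\<^sup>2 \<partial>unit_measure) \<le> (\<integral>a. G a b \<partial>unit_measure)"
    by (auto elim: eventually_mono)
  then have "(\<integral>b. w\<^sup>2 * (\<integral>a. (F a b - u b)\<^sup>2 \<partial>unit_measure) \<partial>unit_measure)
      \<le> (\<integral>b. (\<integral>a. G a b \<partial>unit_measure) \<partial>unit_measure)"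
    by (intro integral_mono_AE integrable_mult_right int V Gsb)
  then show ?thesis
    using square_integral_iterated(2)[OF V] square_integral_iterated(2)[OF Gsb] by (simp add: u_def)
qed

section \<open>Change of variables in the plane\<close>

lemma nn_integral_square:
  assumes [measurable]: "h \<in> borel_measurable (borel :: (real \<times> real) measure)"
  shows "(\<integral>\<^sup>+p. h p \<partial>square_measure) = (\<integral>\<^sup>+p. h p * indicator ({0..1} \<times> {0..1}) p \<partial>lborel)"
proof -
  have [measurable]: "{0..1} \<times> {0..1} \<in> sets (borel :: (real \<times> real) measure)"
    by (intro borel_closed closed_Times) auto
  have hp: "(\<lambda>(a, b). h (a, b)) \<in> borel_measurable square_measure"
  proof -
    have "(\<lambda>x. x) \<in> borel_measurable unit_measure"
      by (rule measurable_unit_borel) simp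
    from measurable_compose[OF measurable_fst this] measurable_compose[OF measurable_snd this]
    have "(\<lambda>p. (fst p, snd p)) \<in> square_measure \<rightarrow>\<^sub>M borel"
      by (intro borel_measurable_Pair) auto
    from measurable_compose[OF this assms] show ?thesis by (simp add: case_prod_beta')
  qed
  have "(\<integral>\<^sup>+p. h p \<partial>square_measure) = (\<integral>\<^sup>+a. (\<integral>\<^sup>+b. h (a, b) \<partial>unit_measure) \<partial>unit_measure)"
    using unit.nn_integral_fst[of h] hp by (simp add: case_prod_beta')
  also have "\<dots> = (\<integral>\<^sup>+a. (\<integral>\<^sup>+b. h (a, b) * indicator ({0..1} \<times> {0..1}) (a, b) \<partial>lborel) \<partial>lborel)"
    unfolding nn_integral_unit
    by (intro nn_integral_cong) (auto simp: indicator_times split: split_indicator)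
  also have "\<dots> = (\<integral>\<^sup>+p. h p * indicator ({0..1} \<times> {0..1}) p \<partial>(lborel \<Otimes>\<^sub>M lborel))"
    by (intro lborel.nn_integral_fst) (simp add: lborel_prod)
  finally show ?thesis by (simp add: lborel_prod)
qed

lemma nn_integral_plane_iterated:
  assumes [measurable]: "h \<in> borel_measurable (borel :: (real \<times> real) measure)"
  shows "(\<integral>\<^sup>+z. h z \<partial>lborel) = (\<integral>\<^sup>+x. (\<integral>\<^sup>+y. h (x, y) \<partial>lborel) \<partial>lborel)"
    and "(\<integral>\<^sup>+z. h z \<partial>lborel) = (\<integral>\<^sup>+y. (\<integral>\<^sup>+x. h (x, y) \<partial>lborel) \<partial>lborel)"
  using lborel.nn_integral_fst[of h lborel] lborel_pair.nn_integral_snd[of h]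
  by (simp_all add: lborel_prod case_prod_beta')

text \<open>If p is not 0, one elimination step factors the map into an affine substitution in y
  with factor det / p and one in x with factor p, each done under Fubini. If p = 0, the columns are
  swapped, which is an exchange of the order of integration.\<close>

lemma nn_integral_affine_plane:
  fixes h :: "real \<times> real \<Rightarrow> ennreal"
  assumes [measurable]: "h \<in> borel_measurable borel" and det: "p * s - q * r \<noteq> 0"
  shows "ennreal \<bar>p * s - q * r\<bar> *
      (\<integral>\<^sup>+z. h (p * fst z + q * snd z + e, r * fst z + s * snd z + f) \<partial>lborel)
    = (\<integral>\<^sup>+z. h z \<partial>lborel)"
proof -
  have pivot: "ennreal \<bar>p * s - q * r\<bar> * (\<integral>\<^sup>+y. (\<integral>\<^sup>+x. h (p * x + q * y + e, r * x + s * y + f) \<partial>lborel) \<partial>lborel)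
    = (\<integral>\<^sup>+z. h z \<partial>lborel)" if p: "p \<noteq> 0" and det: "p * s - q * r \<noteq> 0" for p q r s
  proof -
    define d where "d = (p * s - q * r) / p"
    have d: "d \<noteq> 0" using p det by (simp add: d_def)
    have "(\<integral>\<^sup>+z. h z \<partial>lborel) = (\<integral>\<^sup>+x. (\<integral>\<^sup>+y. h (x, y) \<partial>lborel) \<partial>lborel)"
      by (rule nn_integral_plane_iterated) simp
    also have "\<dots> = (\<integral>\<^sup>+x. ennreal \<bar>d\<bar> * (\<integral>\<^sup>+y. h (x, (r / p * (x - e) + f) + d * y) \<partial>lborel) \<partial>lborel)"
      by (intro nn_integral_cong nn_integral_real_affine d) simp
    also have "\<dots> = ennreal \<bar>d\<bar> * (\<integral>\<^sup>+x. (\<integral>\<^sup>+y. h (x, (r / p * (x - e) + f) + d * y) \<partial>lborel) \<partial>lborel)"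
      by (intro nn_integral_cmult) measurable
    also have "(\<integral>\<^sup>+x. (\<integral>\<^sup>+y. h (x, (r / p * (x - e) + f) + d * y) \<partial>lborel) \<partial>lborel)
        = (\<integral>\<^sup>+y. (\<integral>\<^sup>+x. h (x, (r / p * (x - e) + f) + d * y) \<partial>lborel) \<partial>lborel)"
      by (rule lborel_pair.Fubini') measurable
    also have "\<dots> = (\<integral>\<^sup>+y. ennreal \<bar>p\<bar> * (\<integral>\<^sup>+x. h ((q * y + e) + p * x,
        (r / p * (((q * y + e) + p * x) - e) + f) + d * y) \<partial>lborel) \<partial>lborel)"
      by (intro nn_integral_cong nn_integral_real_affine p) simp
    also have "\<dots> = ennreal \<bar>p\<bar> * (\<integral>\<^sup>+y. (\<integral>\<^sup>+x. h ((q * y + e) + p * x,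
        (r / p * (((q * y + e) + p * x) - e) + f) + d * y) \<partial>lborel) \<partial>lborel)"
      by (intro nn_integral_cmult) measurable
    also have "(\<lambda>y x. h ((q * y + e) + p * x, (r / p * (((q * y + e) + p * x) - e) + f) + d * y))
        = (\<lambda>y x. h (p * x + q * y + e, r * x + s * y + f))"
    proof (intro ext arg_cong[where f = h])
      fix x y
      have "(r / p * (((q * y + e) + p * x) - e) + f) + d * y = r * x + s * y + f"
        using p unfolding d_def by (simp add: field_simps)
      then show "((q * y + e) + p * x, (r / p * (((q * y + e) + p * x) - e) + f) + d * y)
          = (p * x + q * y + e, r * x + s * y + f)"
        by (simp add: algebra_simps)
    qed
    finally show ?thesis
      using p by (simp add: d_def abs_divide mult.assoc[symmetric] ennreal_mult'[symmetric])
  qed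
  let ?g = "\<lambda>z. h (p * fst z + q * snd z + e, r * fst z + s * snd z + f)"
  have "(\<lambda>z :: real \<times> real. (p * fst z + q * snd z + e, r * fst z + s * snd z + f)) \<in> borel_measurable borel"
    by (intro borel_measurable_continuous_onI continuous_intros)
  from measurable_compose[OF this assms(1)] have g [measurable]: "?g \<in> borel_measurable borel" .
  show ?thesis
  proof (cases "p = 0")
    case False
    show ?thesis
      using pivot[OF False det] nn_integral_plane_iterated(2)[OF g] by simp
  next
    case True
    then have q: "q \<noteq> 0" and det': "q * r - p * s \<noteq> 0" using det by auto
    have "(\<integral>\<^sup>+z. ?g z \<partial>lborel) = (\<integral>\<^sup>+y. (\<integral>\<^sup>+x. h (q * x + p * y + e, s * x + r * y + f) \<partial>lborel) \<partial>lborel)"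
      using nn_integral_plane_iterated(1)[OF g] by (simp add: add.commute)
    then show ?thesis
      using pivot[OF q det'] by (simp add: abs_minus_commute)
  qed
qed

text \<open>A piece \<open>(p, q, e, r, s, f, \<sigma>)\<close> is an affine map, restricted to the preimage of the part of the triangle
  that \<open>\<sigma>\<close> selects: all of it (\<open>\<sigma> = 0\<close>) or one of the halves into which the altitude \<open>s - 3 t + 1 = 0\<close> cuts
  the equilateral triangle. The unit square contains only halves of some alcoves.\<close>

type_synonym piece = "real \<times> real \<times> real \<times> real \<times> real \<times> real \<times> real"

fun piece_map :: "piece \<Rightarrow> real \<times> real \<Rightarrow> real \<times> real" where
  "piece_map (p, q, e, r, s, f, \<sigma>) z = (p * fst z + q * snd z + e, r * fst z + s * snd z + f)"

fun piece_det :: "piece \<Rightarrow> real" where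
  "piece_det (p, q, e, r, s, f, \<sigma>) = p * s - q * r"

definition triangle :: "(real \<times> real) set" where
  "triangle = {z. 0 \<le> snd z \<and> fst z \<le> 1 - snd z \<and> - fst z \<le> 1 - snd z}"

fun piece_image :: "piece \<Rightarrow> (real \<times> real) set" where
  "piece_image (p, q, e, r, s, f, \<sigma>) = triangle \<inter> {z. 0 \<le> \<sigma> * (fst z - 3 * snd z + 1)}"

text \<open>The square of the derivative of \<open>g \<circ> piece_map c\<close> in the first variable, if \<open>g\<close> has partial
  derivatives \<open>gs\<close> and \<open>gt\<close>.\<close>
fun piece_slope :: "piece \<Rightarrow> (real \<times> real \<Rightarrow> real) \<Rightarrow> (real \<times> real \<Rightarrow> real) \<Rightarrow> real \<times> real \<Rightarrow> real" where
  "piece_slope (p, q, e, r, s, f, \<sigma>) gs gt z = (p * gs z + r * gt z)\<^sup>2"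

lemma closed_triangle: "closed triangle"
  unfolding triangle_def by (intro closed_Collect_conj closed_Collect_le continuous_intros)

lemma borel_triangle [measurable]: "triangle \<in> sets borel"
  by (rule borel_closed[OF closed_triangle])

lemma borel_piece_image [measurable]: "piece_image c \<in> sets borel"
proof (cases c)
  case (fields p q e r s f \<sigma>)
  have "closed (triangle \<inter> {z. 0 \<le> \<sigma> * (fst z - 3 * snd z + 1)})"
    by (intro closed_Int closed_triangle closed_Collect_le continuous_intros)
  then show ?thesis using fields by auto
qed

lemma continuous_piece_map: "continuous_on UNIV (piece_map c)"
  by (cases c) (auto intro!: continuous_intros)

lemma borel_piece_map [measurable]: "piece_map c \<in> borel_measurable borel"
  by (intro borel_measurable_continuous_onI continuous_piece_map)

lemma nn_integral_piece_map:
  fixes h :: "real \<times> real \<Rightarrow> ennreal"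
  assumes "h \<in> borel_measurable borel" "\<bar>piece_det c\<bar> = D" "D > 0"
  shows "ennreal D * (\<integral>\<^sup>+z. h (piece_map c z) \<partial>lborel) = (\<integral>\<^sup>+z. h z \<partial>lborel)"
proof (cases c)
  case (fields p q e r s f \<sigma>)
  then show ?thesis
    using nn_integral_affine_plane[OF assms(1), of p s q r e f] assms(2,3) by auto
qed

lemma nn_integral_piece_sum:
  fixes h :: "piece \<Rightarrow> real \<times> real \<Rightarrow> ennreal"
  assumes [measurable]: "\<And>c. h c \<in> borel_measurable borel"
    and D: "\<And>c. c \<in> set L \<Longrightarrow> \<bar>piece_det c\<bar> = D" "D > 0"
  shows "ennreal D * (\<integral>\<^sup>+z. (\<Sum>c\<leftarrow>L. h c (piece_map c z)) \<partial>lborel) = (\<Sum>c\<leftarrow>L. \<integral>\<^sup>+z. h c z \<partial>lborel)"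
    and "(\<lambda>z. \<Sum>c\<leftarrow>L. h c (piece_map c z)) \<in> borel_measurable borel"
proof -
  have hm: "(\<lambda>z. h c (piece_map c z)) \<in> borel_measurable borel" for c
    using measurable_compose[OF borel_piece_map assms(1)] .
  then have meas: "(\<lambda>z. \<Sum>c\<leftarrow>L. h c (piece_map c z)) \<in> borel_measurable borel" for L
    by (induction L) auto
  then show "(\<lambda>z. \<Sum>c\<leftarrow>L. h c (piece_map c z)) \<in> borel_measurable borel" .
  show "ennreal D * (\<integral>\<^sup>+z. (\<Sum>c\<leftarrow>L. h c (piece_map c z)) \<partial>lborel) = (\<Sum>c\<leftarrow>L. \<integral>\<^sup>+z. h c z \<partial>lborel)"
    using D
  proof (induction L)
    case (Cons c L)
    have "(\<integral>\<^sup>+z. (\<Sum>c\<leftarrow>c # L. h c (piece_map c z)) \<partial>lborel)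
        = (\<integral>\<^sup>+z. h c (piece_map c z) \<partial>lborel) + (\<integral>\<^sup>+z. (\<Sum>c\<leftarrow>L. h c (piece_map c z)) \<partial>lborel)"
      using hm meas by (simp add: nn_integral_add)
    then show ?case
      using Cons nn_integral_piece_map[OF assms(1), of c D c] by (simp add: distrib_left)
  qed simp
qed

lemma AE_line:
  assumes "p \<noteq> 0 \<or> q \<noteq> 0"
  shows "AE z in (lborel :: (real \<times> real) measure). p * fst z + q * snd z \<noteq> c"
proof -
  have "negligible {z. (p, q) \<bullet> z = c}"
    using assms by (intro negligible_hyperplane) (auto simp: zero_prod_def)
  then have "{z. (p, q) \<bullet> z = c} \<in> null_sets lebesgue"
    by (simp add: negligible_iff_null_sets)
  moreover have "{z. (p, q) \<bullet> z = c} \<in> sets lborel"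
    by (simp add: borel_closed closed_hyperplane)
  ultimately have "{z. (p, q) \<bullet> z = c} \<in> null_sets lborel"
    by (simp add: null_sets_completion_iff)
  then have "AE z in lborel. z \<notin> {z. (p, q) \<bullet> z = c}"
    by (rule AE_not_in)
  then show ?thesis by (simp add: inner_prod_def)
qed

text \<open>\<open>\<Gamma>\<close> folds the unit square onto the triangle: it is affine, with linear part of determinant
  \<open>\<plusminus> D\<close>, on each of the pieces in \<open>L\<close>, and lines parallel to the first axis are folded to billiard paths.\<close>

locale triangle_fold =
  fixes L :: "piece list" and D :: real and \<Gamma> :: "real \<times> real \<Rightarrow> real \<times> real"
  assumes det: "\<And>c. c \<in> set L \<Longrightarrow> \<bar>piece_det c\<bar> = D" and D: "D > 0"
    and cover: "AE z in lborel. (indicator ({0..1} \<times> {0..1}) z :: ennreal)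
      = (\<Sum>c\<leftarrow>L. indicator (piece_image c) (piece_map c z))"
    and on_piece: "\<And>z c. z \<in> {0..1} \<times> {0..1} \<Longrightarrow> c \<in> set L \<Longrightarrow> piece_map c z \<in> triangle \<Longrightarrow>
      \<Gamma> z = piece_map c z"
    and continuous_fold: "continuous_on UNIV \<Gamma>"
    and fold_in_triangle: "\<And>z. z \<in> {0..1} \<times> {0..1} \<Longrightarrow> \<Gamma> z \<in> triangle"
    and slices: "\<And>b. b \<in> {0<..<1} \<Longrightarrow> \<exists>E. finite E \<and> (\<forall>a\<in>{0<..<1} - E. \<exists>c\<in>set L.
      piece_map c (a, b) \<in> piece_image c \<and> piece_map c (a, b) \<in> interior triangle)"
begin

text \<open>The integrand may depend on the piece because the squared slopes do. The piecewise
  substitutions take place on the whole plane; by \<open>cover\<close> the preimages of the sets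
  \<open>piece_image c\<close> lie in the square up to a null set, so restricting to the square
  changes nothing.\<close>

lemma nn_integral_fold:
  fixes h :: "piece \<Rightarrow> real \<times> real \<Rightarrow> ennreal"
  assumes h: "\<And>c. h c \<in> borel_measurable borel"
  shows "ennreal D * (\<integral>\<^sup>+z. (\<Sum>c\<leftarrow>L. h c (piece_map c z) * indicator (piece_image c) (piece_map c z)) \<partial>square_measure)
    = (\<Sum>c\<leftarrow>L. \<integral>\<^sup>+z. h c z * indicator (piece_image c) z \<partial>lborel)"
proof -
  let ?h = "\<lambda>c z. h c z * indicator (piece_image c) z"
  have m: "\<And>c. ?h c \<in> borel_measurable borel"
    using h by measurable
  note sums = nn_integral_piece_sum[where h = ?h, OF m det D]
  have "AE z in lborel. (\<Sum>c\<leftarrow>L. ?h c (piece_map c z)) * indicator ({0..1} \<times> {0..1}) z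
      = (\<Sum>c\<leftarrow>L. ?h c (piece_map c z))"
    using cover
  proof eventually_elim
    case (elim z)
    show ?case
    proof (cases "z \<in> {0..1} \<times> {0..1}")
      case False
      then have "(\<Sum>c\<leftarrow>L. indicator (piece_image c) (piece_map c z) :: ennreal) = 0"
        using elim by simp
      then have "\<forall>c\<in>set L. piece_map c z \<notin> piece_image c"
        by (auto simp: sum_list_nonneg_eq_0_iff split: split_indicator_asm)
      then have "(\<Sum>c\<leftarrow>L. ?h c (piece_map c z)) = (\<Sum>c\<leftarrow>L. 0)"
        by (intro arg_cong[where f = sum_list] map_cong) auto
      then have "(\<Sum>c\<leftarrow>L. ?h c (piece_map c z)) = 0" by simp
      then show ?thesis by (simp only: mult_zero_left)
    qed simp
  qed
  then have "(\<integral>\<^sup>+z. (\<Sum>c\<leftarrow>L. ?h c (piece_map c z)) * indicator ({0..1} \<times> {0..1}) z \<partial>lborel)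
      = (\<integral>\<^sup>+z. (\<Sum>c\<leftarrow>L. ?h c (piece_map c z)) \<partial>lborel)"
    by (rule nn_integral_cong_AE)
  then show ?thesis
    using sums(1) nn_integral_square[OF sums(2)] by simp
qed

text \<open>By \<open>on_piece\<close> every nonzero term of the sum over the pieces equals
  \<open>h (\<Gamma> z)\<close>, and by \<open>cover\<close> almost every point of the square has
  exactly one such piece.\<close>

lemma nn_integral_fold_same:
  fixes h :: "real \<times> real \<Rightarrow> ennreal"
  assumes h: "h \<in> borel_measurable borel"
  shows "ennreal D * (\<integral>\<^sup>+z. h (\<Gamma> z) \<partial>square_measure)
    = (\<Sum>c\<leftarrow>L. \<integral>\<^sup>+z. h z * indicator (piece_image c) z \<partial>lborel)"
proof -
  have sub: "piece_image c \<subseteq> triangle" for c by (cases c) auto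
  let ?S = "\<lambda>z. (\<Sum>c\<leftarrow>L. h (piece_map c z) * indicator (piece_image c) (piece_map c z))"
  have \<Gamma>m: "\<Gamma> \<in> borel_measurable borel"
    by (intro borel_measurable_continuous_onI continuous_fold)
  have "(\<integral>\<^sup>+z. h (\<Gamma> z) \<partial>square_measure) = (\<integral>\<^sup>+z. h (\<Gamma> z) * indicator ({0..1} \<times> {0..1}) z \<partial>lborel)"
    by (rule nn_integral_square[OF measurable_compose[OF \<Gamma>m h]])
  also have "\<dots> = (\<integral>\<^sup>+z. ?S z * indicator ({0..1} \<times> {0..1}) z \<partial>lborel)"
  proof (rule nn_integral_cong_AE, use cover in eventually_elim)
    fix z :: "real \<times> real"
    assume count: "indicator ({0..1} \<times> {0..1}) z
      = (\<Sum>c\<leftarrow>L. indicator (piece_image c) (piece_map c z) :: ennreal)"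
    show "h (\<Gamma> z) * indicator ({0..1} \<times> {0..1}) z = ?S z * indicator ({0..1} \<times> {0..1}) z"
    proof (cases "z \<in> {0..1} \<times> {0..1}")
      case True
      have "?S z = (\<Sum>c\<leftarrow>L. h (\<Gamma> z) * indicator (piece_image c) (piece_map c z))"
      proof (intro arg_cong[where f = sum_list] map_cong refl)
        fix c assume "c \<in> set L"
        then show "h (piece_map c z) * indicator (piece_image c) (piece_map c z)
            = h (\<Gamma> z) * indicator (piece_image c) (piece_map c z)"
          using on_piece[OF True, of c] sub[of c] by (auto split: split_indicator)
      qed
      also have "\<dots> = h (\<Gamma> z)"
        using count True by (simp add: sum_list_const_mult)
      finally show ?thesis by simp
    qed simp
  qed
  also have "\<dots> = (\<integral>\<^sup>+z. ?S z \<partial>square_measure)"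
    by (rule nn_integral_square[symmetric], rule nn_integral_piece_sum(2)[of "\<lambda>c z. h z * indicator (piece_image c) z"])
       (use h det D in \<open>auto\<close>)
  finally show ?thesis
    using nn_integral_fold[of "\<lambda>_. h"] h by simp
qed

end

lemma compact_triangle: "compact triangle"
proof -
  have "triangle \<subseteq> {-1..1} \<times> {0..1}"
    unfolding triangle_def by auto
  moreover have "bounded ({-1..1} \<times> {0..1} :: (real \<times> real) set)"
    by (intro bounded_Times) auto
  ultimately show ?thesis
    using closed_triangle bounded_subset compact_eq_bounded_closed by blast
qed

lemma bounded_on_triangle:
  fixes g :: "real \<times> real \<Rightarrow> real"
  assumes "continuous_on UNIV g"
  obtains B where "\<And>z. z \<in> triangle \<Longrightarrow> \<bar>g z\<bar> \<le> B"
proof -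
  have "bounded (g ` triangle)"
    using compact_continuous_image[OF continuous_on_subset[OF assms] compact_triangle]
    by (auto intro: compact_imp_bounded)
  then show ?thesis using that by (auto simp: bounded_iff)
qed

section \<open>Wirtinger inequalities on the slices of a folded function\<close>

locale triangle_fold_function = triangle_fold +
  fixes g gs gt :: "real \<times> real \<Rightarrow> real"
  assumes deriv: "\<And>z. (g has_derivative (\<lambda>h. fst h * gs z + snd h * gt z)) (at z)"
    and gs: "continuous_on UNIV gs" and gt: "continuous_on UNIV gt"
begin

definition folded :: "real \<Rightarrow> real \<Rightarrow> real" where
  "folded a b = g (\<Gamma> (a, b))"

text \<open>Almost everywhere this is the squared derivative of \<open>folded\<close> in its first
  argument. Where images of several pieces meet, the extra terms are nonnegative, and an upper bound
  is all that the Wirtinger inequalities ask for.\<close>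

definition energy :: "real \<Rightarrow> real \<Rightarrow> real" where
  "energy a b = (\<Sum>c\<leftarrow>L. piece_slope c gs gt (piece_map c (a, b))
    * indicator (piece_image c) (piece_map c (a, b)))"

lemma continuous_g: "continuous_on UNIV g"
  using deriv by (meson continuous_at_imp_continuous_on has_derivative_continuous)

lemma continuous_folded: "continuous_on UNIV (\<lambda>p. folded (fst p) (snd p))"
  unfolding folded_def
  using continuous_on_compose2[OF continuous_g continuous_fold] by simp

lemma borel_folded: "(\<lambda>p. folded (fst p) (snd p)) \<in> borel_measurable borel"
  by (intro borel_measurable_continuous_onI continuous_folded)

lemma bounded_folded: "\<exists>B. \<forall>a\<in>{0..1}. \<forall>b\<in>{0..1}. \<bar>folded a b\<bar> \<le> B"
proof -
  obtain B where "\<And>z. z \<in> triangle \<Longrightarrow> \<bar>g z\<bar> \<le> B"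
    using bounded_on_triangle[OF continuous_g] by blast
  then show ?thesis
    unfolding folded_def using fold_in_triangle by (intro exI[of _ B]) auto
qed

lemma continuous_slope: "continuous_on UNIV (piece_slope c gs gt)"
  using gs gt by (cases c) (auto intro!: continuous_intros)

lemma slope_nonneg: "0 \<le> piece_slope c gs gt z"
  by (cases c) auto

lemma borel_slope [measurable]: "piece_slope c gs gt \<in> borel_measurable borel"
  by (intro borel_measurable_continuous_onI continuous_slope)

lemma borel_energy: "(\<lambda>p. energy (fst p) (snd p)) \<in> borel_measurable borel"
proof -
  have m: "(\<lambda>z. piece_slope c gs gt (piece_map c z) * indicator (piece_image c) (piece_map c z))
      \<in> borel_measurable borel" for c
    using measurable_compose[OF borel_piece_map,
        of "\<lambda>z. piece_slope c gs gt z * indicator (piece_image c) z" borel c] by simp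
  have "(\<lambda>z. \<Sum>c\<leftarrow>K. piece_slope c gs gt (piece_map c z) * indicator (piece_image c) (piece_map c z))
      \<in> borel_measurable borel" for K
    by (induction K) (use m in \<open>auto simp del: piece_slope.simps piece_map.simps piece_image.simps\<close>)
  then show ?thesis unfolding energy_def by simp
qed

lemma bounded_energy: "\<exists>C. \<forall>a b. \<bar>energy a b\<bar> \<le> C"
proof -
  have one: "\<exists>C. \<forall>z. \<bar>piece_slope c gs gt z * indicator (piece_image c) z\<bar> \<le> C" for c
  proof -
    obtain C where C: "\<And>z. z \<in> triangle \<Longrightarrow> \<bar>piece_slope c gs gt z\<bar> \<le> C"
      using bounded_on_triangle[OF continuous_slope] by blast
    have "piece_image c \<subseteq> triangle" by (cases c) auto
    then have "\<bar>piece_slope c gs gt z * indicator (piece_image c) z\<bar> \<le> max C 0" for z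
      using C[of z] by (auto split: split_indicator)
    then show ?thesis by blast
  qed
  have "\<exists>C. \<forall>a b. \<bar>\<Sum>c\<leftarrow>K. piece_slope c gs gt (piece_map c (a, b))
    * indicator (piece_image c) (piece_map c (a, b))\<bar> \<le> C" for K
  proof (induction K)
    case (Cons c K)
    then obtain C where C: "\<And>a b. \<bar>\<Sum>c\<leftarrow>K. piece_slope c gs gt (piece_map c (a, b))
      * indicator (piece_image c) (piece_map c (a, b))\<bar> \<le> C" by blast
    obtain C' where C': "\<And>z. \<bar>piece_slope c gs gt z * indicator (piece_image c) z\<bar> \<le> C'"
      using one by blast
    have "\<bar>\<Sum>c\<leftarrow>c # K. piece_slope c gs gt (piece_map c (a, b))
      * indicator (piece_image c) (piece_map c (a, b))\<bar> \<le> C' + C" for a b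
      using C[of a b] C'[of "piece_map c (a, b)"] unfolding list.map sum_list.Cons by linarith
    then show ?case by blast
  qed auto
  then show ?thesis unfolding energy_def .
qed

text \<open>Near a point that is mapped into the interior of the triangle, \<open>folded\<close>
  coincides with g after \<open>piece_map c\<close>. Since \<open>on_piece\<close> asks only for
  membership in the triangle and not in the selected half, an altitude causes no break in the
  derivative.\<close>

lemma folded_slice_derivative:
  assumes a: "a \<in> {0<..<1}" and b: "b \<in> {0..1}" and c: "c \<in> set L"
    and im: "piece_map c (a, b) \<in> piece_image c" and int: "piece_map c (a, b) \<in> interior triangle"
  shows "\<exists>d. ((\<lambda>a. folded a b) has_real_derivative d) (at a) \<and> d\<^sup>2 \<le> energy a b"
proof -
  obtain p q e r s f \<sigma> where cc: "c = (p, q, e, r, s, f, \<sigma>)" by (cases c)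
  let ?z = "piece_map c (a, b)"
  have line: "((\<lambda>x. piece_map c (x, b)) has_derivative (\<lambda>h. (p * h, r * h))) (at a)"
    unfolding cc by (auto intro!: derivative_eq_intros)
  have "((\<lambda>x. g (piece_map c (x, b))) has_derivative
      (\<lambda>h. fst (p * h, r * h) * gs ?z + snd (p * h, r * h) * gt ?z)) (at a)"
    using has_derivative_compose[OF line deriv] by simp
  moreover have "(\<lambda>h. fst (p * h, r * h) * gs ?z + snd (p * h, r * h) * gt ?z) = (*) (p * gs ?z + r * gt ?z)"
    by (auto simp: fun_eq_iff algebra_simps)
  ultimately have d: "((\<lambda>x. g (piece_map c (x, b))) has_real_derivative (p * gs ?z + r * gt ?z)) (at a)"
    unfolding has_field_derivative_def by (simp only:)
  have "open ((\<lambda>x. piece_map c (x, b)) -` interior triangle \<inter> {0<..<1})"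
    by (intro open_Int open_vimage continuous_on_compose2[OF continuous_piece_map] continuous_intros) auto
  then have "((\<lambda>a. folded a b) has_real_derivative (p * gs ?z + r * gt ?z)) (at a)"
  proof (rule has_field_derivative_transform_within_open[OF d])
    fix x assume "x \<in> (\<lambda>x. piece_map c (x, b)) -` interior triangle \<inter> {0<..<1}"
    then have "piece_map c (x, b) \<in> triangle" "(x, b) \<in> {0..1} \<times> {0..1}"
      using interior_subset[of triangle] b by auto
    then show "g (piece_map c (x, b)) = folded x b"
      unfolding folded_def using on_piece[OF _ c] by simp
  qed (use a int in auto)
  moreover have "(p * gs ?z + r * gt ?z)\<^sup>2 \<le> energy a b"
  proof -
    have "(p * gs ?z + r * gt ?z)\<^sup>2 = piece_slope c gs gt ?z * indicator (piece_image c) ?z"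
      using im by (simp add: cc)
    also have "\<dots> \<le> energy a b"
      unfolding energy_def using c slope_nonneg
      by (intro member_le_sum_list) (auto intro!: image_eqI simp: slope_nonneg)
    finally show ?thesis .
  qed
  ultimately show ?thesis by blast
qed

lemma folded_slice:
  assumes b: "b \<in> {0<..<1}"
  obtains E f' where "finite E" "continuous_on {0..1} (\<lambda>a. folded a b)"
    "\<And>x. x \<in> {0<..<1} - E \<Longrightarrow> ((\<lambda>a. folded a b) has_real_derivative f' x) (at x)"
    "\<And>x. x \<in> {0<..<1} - E \<Longrightarrow> (f' x)\<^sup>2 \<le> energy x b"
    "(\<lambda>a. energy a b) integrable_on {0..1}"
proof -
  obtain E where E: "finite E" "\<forall>a\<in>{0<..<1} - E. \<exists>c\<in>set L.
      piece_map c (a, b) \<in> piece_image c \<and> piece_map c (a, b) \<in> interior triangle"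
    using slices[OF b] by blast
  then have "\<forall>a\<in>{0<..<1} - E. \<exists>d. ((\<lambda>a. folded a b) has_real_derivative d) (at a) \<and> d\<^sup>2 \<le> energy a b"
    using folded_slice_derivative[of _ b] b
    by (meson DiffD1 greaterThanLessThan_subseteq_atLeastAtMost_iff order_refl subsetD)
  then obtain f' where "\<forall>a\<in>{0<..<1} - E. ((\<lambda>a. folded a b) has_real_derivative f' a) (at a) \<and> (f' a)\<^sup>2 \<le> energy a b"
    by (rule bchoice[THEN exE])
  moreover have "continuous_on {0..1} (\<lambda>a. (a, b))" by (intro continuous_intros)
  from continuous_on_compose2[OF continuous_folded this]
  have "continuous_on {0..1} (\<lambda>a. folded a b)" by simp
  moreover obtain C where "\<And>a b. \<bar>energy a b\<bar> \<le> C" using bounded_energy by blast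
  then have "(\<lambda>a. energy a b) integrable_on {0..1}"
    by (intro unit_integral_HK(1)[OF borel_slice[of energy b, OF borel_energy]])
  ultimately show ?thesis using that E(1) by blast
qed

text \<open>The Jacobian D appears on both sides and cancels. The constant is the product of 1 / w^2
  from the slices and m / k from the comparison of the variance with the slice variance.\<close>

lemma poincare_from_fold:
  assumes slice: "\<And>b. b \<in> {0<..<1} \<Longrightarrow>
      \<exists>A. w\<^sup>2 * integral {0..1} (\<lambda>a. (folded a b - A)\<^sup>2) \<le> integral {0..1} (\<lambda>a. energy a b)"
    and bessel: "k * square_integral (\<lambda>a b. (folded a b - square_integral folded)\<^sup>2)
      \<le> m * square_integral (\<lambda>a b. (folded a b - (\<integral>x. folded x b \<partial>unit_measure))\<^sup>2)"
    and pos: "k > 0" "m > 0" "w > 0"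
  shows "\<exists>\<alpha>. (\<Sum>c\<leftarrow>L. \<integral>\<^sup>+z. ennreal ((g z - \<alpha>)\<^sup>2) * indicator (piece_image c) z \<partial>lborel)
    \<le> ennreal (m / (k * w\<^sup>2)) *
      (\<Sum>c\<leftarrow>L. \<integral>\<^sup>+z. ennreal (piece_slope c gs gt z) * indicator (piece_image c) z \<partial>lborel)"
proof -
  obtain B where B: "\<And>a b. a \<in> {0..1} \<Longrightarrow> b \<in> {0..1} \<Longrightarrow> \<bar>folded a b\<bar> \<le> B"
    using bounded_folded by blast
  obtain C where C: "\<And>a b. \<bar>energy a b\<bar> \<le> C" using bounded_energy by blast
  define \<alpha> where "\<alpha> = square_integral folded"
  have Fsb: "square_bounded (\<lambda>a b. (folded a b - \<alpha>)\<^sup>2)"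
    by (intro square_bounded_power2 square_bounded_diff square_bounded_const square_boundedI[OF borel_folded B])
  have Gsb: "square_bounded energy"
    by (rule square_boundedI[OF borel_energy C])
  have "w\<^sup>2 * square_integral (\<lambda>a b. (folded a b - (\<integral>x. folded x b \<partial>unit_measure))\<^sup>2) \<le> square_integral energy"
    by (rule square_slice_variance_le[OF borel_folded B borel_energy C slice])
  then have step: "m * (w\<^sup>2 * square_integral (\<lambda>a b. (folded a b - (\<integral>x. folded x b \<partial>unit_measure))\<^sup>2))
      \<le> m * square_integral energy"
    using pos by (intro mult_left_mono) auto
  have "w\<^sup>2 * (k * square_integral (\<lambda>a b. (folded a b - \<alpha>)\<^sup>2))
      \<le> w\<^sup>2 * (m * square_integral (\<lambda>a b. (folded a b - (\<integral>x. folded x b \<partial>unit_measure))\<^sup>2))"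
    unfolding \<alpha>_def by (intro mult_left_mono bessel) simp
  also have "\<dots> \<le> m * square_integral energy"
    using step by (simp only: mult.left_commute)
  finally have "w\<^sup>2 * (k * square_integral (\<lambda>a b. (folded a b - \<alpha>)\<^sup>2)) \<le> m * square_integral energy" .
  then have real_bound: "square_integral (\<lambda>a b. (folded a b - \<alpha>)\<^sup>2) \<le> m / (k * w\<^sup>2) * square_integral energy"
    using pos by (simp add: field_simps)
  have "(\<integral>\<^sup>+z. ennreal ((g (\<Gamma> z) - \<alpha>)\<^sup>2) \<partial>square_measure) = ennreal (square_integral (\<lambda>a b. (folded a b - \<alpha>)\<^sup>2))"
    using nn_integral_eq_integral[OF square_bounded_integrable[OF Fsb]]
    by (simp add: square_integral_def folded_def)
  also have "\<dots> \<le> ennreal (m / (k * w\<^sup>2)) * ennreal (square_integral energy)"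
    unfolding ennreal_mult'[symmetric, OF divide_nonneg_nonneg[OF less_imp_le[OF pos(2)]
      mult_nonneg_nonneg[OF less_imp_le[OF pos(1)] zero_le_power2]]]
    by (rule ennreal_leI[OF real_bound])
  also have "ennreal (square_integral energy) = (\<integral>\<^sup>+z. energy (fst z) (snd z) \<partial>square_measure)"
  proof -
    have "0 \<le> energy a b" for a b
      unfolding energy_def using slope_nonneg by (intro sum_list_nonneg) auto
    then show ?thesis
      using nn_integral_eq_integral[OF square_bounded_integrable[OF Gsb]] by (simp add: square_integral_def)
  qed
  also have "\<dots> = (\<integral>\<^sup>+z. (\<Sum>c\<leftarrow>L. ennreal (piece_slope c gs gt (piece_map c z))
      * indicator (piece_image c) (piece_map c z)) \<partial>square_measure)"
  proof (intro nn_integral_cong)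
    fix z :: "real \<times> real"
    have "ennreal (\<Sum>c\<leftarrow>K. piece_slope c gs gt (piece_map c z) * indicator (piece_image c) (piece_map c z))
      = (\<Sum>c\<leftarrow>K. ennreal (piece_slope c gs gt (piece_map c z)) * indicator (piece_image c) (piece_map c z))" for K
    proof (induction K)
      case (Cons c K)
      let ?t = "\<lambda>c. piece_slope c gs gt (piece_map c z) * indicator (piece_image c) (piece_map c z)"
      have t: "0 \<le> ?t c" "ennreal (?t c)
          = ennreal (piece_slope c gs gt (piece_map c z)) * indicator (piece_image c) (piece_map c z)" for c
        using slope_nonneg by (auto split: split_indicator)
      have "0 \<le> (\<Sum>c\<leftarrow>K. ?t c)"
        using t(1) by (intro sum_list_nonneg) auto
      then have "ennreal (?t c + (\<Sum>c\<leftarrow>K. ?t c)) = ennreal (?t c) + ennreal (\<Sum>c\<leftarrow>K. ?t c)"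
        using t(1) by (intro ennreal_plus)
      then show ?case
        unfolding list.map sum_list.Cons Cons.IH t(2) .
    qed simp
    then show "ennreal (energy (fst z) (snd z)) = (\<Sum>c\<leftarrow>L. ennreal (piece_slope c gs gt (piece_map c z))
      * indicator (piece_image c) (piece_map c z))"
      unfolding energy_def by simp
  qed
  finally have le: "(\<integral>\<^sup>+z. ennreal ((g (\<Gamma> z) - \<alpha>)\<^sup>2) \<partial>square_measure) \<le> ennreal (m / (k * w\<^sup>2)) *
    (\<integral>\<^sup>+z. (\<Sum>c\<leftarrow>L. ennreal (piece_slope c gs gt (piece_map c z))
      * indicator (piece_image c) (piece_map c z)) \<partial>square_measure)" .
  have gm [measurable]: "g \<in> borel_measurable borel"
    by (intro borel_measurable_continuous_onI continuous_g)
  have "ennreal D * (\<integral>\<^sup>+z. ennreal ((g (\<Gamma> z) - \<alpha>)\<^sup>2) \<partial>square_measure)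
    \<le> ennreal (m / (k * w\<^sup>2)) * (ennreal D * (\<integral>\<^sup>+z. (\<Sum>c\<leftarrow>L. ennreal (piece_slope c gs gt (piece_map c z))
      * indicator (piece_image c) (piece_map c z)) \<partial>square_measure))"
    using mult_left_mono[OF le, of "ennreal D"] by (simp add: mult.left_commute)
  then show ?thesis
    using nn_integral_fold_same[of "\<lambda>z. ennreal ((g z - \<alpha>)\<^sup>2)"]
      nn_integral_fold[of "\<lambda>c z. ennreal (piece_slope c gs gt z)"] by auto
qed

end

subsection \<open>The foldings onto the right isosceles and the equilateral triangle\<close>

lemma interior_triangleI:
  assumes "0 < snd z" "fst z < 1 - snd z" "- fst z < 1 - snd z"
  shows "z \<in> interior triangle"
proof -
  have "open {z :: real \<times> real. 0 < snd z \<and> fst z < 1 - snd z \<and> - fst z < 1 - snd z}"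
    by (intro open_Collect_conj open_Collect_less continuous_intros)
  then show ?thesis
    by (rule interiorI) (use assms in \<open>auto simp: triangle_def\<close>)
qed

definition diamond_pieces :: "piece list" where
  "diamond_pieces = [(1, 1, -1, 1, -1, 0, 0), (1, 1, -1, -1, 1, 0, 0)]"

text \<open>The right isosceles triangle is half of a square: the diagonal a = b becomes the base t
  = 0, the fold is the reflection in it, and the legs are sides of the square, which explains the
  Neumann condition on the slices.\<close>

definition diamond_fold :: "real \<times> real \<Rightarrow> real \<times> real" where
  "diamond_fold z = (fst z + snd z - 1, \<bar>fst z - snd z\<bar>)"

lemma triangle_fold_diamond: "triangle_fold diamond_pieces 2 diamond_fold"
proof
  show "AE z in lborel. (indicator ({0..1} \<times> {0..1}) z :: ennreal)
      = (\<Sum>c\<leftarrow>diamond_pieces. indicator (piece_image c) (piece_map c z))"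
  proof -
    have "AE z in lborel. fst z - snd z \<noteq> (0 :: real)"
      using AE_line[of 1 "-1" 0] by simp
    then show ?thesis
  proof eventually_elim
    case (elim z)
    obtain a b where z: "z = (a, b)" by (cases z)
    with elim consider "a < b" | "b < a" by (auto simp: neq_iff)
    then show ?case
      by cases (auto simp: z diamond_pieces_def triangle_def split: split_indicator)
  qed
  qed
next
  show "\<exists>E. finite E \<and> (\<forall>a\<in>{0<..<1} - E. \<exists>c\<in>set diamond_pieces.
      piece_map c (a, b) \<in> piece_image c \<and> piece_map c (a, b) \<in> interior triangle)"
    if b: "b \<in> {0<..<1}" for b
  proof (intro exI[of _ "{b, 1 - b}"] conjI ballI)
    fix a assume a: "a \<in> {0<..<1} - {b, 1 - b}"
    let ?c = "if b < a then (1, 1, -1, 1, -1, 0, 0) else (1, 1, -1, -1, 1, 0, 0) :: piece"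
    have "?c \<in> set diamond_pieces" by (simp add: diamond_pieces_def)
    moreover have "piece_map ?c (a, b) \<in> interior triangle"
      using a b by (intro interior_triangleI) (auto split: if_splits)
    moreover have "piece_map ?c (a, b) \<in> piece_image ?c"
      using a b by (auto simp: triangle_def)
    ultimately show "\<exists>c\<in>set diamond_pieces.
      piece_map c (a, b) \<in> piece_image c \<and> piece_map c (a, b) \<in> interior triangle" by blast
  qed simp
qed (auto simp: diamond_pieces_def diamond_fold_def triangle_def intro!: continuous_intros)

text \<open>In the metric ds^2 + 3 dt^2 of the equilateral triangle, s = 3 a - 1 and t = 2 b - a
  give 12 (da^2 - da db + db^2). So a and b are coordinates for a hexagonal lattice of translations,
  and its unit cell has the area of six alcoves. Entries 0 and 1 are whole alcoves. The other eight
  form the pairs (2, 3), (4, 5), (6, 7), (8, 9): the two halves of an alcove cut along its altitude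
  by an edge of the square, one of them moved to the opposite edge by a unit translation.\<close>

definition hex :: "nat \<Rightarrow> piece" where
  "hex i = [(3, 0, -1, -1, 2, 0, 0), (0, -3, 2, -2, 1, 1, 0),
    (3, 0, -1, 1, -2, 0, 1), (3, 0, -1, 1, -2, 2, -1),
    (-3, 3, 2, -1, -1, 1, 1), (-3, 3, -1, -1, -1, 2, -1),
    (0, -3, 2, 2, -1, -1, 1), (0, -3, 2, 2, -1, 1, -1),
    (-3, 3, -1, 1, 1, 0, -1), (-3, 3, 2, 1, 1, -1, 1)] ! i"

lemma hex_simps [simp]:
  "hex 0 = (3, 0, -1, -1, 2, 0, 0)" "hex (Suc 0) = (0, -3, 2, -2, 1, 1, 0)"
  "hex 2 = (3, 0, -1, 1, -2, 0, 1)" "hex 3 = (3, 0, -1, 1, -2, 2, -1)"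
  "hex 4 = (-3, 3, 2, -1, -1, 1, 1)" "hex 5 = (-3, 3, -1, -1, -1, 2, -1)"
  "hex 6 = (0, -3, 2, 2, -1, -1, 1)" "hex 7 = (0, -3, 2, 2, -1, 1, -1)"
  "hex 8 = (-3, 3, -1, 1, 1, 0, -1)" "hex 9 = (-3, 3, 2, 1, 1, -1, 1)"
  by (simp_all add: hex_def)

definition hexagonal_pieces :: "piece list" where
  "hexagonal_pieces = [hex 0, hex 1, hex 2, hex 3, hex 4, hex 5, hex 6, hex 7, hex 8, hex 9]"

text \<open>The successive minima and maxima are the reflections in the walls \<open>a + b = 1\<close>, then \<open>2 a - b = 1\<close> and
  \<open>2 b - a = 1\<close>, then \<open>2 a = b\<close> and \<open>2 b = a\<close> of the tiling, in lattice coordinates.\<close>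

definition hexagonal_fold :: "real \<times> real \<Rightarrow> real \<times> real" where
  "hexagonal_fold z = (let a = min (fst z) (1 - snd z); b = min (snd z) (1 - fst z);
     a' = min a (1 - a + b); b' = min b (1 - b + a);
     a'' = max a' (b' - a'); b'' = max b' (a' - b')
   in (3 * a'' - 1, 2 * b'' - a''))"

lemma hexagonal_foldI:
  assumes "min a (1 - b) = a1" "min b (1 - a) = b1" "min a1 (1 - a1 + b1) = a2" "min b1 (1 - b1 + a1) = b2"
    "max a2 (b2 - a2) = a3" "max b2 (a2 - b2) = b3"
  shows "hexagonal_fold (a, b) = (3 * a3 - 1, 2 * b3 - a3)"
  using assms by (simp add: hexagonal_fold_def Let_def)

text \<open>No wall crosses an alcove, so each min and max selects the same argument throughout the
  part of it in the square. The values passed to \<open>hexagonal_foldI\<close> record the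
  selections made in the first two rounds.\<close>

lemma hexagonal_fold_on_piece:
  assumes ab: "a \<in> {0..1}" "b \<in> {0..1}" and "c \<in> set hexagonal_pieces" "piece_map c (a, b) \<in> triangle"
  shows "hexagonal_fold (a, b) = piece_map c (a, b)"
proof -
  have p1: "hexagonal_fold (a, b) = piece_map (hex 0) (a, b)"
    if "piece_map (hex 0) (a, b) \<in> triangle"
  proof -
    have "hexagonal_fold (a, b) = (3 * (a) - 1, 2 * (b) - (a))"
      by (rule hexagonal_foldI[of a b "a" "b" "a" "b"])
        (use that ab in \<open>auto simp: triangle_def\<close>)
    then show ?thesis by simp
  qed
  have p2: "hexagonal_fold (a, b) = piece_map (hex 1) (a, b)"
    if "piece_map (hex 1) (a, b) \<in> triangle"
  proof -
    have "hexagonal_fold (a, b) = (3 * (1 - b) - 1, 2 * (1 - a) - (1 - b))"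
      by (rule hexagonal_foldI[of a b "1 - b" "1 - a" "1 - b" "1 - a"])
        (use that ab in \<open>auto simp: triangle_def\<close>)
    then show ?thesis by simp
  qed
  have p3: "hexagonal_fold (a, b) = piece_map (hex 2) (a, b)"
    if "piece_map (hex 2) (a, b) \<in> triangle"
  proof -
    have "hexagonal_fold (a, b) = (3 * (a) - 1, 2 * (a - b) - (a))"
      by (rule hexagonal_foldI[of a b "a" "b" "a" "b"])
        (use that ab in \<open>auto simp: triangle_def\<close>)
    then show ?thesis by simp
  qed
  have p4: "hexagonal_fold (a, b) = piece_map (hex 3) (a, b)"
    if "piece_map (hex 3) (a, b) \<in> triangle"
  proof -
    have "hexagonal_fold (a, b) = (3 * (a) - 1, 2 * (1 + a - b) - (a))"
      by (rule hexagonal_foldI[of a b "1 - b" "1 - a" "1 - b" "1 + a - b"])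
        (use that ab in \<open>auto simp: triangle_def\<close>)
    then show ?thesis by simp
  qed
  have p5: "hexagonal_fold (a, b) = piece_map (hex 4) (a, b)"
    if "piece_map (hex 4) (a, b) \<in> triangle"
  proof -
    have "hexagonal_fold (a, b) = (3 * (1 - a + b) - 1, 2 * (1 - a) - (1 - a + b))"
      by (rule hexagonal_foldI[of a b "a" "b" "1 - a + b" "b"])
        (use that ab in \<open>auto simp: triangle_def\<close>)
    then show ?thesis by simp
  qed
  have p6: "hexagonal_fold (a, b) = piece_map (hex 5) (a, b)"
    if "piece_map (hex 5) (a, b) \<in> triangle"
  proof -
    have "hexagonal_fold (a, b) = (3 * (b - a) - 1, 2 * (1 - a) - (b - a))"
      by (rule hexagonal_foldI[of a b "1 - b" "1 - a" "1 - b" "1 - a"])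
        (use that ab in \<open>auto simp: triangle_def\<close>)
    then show ?thesis by simp
  qed
  have p7: "hexagonal_fold (a, b) = piece_map (hex 6) (a, b)"
    if "piece_map (hex 6) (a, b) \<in> triangle"
  proof -
    have "hexagonal_fold (a, b) = (3 * (1 - b) - 1, 2 * (a - b) - (1 - b))"
      by (rule hexagonal_foldI[of a b "1 - b" "1 - a" "1 - b" "1 - a"])
        (use that ab in \<open>auto simp: triangle_def\<close>)
    then show ?thesis by simp
  qed
  have p8: "hexagonal_fold (a, b) = piece_map (hex 7) (a, b)"
    if "piece_map (hex 7) (a, b) \<in> triangle"
  proof -
    have "hexagonal_fold (a, b) = (3 * (1 - b) - 1, 2 * (1 - b + a) - (1 - b))"
      by (rule hexagonal_foldI[of a b "a" "b" "a" "1 - b + a"])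
        (use that ab in \<open>auto simp: triangle_def\<close>)
    then show ?thesis by simp
  qed
  have p9: "hexagonal_fold (a, b) = piece_map (hex 8) (a, b)"
    if "piece_map (hex 8) (a, b) \<in> triangle"
  proof -
    have "hexagonal_fold (a, b) = (3 * (b - a) - 1, 2 * (b) - (b - a))"
      by (rule hexagonal_foldI[of a b "a" "b" "a" "b"])
        (use that ab in \<open>auto simp: triangle_def\<close>)
    then show ?thesis by simp
  qed
  have p10: "hexagonal_fold (a, b) = piece_map (hex 9) (a, b)"
    if "piece_map (hex 9) (a, b) \<in> triangle"
  proof -
    have "hexagonal_fold (a, b) = (3 * (1 + b - a) - 1, 2 * (b) - (1 + b - a))"
      by (rule hexagonal_foldI[of a b "1 - b" "1 - a" "1 + b - a" "1 - a"])
        (use that ab in \<open>auto simp: triangle_def\<close>)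
    then show ?thesis by simp
  qed
  from assms(3,4) show ?thesis
    unfolding hexagonal_pieces_def set_simps insert_iff empty_iff
    by (elim disjE) (use p1 p2 p3 p4 p5 p6 p7 p8 p9 p10 in \<open>simp_all only: simp_thms\<close>)
qed

text \<open>The square is split along a = b because \<open>circle_diff\<close> changes its formula
  there. The walls a + b = 1, a = 2 b and 2 a - b = 1 cut the half below into six cells, one for
  each listed piece; the half above is the mirror image.\<close>

lemma hexagonal_cover_below:
  assumes "a \<in> {0..1}" "b \<in> {0..1}" "b \<le> a"
  shows "\<exists>i\<in>{0, 1, 2, 4, 6, 9}. piece_map (hex i) (a, b) \<in> triangle"
proof -
  consider "a + b \<le> 1" "a \<le> 2 * b"
    | "a + b \<le> 1" "2 * b < a" "2 * a - b \<le> 1"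
    | "a + b \<le> 1" "2 * b < a" "1 < 2 * a - b"
    | "1 < a + b" "a \<le> 2 * b" "2 * a - b \<le> 1"
    | "1 < a + b" "a \<le> 2 * b" "1 < 2 * a - b"
    | "1 < a + b" "2 * b < a"
    by linarith
  then show ?thesis
    by cases (use assms in \<open>auto simp: triangle_def\<close>)
qed

lemma hexagonal_cover_above:
  assumes "a \<in> {0..1}" "b \<in> {0..1}" "a \<le> b"
  shows "\<exists>i\<in>{0, 1, 3, 5, 7, 8}. piece_map (hex i) (a, b) \<in> triangle"
proof -
  consider "a + b \<le> 1" "b \<le> 2 * a"
    | "a + b \<le> 1" "2 * a < b" "2 * b - a \<le> 1"
    | "a + b \<le> 1" "2 * a < b" "1 < 2 * b - a"
    | "1 < a + b" "b \<le> 2 * a" "2 * b - a \<le> 1"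
    | "1 < a + b" "b \<le> 2 * a" "1 < 2 * b - a"
    | "1 < a + b" "2 * a < b"
    by linarith
  then show ?thesis
    by cases (use assms in \<open>auto simp: triangle_def\<close>)
qed

lemma hexagonal_fold_range:
  assumes ab: "a \<in> {0..1}" "b \<in> {0..1}"
  shows "hexagonal_fold (a, b) \<in> triangle"
proof -
  obtain i where "i \<in> {0, 1, 2, 3, 4, 5, 6, 7, 8, 9}" and i: "piece_map (hex i) (a, b) \<in> triangle"
    using hexagonal_cover_below[OF ab] hexagonal_cover_above[OF ab] linear[of b a] by blast
  then have "hex i \<in> set hexagonal_pieces"
    unfolding hexagonal_pieces_def set_simps by blast
  from hexagonal_fold_on_piece[OF ab this i] i show ?thesis by simp
qed

lemma hexagonal_fold_reflect: "hexagonal_fold (1 - b, 1 - a) = hexagonal_fold (a, b)"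
proof -
  have e: "1 - (1 - a) = a" "1 - (1 - b) = b" by simp_all
  show ?thesis
    unfolding hexagonal_fold_def Let_def fst_conv snd_conv e
      min.commute[of "1 - b" a] min.commute[of "1 - a" b] ..
qed

text \<open>The map b -> a - b mod 1 is a symmetry of the tiling modulo the lattice, so it permutes
  the pieces: \<open>piece_map (hex j)\<close> after it equals \<open>piece_map (hex i)\<close>. The
  indices below are this permutation. The whole alcoves 0 and 1 go to one half of their partner or
  to the other, depending on the side of the diagonal.\<close>

lemma hexagonal_fold_circle_diff:
  assumes ab: "a \<in> {0..1}" "b \<in> {0..1}"
  shows "hexagonal_fold (a, circle_diff a b) = hexagonal_fold (a, b)"
proof -
  have eq: "hexagonal_fold (a, circle_diff a b) = hexagonal_fold (a, b)"
    if "piece_map (hex i) (a, b) \<in> triangle" "piece_map (hex j) (a, circle_diff a b) = piece_map (hex i) (a, b)"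
      "hex i \<in> set hexagonal_pieces" "hex j \<in> set hexagonal_pieces" for i j
    using hexagonal_fold_on_piece[OF ab that(3,1)]
      hexagonal_fold_on_piece[OF ab(1) circle_diff_range[OF ab] that(4)] that(1,2) by simp
  show ?thesis
  proof (cases "b \<le> a")
  case True
    then have d: "circle_diff a b = a - b" and le: "b \<le> a" by (auto simp: circle_diff_def)
    from hexagonal_cover_below[OF ab le] obtain i where "i \<in> {0, 1, 2, 4, 6, 9}"
      and i: "piece_map (hex i) (a, b) \<in> triangle" by (rule bexE)
    from this(1) consider "i = 0" | "i = 1" | "i = 2" | "i = 4" | "i = 6" | "i = 9" by blast
    then show ?thesis
    proof cases
      case 1
      with i show ?thesis by (intro eq[of i 2]) (simp_all add: d hexagonal_pieces_def)
    next
      case 2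
      with i show ?thesis by (intro eq[of i 4]) (simp_all add: d hexagonal_pieces_def)
    next
      case 3
      with i show ?thesis by (intro eq[of i 0]) (simp_all add: d hexagonal_pieces_def)
    next
      case 4
      with i show ?thesis by (intro eq[of i 1]) (simp_all add: d hexagonal_pieces_def)
    next
      case 5
      with i show ?thesis by (intro eq[of i 9]) (simp_all add: d hexagonal_pieces_def)
    next
      case 6
      with i show ?thesis by (intro eq[of i 6]) (simp_all add: d hexagonal_pieces_def)
    qed
  next
  case False
    then have d: "circle_diff a b = 1 + a - b" and le: "a \<le> b" by (auto simp: circle_diff_def)
    from hexagonal_cover_above[OF ab le] obtain i where "i \<in> {0, 1, 3, 5, 7, 8}"
      and i: "piece_map (hex i) (a, b) \<in> triangle" by (rule bexE)
    from this(1) consider "i = 0" | "i = 1" | "i = 3" | "i = 5" | "i = 7" | "i = 8" by blast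
    then show ?thesis
    proof cases
      case 1
      with i show ?thesis by (intro eq[of i 3]) (simp_all add: d hexagonal_pieces_def)
    next
      case 2
      with i show ?thesis by (intro eq[of i 5]) (simp_all add: d hexagonal_pieces_def)
    next
      case 3
      with i show ?thesis by (intro eq[of i 0]) (simp_all add: d hexagonal_pieces_def)
    next
      case 4
      with i show ?thesis by (intro eq[of i 1]) (simp_all add: d hexagonal_pieces_def)
    next
      case 5
      with i show ?thesis by (intro eq[of i 8]) (simp_all add: d hexagonal_pieces_def)
    next
      case 6
      with i show ?thesis by (intro eq[of i 7]) (simp_all add: d hexagonal_pieces_def)
    qed
  qed
qed

text \<open>The edges a = 0 and a = 1 carry the two halves of the same alcoves, glued by a unit
  translation. The point b = 1/2 separates the alcove of the pieces 8 and 9 from that of 6 and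
  7.\<close>

lemma hexagonal_fold_periodic:
  assumes b: "b \<in> {0..1}"
  shows "hexagonal_fold (0, b) = hexagonal_fold (1, b)"
proof (cases "2 * b \<le> 1")
  case True
  have "hexagonal_fold (0, b) = piece_map (hex 8) (0, b)"
    by (rule hexagonal_fold_on_piece) (use b True in \<open>auto simp: hexagonal_pieces_def triangle_def\<close>)
  moreover have "hexagonal_fold (1, b) = piece_map (hex 9) (1, b)"
    by (rule hexagonal_fold_on_piece) (use b True in \<open>auto simp: hexagonal_pieces_def triangle_def\<close>)
  ultimately show ?thesis by simp
next
  case False
  have "hexagonal_fold (0, b) = piece_map (hex 7) (0, b)"
    by (rule hexagonal_fold_on_piece) (use b False in \<open>auto simp: hexagonal_pieces_def triangle_def\<close>)
  moreover have "hexagonal_fold (1, b) = piece_map (hex 6) (1, b)"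
    by (rule hexagonal_fold_on_piece) (use b False in \<open>auto simp: hexagonal_pieces_def triangle_def\<close>)
  ultimately show ?thesis by simp
qed

lemma hexagonal_count:
  assumes off: "a + b \<noteq> 1" "2 * a - b \<noteq> 0" "2 * a - b \<noteq> 1" "2 * b - a \<noteq> 0" "2 * b - a \<noteq> 1"
  shows "(indicator ({0..1} \<times> {0..1}) (a, b) :: ennreal)
    = (\<Sum>c\<leftarrow>hexagonal_pieces. indicator (piece_image c) (piece_map c (a, b)))"
proof (cases "(a, b) \<in> {0..1} \<times> {0..1}")
  case True
  then have ab: "0 \<le> a" "a \<le> 1" "0 \<le> b" "b \<le> 1" by auto
  define P Q R S T where "P \<longleftrightarrow> a + b \<le> 1" and "Q \<longleftrightarrow> a \<le> 2 * b" and "R \<longleftrightarrow> b \<le> 2 * a"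
    and "S \<longleftrightarrow> 2 * a - b \<le> 1" and "T \<longleftrightarrow> 2 * b - a \<le> 1"
  note defs = this
  have e1: "piece_map (hex 0) (a, b) \<in> piece_image (hex 0) \<longleftrightarrow> P \<and> Q \<and> R"
    unfolding defs using ab off by (auto simp: triangle_def)
  have e2: "piece_map (hex 1) (a, b) \<in> piece_image (hex 1) \<longleftrightarrow> \<not> P \<and> S \<and> T"
    unfolding defs using ab off by (auto simp: triangle_def)
  have e3: "piece_map (hex 2) (a, b) \<in> piece_image (hex 2) \<longleftrightarrow> \<not> Q \<and> S"
    unfolding defs using ab off by (auto simp: triangle_def)
  have e4: "piece_map (hex 3) (a, b) \<in> piece_image (hex 3) \<longleftrightarrow> \<not> R \<and> \<not> P"
    unfolding defs using ab off by (auto simp: triangle_def)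
  have e5: "piece_map (hex 4) (a, b) \<in> piece_image (hex 4) \<longleftrightarrow> P \<and> \<not> S"
    unfolding defs using ab off by (auto simp: triangle_def)
  have e6: "piece_map (hex 5) (a, b) \<in> piece_image (hex 5) \<longleftrightarrow> R \<and> \<not> T"
    unfolding defs using ab off by (auto simp: triangle_def)
  have e7: "piece_map (hex 6) (a, b) \<in> piece_image (hex 6) \<longleftrightarrow> \<not> S \<and> Q"
    unfolding defs using ab off by (auto simp: triangle_def)
  have e8: "piece_map (hex 7) (a, b) \<in> piece_image (hex 7) \<longleftrightarrow> \<not> T \<and> P"
    unfolding defs using ab off by (auto simp: triangle_def)
  have e9: "piece_map (hex 8) (a, b) \<in> piece_image (hex 8) \<longleftrightarrow> T \<and> \<not> R"
    unfolding defs using ab off by (auto simp: triangle_def)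
  have e10: "piece_map (hex 9) (a, b) \<in> piece_image (hex 9) \<longleftrightarrow> \<not> Q \<and> \<not> P"
    unfolding defs using ab off by (auto simp: triangle_def)
  \<comment> \<open>Inside the square these relations leave exactly ten sign patterns of the five
    wall forms, one for each of \<open>e1\<close> to \<open>e10\<close>. So exactly one of the ten
    indicators is 1.\<close>
  have "Q \<or> R" "S \<or> T" "P \<and> Q \<longrightarrow> S" "P \<and> R \<longrightarrow> T" "\<not> P \<and> S \<longrightarrow> Q" "\<not> P \<and> T \<longrightarrow> R"
    unfolding defs using ab by auto
  then show ?thesis
    using True unfolding hexagonal_pieces_def list.map sum_list.Cons sum_list.Nil indicator_def[of "piece_image _"]
      e1 e2 e3 e4 e5 e6 e7 e8 e9 e10
    by (cases P; cases Q; cases R; cases S; cases T) simp_all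
next
  case False
  have "piece_map c (a, b) \<notin> piece_image c" if "c \<in> set hexagonal_pieces" for c
  proof
    assume "piece_map c (a, b) \<in> piece_image c"
    with that have "(a, b) \<in> {0..1} \<times> {0..1}"
      unfolding hexagonal_pieces_def set_simps
      by (elim insertE emptyE) (simp_all add: triangle_def)
    with False show False by simp
  qed
  then have "(\<Sum>c\<leftarrow>hexagonal_pieces. indicator (piece_image c) (piece_map c (a, b)) :: ennreal)
      = (\<Sum>c\<leftarrow>hexagonal_pieces. 0)"
    by (intro arg_cong[where f = sum_list] map_cong) auto
  then show ?thesis using False by simp
qed

lemma hexagonal_interior:
  assumes off: "a + b \<noteq> 1" "2 * a - b \<noteq> 0" "2 * a - b \<noteq> 1" "2 * b - a \<noteq> 0" "2 * b - a \<noteq> 1"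
    and ab: "a \<in> {0<..<1}" "b \<in> {0<..<1}"
    and "c \<in> set hexagonal_pieces" "piece_map c (a, b) \<in> piece_image c"
  shows "piece_map c (a, b) \<in> interior triangle"
  using assms(8,9) unfolding hexagonal_pieces_def set_simps
  by (elim insertE emptyE; intro interior_triangleI) (use off ab in \<open>auto simp: triangle_def\<close>)

lemma triangle_fold_hexagonal: "triangle_fold hexagonal_pieces 6 hexagonal_fold"
proof
  show "AE z in lborel. (indicator ({0..1} \<times> {0..1}) z :: ennreal)
      = (\<Sum>c\<leftarrow>hexagonal_pieces. indicator (piece_image c) (piece_map c z))"
    using AE_line[of 1 1 1, OF disjI1[OF one_neq_zero]] AE_line[of 2 "-1" 0, simplified]
      AE_line[of 2 "-1" 1, simplified] AE_line[of "-1" 2 0, simplified] AE_line[of "-1" 2 1, simplified]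
  proof eventually_elim
    case (elim z)
    show ?case
      using hexagonal_count[of "fst z" "snd z"] elim by simp
  qed
next
  show "hexagonal_fold z = piece_map c z"
    if "z \<in> {0..1} \<times> {0..1}" "c \<in> set hexagonal_pieces" "piece_map c z \<in> triangle" for z c
    using that hexagonal_fold_on_piece[of "fst z" "snd z" c] by (auto simp del: piece_map.simps)
next
  show "hexagonal_fold z \<in> triangle" if "z \<in> {0..1} \<times> {0..1}" for z
    using that hexagonal_fold_range[of "fst z" "snd z"] by auto
next
  show "\<exists>E. finite E \<and> (\<forall>a\<in>{0<..<1} - E. \<exists>c\<in>set hexagonal_pieces.
      piece_map c (a, b) \<in> piece_image c \<and> piece_map c (a, b) \<in> interior triangle)"
    if b: "b \<in> {0<..<1}" for b
  \<comment> \<open>These are the points in which the slice at height b meets the five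
    walls.\<close>
  proof (intro exI[of _ "{1 - b, b / 2, (1 + b) / 2, 2 * b, 2 * b - 1}"] conjI ballI)
    fix a assume a: "a \<in> {0<..<1} - {1 - b, b / 2, (1 + b) / 2, 2 * b, 2 * b - 1}"
    then have off: "a + b \<noteq> 1" "2 * a - b \<noteq> 0" "2 * a - b \<noteq> 1" "2 * b - a \<noteq> 0" "2 * b - a \<noteq> 1"
      by (auto simp: field_simps)
    have "\<exists>c\<in>set hexagonal_pieces. piece_map c (a, b) \<in> piece_image c"
    proof (rule ccontr)
      assume "\<not> ?thesis"
      then have "(\<Sum>c\<leftarrow>hexagonal_pieces. indicator (piece_image c) (piece_map c (a, b)) :: ennreal)
          = (\<Sum>c\<leftarrow>hexagonal_pieces. 0)"
        by (intro arg_cong[where f = sum_list] map_cong) auto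
      then have none: "(\<Sum>c\<leftarrow>hexagonal_pieces. indicator (piece_image c) (piece_map c (a, b)) :: ennreal) = 0"
        by simp
      have "indicator ({0..1} \<times> {0..1}) (a, b) = (0 :: ennreal)"
        using hexagonal_count[OF off] unfolding none .
      then show False using a b by (auto simp: indicator_def split: if_splits)
    qed
    then show "\<exists>c\<in>set hexagonal_pieces. piece_map c (a, b) \<in> piece_image c \<and>
        piece_map c (a, b) \<in> interior triangle"
      using hexagonal_interior[OF off] a b by blast
  qed simp
next
  show "continuous_on UNIV hexagonal_fold"
    unfolding hexagonal_fold_def Let_def by (intro continuous_intros)
qed (auto simp: hexagonal_pieces_def)

section \<open>Poincare inequalities for the two reflection triangles\<close>

definition triangle_integral :: "(real \<times> real \<Rightarrow> real) \<Rightarrow> ennreal" where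
  "triangle_integral h = (\<integral>\<^sup>+z. ennreal (h z) * indicator triangle z \<partial>lborel)"

lemma triangle_integral_add:
  assumes [measurable]: "f \<in> borel_measurable borel" "g \<in> borel_measurable borel"
    and "\<And>z. 0 \<le> f z" "\<And>z. 0 \<le> g z"
  shows "triangle_integral f + triangle_integral g = triangle_integral (\<lambda>z. f z + g z)"
  unfolding triangle_integral_def using assms
  by (subst nn_integral_add[symmetric]) (auto simp: distrib_right)

lemma triangle_integral_cmult:
  assumes [measurable]: "f \<in> borel_measurable borel" and "0 \<le> c"
  shows "triangle_integral (\<lambda>z. c * f z) = ennreal c * triangle_integral f"
  unfolding triangle_integral_def using assms(2)
  by (subst nn_integral_cmult[symmetric]) (auto simp: ennreal_mult' mult.assoc)

lemma triangle_integral_halves: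
  assumes [measurable]: "h \<in> borel_measurable borel"
  shows "(\<integral>\<^sup>+z. ennreal (h z) * indicator (piece_image (p, q, e, r, s, f, 1)) z \<partial>lborel)
    + (\<integral>\<^sup>+z. ennreal (h z) * indicator (piece_image (p', q', e', r', s', f', -1)) z \<partial>lborel)
    = triangle_integral h"
proof -
  let ?A = "piece_image (p, q, e, r, s, f, 1)" and ?B = "piece_image (p', q', e', r', s', f', -1)"
  have "(\<integral>\<^sup>+z. ennreal (h z) * indicator ?A z \<partial>lborel) + (\<integral>\<^sup>+z. ennreal (h z) * indicator ?B z \<partial>lborel)
      = (\<integral>\<^sup>+z. ennreal (h z) * indicator ?A z + ennreal (h z) * indicator ?B z \<partial>lborel)"
    by (intro nn_integral_add[symmetric]) (auto simp del: piece_image.simps)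
  also have "\<dots> = triangle_integral h"
    unfolding triangle_integral_def
  proof (rule nn_integral_cong_AE)
    show "AE z in lborel. ennreal (h z) * indicator ?A z + ennreal (h z) * indicator ?B z
        = ennreal (h z) * indicator triangle z"
      using AE_line[of 1 "-3" "-1", simplified]
      by eventually_elim (auto split: split_indicator)
  qed
  finally show ?thesis .
qed

lemma triangle_integral_full:
  "(\<integral>\<^sup>+z. ennreal (h z) * indicator (piece_image (p, q, e, r, s, f, 0)) z \<partial>lborel) = triangle_integral h"
  unfolding triangle_integral_def by (auto intro!: nn_integral_cong split: split_indicator)

text \<open>The slices run parallel to the legs and have slopes gs + gt and gs - gt on the two
  pieces. By the parallelogram identity the squares add up to 2 (gs^2 + gt^2), and this 2 cancels
  against the two copies of the triangle in the square. The 2 in the constant comes from the two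
  directions.\<close>

theorem poincare_right_triangle:
  fixes g gs gt :: "real \<times> real \<Rightarrow> real"
  assumes deriv: "\<And>z. (g has_derivative (\<lambda>h. fst h * gs z + snd h * gt z)) (at z)"
    and gs: "continuous_on UNIV gs" and gt: "continuous_on UNIV gt" and w: "0 < w" "w < pi"
  shows "\<exists>\<alpha>. triangle_integral (\<lambda>z. (g z - \<alpha>)\<^sup>2)
    \<le> ennreal (2 / w\<^sup>2) * triangle_integral (\<lambda>z. (gs z)\<^sup>2 + (gt z)\<^sup>2)"
proof -
  interpret triangle_fold_function diamond_pieces 2 diamond_fold g gs gt
    by (intro triangle_fold_function.intro triangle_fold_diamond triangle_fold_function_axioms.intro deriv gs gt)
  have slice: "\<exists>A. w\<^sup>2 * integral {0..1} (\<lambda>a. (folded a b - A)\<^sup>2) \<le> integral {0..1} (\<lambda>a. energy a b)"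
    if b: "b \<in> {0<..<1}" for b
    by (rule folded_slice[OF b]) (rule wirtinger_neumann[OF _ _ _ _ _ w])
  obtain B where B: "\<And>a b. a \<in> {0..1} \<Longrightarrow> b \<in> {0..1} \<Longrightarrow> \<bar>folded a b\<bar> \<le> B"
    using bounded_folded by blast
  have "square_integral (\<lambda>a b. (folded a b - square_integral folded)\<^sup>2)
      \<le> 2 * square_integral (\<lambda>a b. (folded a b - (\<integral>x. folded x b \<partial>unit_measure))\<^sup>2)"
    by (rule variance_le_slice_variance_symmetric[OF square_boundedI[OF borel_folded B]])
       (simp_all add: folded_def diamond_fold_def add.commute abs_minus_commute)
  then have "1 * square_integral (\<lambda>a b. (folded a b - square_integral folded)\<^sup>2)
      \<le> 2 * square_integral (\<lambda>a b. (folded a b - (\<integral>x. folded x b \<partial>unit_measure))\<^sup>2)"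
    by simp
  from poincare_from_fold[OF slice this] w obtain \<alpha> where
    \<alpha>: "(\<Sum>c\<leftarrow>diamond_pieces. \<integral>\<^sup>+z. ennreal ((g z - \<alpha>)\<^sup>2) * indicator (piece_image c) z \<partial>lborel)
      \<le> ennreal (2 / w\<^sup>2) *
        (\<Sum>c\<leftarrow>diamond_pieces. \<integral>\<^sup>+z. ennreal (piece_slope c gs gt z) * indicator (piece_image c) z \<partial>lborel)"
    by auto
  have [measurable]: "g \<in> borel_measurable borel" "gs \<in> borel_measurable borel" "gt \<in> borel_measurable borel"
    using borel_measurable_continuous_onI continuous_g gs gt by auto
  have "(\<Sum>c\<leftarrow>diamond_pieces. \<integral>\<^sup>+z. ennreal ((g z - \<alpha>)\<^sup>2) * indicator (piece_image c) z \<partial>lborel)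
      = ennreal 2 * triangle_integral (\<lambda>z. (g z - \<alpha>)\<^sup>2)"
    by (simp add: diamond_pieces_def triangle_integral_full mult_2 del: piece_image.simps)
  moreover have "(\<Sum>c\<leftarrow>diamond_pieces. \<integral>\<^sup>+z. ennreal (piece_slope c gs gt z) * indicator (piece_image c) z \<partial>lborel)
      = triangle_integral (\<lambda>z. (gs z + gt z)\<^sup>2) + triangle_integral (\<lambda>z. (gs z - gt z)\<^sup>2)"
    by (simp add: diamond_pieces_def triangle_integral_full del: piece_image.simps)
  moreover have "\<dots> = triangle_integral (\<lambda>z. 2 * ((gs z)\<^sup>2 + (gt z)\<^sup>2))"
  proof -
    have "(\<lambda>z. (gs z + gt z)\<^sup>2 + (gs z - gt z)\<^sup>2) = (\<lambda>z. 2 * ((gs z)\<^sup>2 + (gt z)\<^sup>2))"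
      by (simp add: fun_eq_iff power2_sum power2_diff)
    then show ?thesis
      using triangle_integral_add[of "\<lambda>z. (gs z + gt z)\<^sup>2" "\<lambda>z. (gs z - gt z)\<^sup>2"] by simp
  qed
  moreover have "\<dots> = ennreal 2 * triangle_integral (\<lambda>z. (gs z)\<^sup>2 + (gt z)\<^sup>2)"
    by (rule triangle_integral_cmult) auto
  ultimately have "ennreal 2 * triangle_integral (\<lambda>z. (g z - \<alpha>)\<^sup>2)
      \<le> ennreal 2 * (ennreal (2 / w\<^sup>2) * triangle_integral (\<lambda>z. (gs z)\<^sup>2 + (gt z)\<^sup>2))"
    using \<alpha> by (simp add: mult.left_commute)
  then show ?thesis
    by (subst (asm) ennreal_mult_le_mult_iff) auto
qed

text \<open>The slopes on the six alcoves are, up to sign, 3 gs - gt, 3 gs + gt and 2 gt, each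
  occurring twice; their squares add up to 36 (gs^2 + gt^2 / 3), a multiple of the Euclidean
  gradient after t is stretched by sqrt 3. Closed slices have first frequency 2 pi, hence 2 w in
  place of w, and the constant is 3 / (2 (2 w)^2) times 36 / 6.\<close>

theorem poincare_equilateral_triangle:
  fixes g gs gt :: "real \<times> real \<Rightarrow> real"
  assumes deriv: "\<And>z. (g has_derivative (\<lambda>h. fst h * gs z + snd h * gt z)) (at z)"
    and gs: "continuous_on UNIV gs" and gt: "continuous_on UNIV gt" and w: "0 < w" "w < pi"
  shows "\<exists>\<alpha>. triangle_integral (\<lambda>z. (g z - \<alpha>)\<^sup>2)
    \<le> ennreal (9 / (4 * w\<^sup>2)) * triangle_integral (\<lambda>z. (gs z)\<^sup>2 + (gt z)\<^sup>2 / 3)"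
proof -
  interpret triangle_fold_function hexagonal_pieces 6 hexagonal_fold g gs gt
    by (intro triangle_fold_function.intro triangle_fold_hexagonal triangle_fold_function_axioms.intro deriv gs gt)
  have slice: "\<exists>A. (2 * w)\<^sup>2 * integral {0..1} (\<lambda>a. (folded a b - A)\<^sup>2) \<le> integral {0..1} (\<lambda>a. energy a b)"
    if b: "b \<in> {0<..<1}" for b
  proof (rule folded_slice[OF b])
    fix E f'
    assume "finite E" "continuous_on {0..1} (\<lambda>a. folded a b)"
      "\<And>x. x \<in> {0<..<1} - E \<Longrightarrow> ((\<lambda>a. folded a b) has_real_derivative f' x) (at x)"
      "\<And>x. x \<in> {0<..<1} - E \<Longrightarrow> (f' x)\<^sup>2 \<le> energy x b"
      "(\<lambda>a. energy a b) integrable_on {0..1}"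
    moreover have "folded 0 b = folded 1 b"
      unfolding folded_def using hexagonal_fold_periodic[of b] b by simp
    ultimately show ?thesis
      using w by (intro wirtinger_periodic[where E = E and f' = f']) auto
  qed
  obtain B where B: "\<And>a b. a \<in> {0..1} \<Longrightarrow> b \<in> {0..1} \<Longrightarrow> \<bar>folded a b\<bar> \<le> B"
    using bounded_folded by blast
  have "2 * square_integral (\<lambda>a b. (folded a b - square_integral folded)\<^sup>2)
      \<le> 3 * square_integral (\<lambda>a b. (folded a b - (\<integral>x. folded x b \<partial>unit_measure))\<^sup>2)"
    by (rule variance_le_slice_variance_hexagonal[OF square_boundedI[OF borel_folded B]])
       (simp_all add: folded_def hexagonal_fold_reflect hexagonal_fold_circle_diff)
  from poincare_from_fold[OF slice this] w obtain \<alpha> where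
    \<alpha>: "(\<Sum>c\<leftarrow>hexagonal_pieces. \<integral>\<^sup>+z. ennreal ((g z - \<alpha>)\<^sup>2) * indicator (piece_image c) z \<partial>lborel)
      \<le> ennreal (3 / (2 * (2 * w)\<^sup>2)) *
        (\<Sum>c\<leftarrow>hexagonal_pieces. \<integral>\<^sup>+z. ennreal (piece_slope c gs gt z) * indicator (piece_image c) z \<partial>lborel)"
    by auto
  have [measurable]: "g \<in> borel_measurable borel" "gs \<in> borel_measurable borel" "gt \<in> borel_measurable borel"
    using borel_measurable_continuous_onI continuous_g gs gt by auto
  have halves: "(\<integral>\<^sup>+z. ennreal (h z) * indicator (piece_image (p, q, e, r, s, f, -1)) z \<partial>lborel)
    + (\<integral>\<^sup>+z. ennreal (h z) * indicator (piece_image (p', q', e', r', s', f', 1)) z \<partial>lborel)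
    = triangle_integral h" if "h \<in> borel_measurable borel" for h p q e r s f p' q' e' r' s' f'
    using triangle_integral_halves[OF that] by (simp add: add.commute del: piece_image.simps)
  let ?J = "\<lambda>h c. \<integral>\<^sup>+z. ennreal (h z) * indicator (piece_image c) z \<partial>lborel"
  have sum10: "(\<Sum>c\<leftarrow>hexagonal_pieces. \<integral>\<^sup>+z. ennreal (h c z) * indicator (piece_image c) z \<partial>lborel)
    = triangle_integral (h (hex 0)) + triangle_integral (h (hex 1))
      + triangle_integral (h (hex 2)) + triangle_integral (h (hex 4))
      + triangle_integral (h (hex 6)) + triangle_integral (h (hex 8))"
    if h: "\<And>c. h c \<in> borel_measurable borel"
      "h (hex 3) = h (hex 2)"
      "h (hex 5) = h (hex 4)"
      "h (hex 7) = h (hex 6)"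
      "h (hex 9) = h (hex 8)" for h :: "piece \<Rightarrow> real \<times> real \<Rightarrow> real"
  proof -
    have "(\<Sum>c\<leftarrow>hexagonal_pieces. \<integral>\<^sup>+z. ennreal (h c z) * indicator (piece_image c) z \<partial>lborel)
      = ?J (h (hex 0)) (hex 0)
        + ?J (h (hex 1)) (hex 1)
        + (?J (h (hex 2)) (hex 2) + ?J (h (hex 3)) (hex 3))
        + (?J (h (hex 4)) (hex 4) + ?J (h (hex 5)) (hex 5))
        + (?J (h (hex 6)) (hex 6) + ?J (h (hex 7)) (hex 7))
        + (?J (h (hex 8)) (hex 8) + ?J (h (hex 9)) (hex 9))"
      unfolding hexagonal_pieces_def list.map sum_list.Cons sum_list.Nil by (simp only: add.assoc add_0_right)
    then show ?thesis
      unfolding h(2-5) unfolding hex_simps One_nat_def triangle_integral_full triangle_integral_halves[OF h(1)] halves[OF h(1)] .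
  qed
  have bm: "h \<in> borel_measurable borel \<Longrightarrow> (\<lambda>z. (h z)\<^sup>2) \<in> borel_measurable borel" for h :: "real \<times> real \<Rightarrow> real"
    by measurable
  have "(\<Sum>c\<leftarrow>hexagonal_pieces. \<integral>\<^sup>+z. ennreal ((g z - \<alpha>)\<^sup>2) * indicator (piece_image c) z \<partial>lborel)
      = ennreal 6 * triangle_integral (\<lambda>z. (g z - \<alpha>)\<^sup>2)"
  proof -
    have six: "x + x + x + x + x + x = 6 * x" for x :: ennreal
    proof -
      have "6 * x = (1 + 1 + 1 + 1 + 1 + 1) * x" by simp
      then show ?thesis by (simp only: distrib_right mult_1)
    qed
    show ?thesis
      using sum10[of "\<lambda>_ z. (g z - \<alpha>)\<^sup>2"] six by simp
  qed
  moreover have "(\<Sum>c\<leftarrow>hexagonal_pieces. \<integral>\<^sup>+z. ennreal (piece_slope c gs gt z) * indicator (piece_image c) z \<partial>lborel)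
      = triangle_integral (\<lambda>z. (3 * gs z - gt z)\<^sup>2) + triangle_integral (\<lambda>z. (- 2 * gt z)\<^sup>2)
        + triangle_integral (\<lambda>z. (3 * gs z + gt z)\<^sup>2) + triangle_integral (\<lambda>z. (- 3 * gs z - gt z)\<^sup>2)
        + triangle_integral (\<lambda>z. (2 * gt z)\<^sup>2) + triangle_integral (\<lambda>z. (- 3 * gs z + gt z)\<^sup>2)"
  proof -
    have "piece_slope (p, q, e, r, s, f, \<sigma>) gs gt = (\<lambda>z. (p * gs z + r * gt z)\<^sup>2)" for p q e r s f \<sigma>
      by auto
    then show ?thesis
      by (subst sum10) (simp_all del: piece_slope.simps)
  qed
  moreover have "\<dots> = triangle_integral (\<lambda>z. 36 * ((gs z)\<^sup>2 + (gt z)\<^sup>2 / 3))"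
    by (subst triangle_integral_add; (auto simp: add_nonneg_nonneg)?)+
       (auto simp: triangle_integral_def power2_eq_square algebra_simps intro!: nn_integral_cong)
  moreover have "\<dots> = ennreal 36 * triangle_integral (\<lambda>z. (gs z)\<^sup>2 + (gt z)\<^sup>2 / 3)"
    by (rule triangle_integral_cmult) auto
  ultimately have "ennreal 6 * triangle_integral (\<lambda>z. (g z - \<alpha>)\<^sup>2)
      \<le> ennreal (3 / (2 * (2 * w)\<^sup>2)) * (ennreal 36 * triangle_integral (\<lambda>z. (gs z)\<^sup>2 + (gt z)\<^sup>2 / 3))"
    using \<alpha> by simp
  also have "\<dots> = ennreal 6 * (ennreal (9 / (4 * w\<^sup>2)) * triangle_integral (\<lambda>z. (gs z)\<^sup>2 + (gt z)\<^sup>2 / 3))"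
  proof -
    have "3 / (2 * (2 * w)\<^sup>2) * 36 = 6 * (9 / (4 * w\<^sup>2))"
      using w by (simp add: field_simps)
    then have "ennreal (3 / (2 * (2 * w)\<^sup>2)) * ennreal 36 = ennreal 6 * ennreal (9 / (4 * w\<^sup>2))"
      using ennreal_mult'[of "3 / (2 * (2 * w)\<^sup>2)" 36] ennreal_mult'[of 6 "9 / (4 * w\<^sup>2)"] by simp
    then show ?thesis by (simp only: mult.assoc[symmetric])
  qed
  finally show ?thesis
    by (subst (asm) ennreal_mult_le_mult_iff) auto
qed

subsection \<open>Triangle measures on the plane\<close>

definition vec2 :: "real \<Rightarrow> real \<Rightarrow> real^2" where
  "vec2 a b = (\<chi> i. if i = 1 then a else b)"

lemma vec2_component [simp]: "vec2 a b $ 1 = a" "vec2 a b $ 2 = b"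
  by (simp_all add: vec2_def)

lemma norm_real2: "(norm (x :: real^2))\<^sup>2 = (x $ 1)\<^sup>2 + (x $ 2)\<^sup>2"
  unfolding power2_norm_eq_inner by (simp add: inner_vec_def sum_2 power2_eq_square)

lemma inner_real2: "(x :: real^2) \<bullet> y = x $ 1 * y $ 1 + x $ 2 * y $ 2"
  by (simp add: inner_vec_def sum_2)

lemma Basis_real2: "(Basis :: (real^2) set) = {vec2 1 0, vec2 0 1}"
proof -
  have "axis 1 1 = vec2 1 0" "axis 2 1 = vec2 0 1"
    by (simp_all add: vec_eq_iff forall_2 axis_def)
  then show ?thesis
    by (auto simp: Basis_vec_def UNIV_2)
qed

lemma has_derivative_vec2:
  fixes f f' g g' :: "'a::real_normed_vector \<Rightarrow> real"
  assumes "(f has_derivative f') F" "(g has_derivative g') F"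
  shows "((\<lambda>x. vec2 (f x) (g x)) has_derivative (\<lambda>h. vec2 (f' h) (g' h))) F"
proof -
  have "(\<lambda>x. vec2 (p x) (q x)) = (\<lambda>x. p x *\<^sub>R vec2 1 0 + q x *\<^sub>R vec2 0 1)" for p q :: "'a \<Rightarrow> real"
    by (simp add: fun_eq_iff vec_eq_iff forall_2)
  note split = this[of f g] this[of f' g']
  show ?thesis
    unfolding split by (intro has_derivative_add has_derivative_scaleR_left assms)
qed

lemma continuous_on_vec2 [continuous_intros]:
  assumes "continuous_on S f" "continuous_on S g"
  shows "continuous_on S (\<lambda>x. vec2 (f x) (g x))"
proof -
  have split: "(\<lambda>x. vec2 (f x) (g x)) = (\<lambda>x. f x *\<^sub>R vec2 1 0 + g x *\<^sub>R vec2 0 1)"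
    by (simp add: fun_eq_iff vec_eq_iff forall_2)
  show ?thesis
    unfolding split by (intro continuous_on_add continuous_on_scaleR continuous_on_const assms)
qed

definition vec2_pair :: "real \<times> real \<Rightarrow> real^2" where
  "vec2_pair z = vec2 (fst z) (snd z)"

lemma borel_vec2_pair [measurable]: "vec2_pair \<in> borel_measurable borel"
  unfolding vec2_pair_def[abs_def]
  by (intro borel_measurable_continuous_onI continuous_intros)

text \<open>The substitution rules above are stated for pairs, the measures of the theorem live on
  \<open>real^2\<close>; this identity connects the two.\<close>

lemma lborel_real2: "(lborel :: (real^2) measure) = distr lborel borel vec2_pair"
proof (rule lborel_eqI)
  fix l u :: "real^2"
  assume "\<And>b. b \<in> Basis \<Longrightarrow> l \<bullet> b \<le> u \<bullet> b"
  from this[of "vec2 1 0"] this[of "vec2 0 1"] have le: "l $ 1 \<le> u $ 1" "l $ 2 \<le> u $ 2"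
    by (simp_all add: Basis_real2 inner_real2)
  have "vec2_pair -` box l u = box (l $ 1, l $ 2) (u $ 1, u $ 2)"
    by (auto simp: vec2_pair_def mem_box Basis_real2 inner_real2 Basis_prod_def)
  then have "emeasure (distr lborel borel vec2_pair) (box l u)
      = emeasure lborel (box (l $ 1, l $ 2) (u $ 1, u $ 2))"
    by (simp add: emeasure_distr)
  also have "\<dots> = ennreal (\<Prod>b\<in>Basis. ((u $ 1, u $ 2) - (l $ 1, l $ 2)) \<bullet> b)"
    using le by (subst emeasure_lborel_box) (auto simp: Basis_prod_def)
  also have "(\<Prod>b\<in>Basis. ((u $ 1, u $ 2) - (l $ 1, l $ 2)) \<bullet> b) = (u $ 1 - l $ 1) * (u $ 2 - l $ 2)"
    by (simp add: Basis_prod_def)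
  also have "\<dots> = (\<Prod>b\<in>Basis. (u - l) \<bullet> b)"
  proof -
    have "vec2 1 0 \<noteq> vec2 0 1" by (simp add: vec_eq_iff forall_2)
    then show ?thesis by (simp add: Basis_real2 inner_real2)
  qed
  finally show "emeasure (distr lborel borel vec2_pair) (box l u) = ennreal (\<Prod>b\<in>Basis. (u - l) \<bullet> b)" .
qed simp

lemma nn_integral_real2:
  assumes "h \<in> borel_measurable borel"
  shows "(\<integral>\<^sup>+x. h x \<partial>(lborel :: (real^2) measure)) = (\<integral>\<^sup>+z. h (vec2_pair z) \<partial>lborel)"
  by (subst lborel_real2) (use assms in \<open>simp add: nn_integral_distr\<close>)

lemma test_functions_C1:
  fixes f :: "real^2 \<Rightarrow> real"
  assumes "f \<in> test_functions"
  obtains f1 f2 where "continuous_on UNIV f1" "continuous_on UNIV f2"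
    "\<And>x. (f has_derivative (\<lambda>h. h $ 1 * f1 x + h $ 2 * f2 x)) (at x)"
    "\<And>x. (norm (gradient f x))\<^sup>2 = (f1 x)\<^sup>2 + (f2 x)\<^sup>2"
proof -
  have "C_k (Suc 0) f" using assms unfolding test_functions_def by blast
  then have diff: "f differentiable_on UNIV"
    and cont: "\<And>b. b \<in> Basis \<Longrightarrow> continuous_on UNIV (\<lambda>x. frechet_derivative f (at x) b)"
    by auto
  define f1 f2 where "f1 = (\<lambda>x. frechet_derivative f (at x) (vec2 1 0))"
    and "f2 = (\<lambda>x. frechet_derivative f (at x) (vec2 0 1))"
  have der: "(f has_derivative (\<lambda>h. h $ 1 * f1 x + h $ 2 * f2 x)) (at x)" for x
  proof -
    have D: "(f has_derivative frechet_derivative f (at x)) (at x)"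
      using diff by (simp add: differentiable_on_def frechet_derivative_works)
    then interpret linear "frechet_derivative f (at x)" by (rule has_derivative_linear)
    have "frechet_derivative f (at x) h = h $ 1 * f1 x + h $ 2 * f2 x" for h
    proof -
      have "h = h $ 1 *\<^sub>R vec2 1 0 + h $ 2 *\<^sub>R vec2 0 1"
        by (simp add: vec_eq_iff forall_2)
      then have "frechet_derivative f (at x) h
          = frechet_derivative f (at x) (h $ 1 *\<^sub>R vec2 1 0 + h $ 2 *\<^sub>R vec2 0 1)"
        by simp
      also have "\<dots> = h $ 1 * f1 x + h $ 2 * f2 x"
        by (simp add: add scaleR f1_def f2_def)
      finally show ?thesis .
    qed
    then have "frechet_derivative f (at x) = (\<lambda>h. h $ 1 * f1 x + h $ 2 * f2 x)" by auto
    with D show ?thesis by simp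
  qed
  have grad: "gradient f x = vec2 (f1 x) (f2 x)" for x
    unfolding gradient_def
  proof (rule the_equality)
    show "GDERIV f x :> vec2 (f1 x) (f2 x)"
      using der[of x] by (simp add: gderiv_def inner_real2)
    fix D assume "GDERIV f x :> D"
    then have "(\<lambda>h. h \<bullet> D) = (\<lambda>h. h $ 1 * f1 x + h $ 2 * f2 x)"
      using der[of x] has_derivative_unique unfolding gderiv_def by blast
    from fun_cong[OF this, of "vec2 1 0"] fun_cong[OF this, of "vec2 0 1"]
    show "D = vec2 (f1 x) (f2 x)"
      by (simp add: inner_real2 vec_eq_iff forall_2)
  qed
  show ?thesis
  proof (rule that[OF _ _ der])
    show "continuous_on UNIV f1" "continuous_on UNIV f2"
      unfolding f1_def f2_def using cont by (auto simp: Basis_real2)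
  qed (simp add: grad norm_real2)
qed

lemma test_functions_bounded:
  fixes f :: "real^2 \<Rightarrow> real"
  assumes f: "f \<in> test_functions"
  shows "continuous_on UNIV f" "\<exists>B. \<forall>x. \<bar>f x\<bar> \<le> B"
proof -
  have "C_k 0 f" using f unfolding test_functions_def by blast
  then show cont: "continuous_on UNIV f" by simp
  have K: "compact (closure {x. f x \<noteq> 0})" using f unfolding test_functions_def by blast
  have "bounded (f ` closure {x. f x \<noteq> 0})"
    by (intro compact_imp_bounded compact_continuous_image continuous_on_subset[OF cont] K) auto
  then obtain B where B: "\<And>x. x \<in> closure {x. f x \<noteq> 0} \<Longrightarrow> \<bar>f x\<bar> \<le> B"
    by (auto simp: bounded_iff)
  have "\<bar>f x\<bar> \<le> max B 0" for x
    using B[of x] closure_subset[of "{x. f x \<noteq> 0}"] by (cases "f x = 0") auto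
  then show "\<exists>B. \<forall>x. \<bar>f x\<bar> \<le> B" by blast
qed

text \<open>The Poincare constant is defined with the mean of the weighted measure, while the
  triangle inequalities supply some constant \<alpha>. The difference of the two sides is the square
  of c minus the mean.\<close>

lemma (in prob_space) nn_integral_variance_le:
  fixes f :: "'a \<Rightarrow> real"
  assumes [measurable]: "f \<in> borel_measurable M" and B: "\<And>x. \<bar>f x\<bar> \<le> B"
  shows "(\<integral>\<^sup>+x. ennreal ((f x - expectation f)\<^sup>2) \<partial>M) \<le> (\<integral>\<^sup>+x. ennreal ((f x - c)\<^sup>2) \<partial>M)"
proof -
  have int: "integrable M f"
    by (rule integrable_const_bound[where B = B]) (use B in auto)
  have int2: "integrable M (\<lambda>x. (f x)\<^sup>2)"
  proof (rule integrable_const_bound[where B = "B\<^sup>2"])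
    show "AE x in M. norm ((f x)\<^sup>2) \<le> B\<^sup>2"
      using power_mono[OF B abs_ge_zero, where n = 2] by simp
  qed simp
  have eq: "(\<integral>\<^sup>+x. ennreal ((f x - d)\<^sup>2) \<partial>M) = ennreal (expectation (\<lambda>x. (f x)\<^sup>2) - 2 * d * expectation f + d\<^sup>2)"
    for d
  proof -
    have *: "(\<lambda>x. (f x - d)\<^sup>2) = (\<lambda>x. (f x)\<^sup>2 - (2 * d) * f x + d\<^sup>2)"
      by (simp add: power2_diff algebra_simps)
    have "integrable M (\<lambda>x. (f x - d)\<^sup>2)"
      unfolding * using int int2 by auto
    then have "(\<integral>\<^sup>+x. ennreal ((f x - d)\<^sup>2) \<partial>M) = ennreal (expectation (\<lambda>x. (f x - d)\<^sup>2))"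
      by (intro nn_integral_eq_integral) auto
    also have "expectation (\<lambda>x. (f x - d)\<^sup>2) = expectation (\<lambda>x. (f x)\<^sup>2) - 2 * d * expectation f + d\<^sup>2"
      unfolding * using int int2 prob_space by simp
    finally show ?thesis .
  qed
  have "0 \<le> (expectation f - c)\<^sup>2" by simp
  then show ?thesis
    unfolding eq by (intro ennreal_leI) (simp add: power2_eq_square algebra_simps)
qed

text \<open>Fubini over -(1 - t) <= s <= 1 - t and 0 <= t <= 1. Since all primitives are supplied
  from outside, an application reduces to differentiation and polynomial identities.\<close>

lemma triangle_integral_FTC:
  fixes h H :: "real \<Rightarrow> real \<Rightarrow> real"
  assumes cont: "continuous_on UNIV (\<lambda>z. h (fst z) (snd z))" and nonneg: "\<And>s t. 0 \<le> h s t"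
    and inner: "\<And>s t. ((\<lambda>s. H s t) has_real_derivative h s t) (at s)"
    and K: "\<And>t. K t = H (1 - t) t - H (- (1 - t)) t" "continuous_on UNIV K"
    and outer: "\<And>t. (L has_real_derivative K t) (at t)"
  shows "triangle_integral (\<lambda>z. h (fst z) (snd z)) = ennreal (L 1 - L 0)"
proof -
  have [measurable]: "(\<lambda>z. h (fst z) (snd z)) \<in> borel_measurable borel"
    by (intro borel_measurable_continuous_onI cont)
  have hs: "(\<lambda>s. h s t) \<in> borel_measurable borel" for t
    using borel_slice[of h t] by simp
  have "triangle_integral (\<lambda>z. h (fst z) (snd z))
      = (\<integral>\<^sup>+t. (\<integral>\<^sup>+s. ennreal (h s t) * indicator triangle (s, t) \<partial>lborel) \<partial>lborel)"
    unfolding triangle_integral_def by (subst nn_integral_plane_iterated(2)) auto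
  also have "\<dots> = (\<integral>\<^sup>+t. ennreal (K t) * indicator {0..1} t \<partial>lborel)"
  proof (intro nn_integral_cong)
    fix t :: real
    show "(\<integral>\<^sup>+s. ennreal (h s t) * indicator triangle (s, t) \<partial>lborel) = ennreal (K t) * indicator {0..1} t"
    proof (cases "t \<in> {0..1}")
      case True
      have "(\<integral>\<^sup>+s. ennreal (h s t) * indicator triangle (s, t) \<partial>lborel)
          = (\<integral>\<^sup>+s. ennreal (h s t) * indicator {- (1 - t)..1 - t} s \<partial>lborel)"
        using True by (intro nn_integral_cong) (auto simp: triangle_def split: split_indicator)
      also have "\<dots> = ennreal (H (1 - t) t - H (- (1 - t)) t)"
        using True hs inner nonneg
        by (intro nn_integral_FTC_Icc) (auto intro: has_field_derivative_at_within)
      finally show ?thesis using True by (simp add: K(1))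
    next
      case False
      then have "(\<integral>\<^sup>+s. ennreal (h s t) * indicator triangle (s, t) \<partial>lborel) = (\<integral>\<^sup>+s. 0 \<partial>(lborel :: real measure))"
        by (intro nn_integral_cong) (auto simp: triangle_def split: split_indicator)
      then show ?thesis using False by simp
    qed
  qed
  also have "\<dots> = ennreal (L 1 - L 0)"
  proof (rule nn_integral_FTC_Icc)
    show "K \<in> borel_measurable borel" by (intro borel_measurable_continuous_onI K)
    show "0 \<le> K t" if "t \<in> {0..1}" for t
    proof -
      have "H (- (1 - t)) t \<le> H (1 - t) t"
      proof (rule DERIV_nonneg_imp_nondecreasing[where f = "\<lambda>s. H s t"])
        show "\<exists>y. ((\<lambda>s. H s t) has_real_derivative y) (at s) \<and> 0 \<le> y" for s
          using inner nonneg by blast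
      qed (use that in simp)
      then show ?thesis by (simp add: K(1))
    qed
  qed (use outer in \<open>auto intro: has_field_derivative_at_within\<close>)
  finally show ?thesis .
qed

lemma triangle_integral_one: "triangle_integral (\<lambda>z. 1) = 1"
proof -
  have "triangle_integral (\<lambda>z. (\<lambda>s t. 1) (fst z) (snd z)) = ennreal ((2 * 1 - 1\<^sup>2) - (2 * 0 - 0\<^sup>2))"
    by (rule triangle_integral_FTC[where H = "\<lambda>s t. s" and K = "\<lambda>t. 2 - 2 * t" and L = "\<lambda>t. 2 * t - t\<^sup>2"])
       (auto intro!: derivative_eq_intros continuous_intros)
  then show ?thesis by simp
qed

lemma triangle_integral_mono:
  "(\<And>z. z \<in> triangle \<Longrightarrow> f z \<le> g z) \<Longrightarrow> triangle_integral f \<le> triangle_integral g"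
  unfolding triangle_integral_def
  by (intro nn_integral_mono) (auto intro: ennreal_leI split: split_indicator)

text \<open>In the coordinates x1 = s, x2 = a t the exponent is \<eta> (x1^2 + (3 / a^2) x2^2), so
  subtracting \<eta> |x|^2 from it leaves a convex function as long as a^2 <= 3. One weight serves
  all heights, which lets linear stretches carry the measures exactly to each other.\<close>

definition weight :: "real \<Rightarrow> real \<times> real \<Rightarrow> real" where
  "weight \<eta> z = exp (- (\<eta> * ((fst z)\<^sup>2 + 3 * (snd z)\<^sup>2)))"

definition mass :: "real \<Rightarrow> real" where
  "mass \<eta> = enn2real (triangle_integral (weight \<eta>))"

lemma borel_weight [measurable]: "weight \<eta> \<in> borel_measurable borel"
  unfolding weight_def[abs_def] by (intro borel_measurable_continuous_onI continuous_intros)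

lemma weight_bounds:
  assumes "z \<in> triangle" "0 \<le> \<eta>"
  shows "exp (- (3 * \<eta>)) \<le> weight \<eta> z" "weight \<eta> z \<le> 1"
proof -
  obtain s t where z: "z = (s, t)" by (cases z)
  have st: "0 \<le> t" "t \<le> 1" "\<bar>s\<bar> \<le> 1 - t"
    using assms(1) by (auto simp: triangle_def z)
  have "s\<^sup>2 \<le> (1 - t)\<^sup>2" using power_mono[OF st(3), of 2] by simp
  moreover have "(1 - t)\<^sup>2 \<le> 1 - t" "t\<^sup>2 \<le> t"
    using st mult_left_le[of "1 - t" "1 - t"] mult_left_le[of t t] by (auto simp: power2_eq_square)
  \<comment> \<open>The sum is at most (1 - t) + 3 t = 1 + 2 t, with the value 3 reached at the
    apex. This 3 is the one in every factor exp (3 \<eta>).\<close>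
  ultimately have "s\<^sup>2 + 3 * t\<^sup>2 \<le> 3" using st by linarith
  then have "\<eta> * (s\<^sup>2 + 3 * t\<^sup>2) \<le> \<eta> * 3" using assms(2) by (rule mult_left_mono)
  moreover have "0 \<le> \<eta> * (s\<^sup>2 + 3 * t\<^sup>2)" using assms(2) by simp
  ultimately show "exp (- (3 * \<eta>)) \<le> weight \<eta> z" "weight \<eta> z \<le> 1"
    by (auto simp: weight_def z)
qed

lemma mass:
  assumes "0 \<le> \<eta>"
  shows "triangle_integral (weight \<eta>) = ennreal (mass \<eta>)" "0 < mass \<eta>"
proof -
  have "triangle_integral (weight \<eta>) \<le> triangle_integral (\<lambda>z. 1)"
    using weight_bounds[OF _ assms] by (intro triangle_integral_mono)
  also have "\<dots> < \<infinity>" by (simp add: triangle_integral_one)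
  finally show eq: "triangle_integral (weight \<eta>) = ennreal (mass \<eta>)"
    by (simp add: mass_def ennreal_enn2real_if)
  have "ennreal (exp (- (3 * \<eta>))) * triangle_integral (\<lambda>z. 1) = triangle_integral (\<lambda>z. exp (- (3 * \<eta>)) * 1)"
    by (rule triangle_integral_cmult[symmetric]) auto
  also have "\<dots> \<le> triangle_integral (weight \<eta>)"
    using weight_bounds[OF _ assms] by (intro triangle_integral_mono) simp
  finally have "ennreal (exp (- (3 * \<eta>))) \<le> ennreal (mass \<eta>)"
    by (simp add: eq triangle_integral_one)
  then have "exp (- (3 * \<eta>)) \<le> mass \<eta>"
    by (simp add: ennreal_le_iff2)
  then show "0 < mass \<eta>" using exp_gt_zero[of "- (3 * \<eta>)"] by linarith
qed

definition stretch :: "real \<Rightarrow> real \<times> real \<Rightarrow> real^2" where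
  "stretch a z = vec2 (fst z) (a * snd z)"

lemma continuous_stretch: "continuous_on UNIV (stretch a)"
  unfolding stretch_def[abs_def] by (intro continuous_intros)

lemma borel_stretch [measurable]: "stretch a \<in> borel_measurable borel"
  by (intro borel_measurable_continuous_onI continuous_stretch)

definition triangle_density :: "real \<Rightarrow> (real \<times> real) measure" where
  "triangle_density \<eta> = density lborel (\<lambda>z. ennreal (weight \<eta> z / mass \<eta>) * indicator triangle z)"

text \<open>For \<open>\<eta> = 0\<close> this is the uniform distribution on the isosceles triangle with base 2 and height \<open>a\<close>.\<close>

definition triangle_measure :: "real \<Rightarrow> real \<Rightarrow> (real^2) measure" where
  "triangle_measure \<eta> a = distr (triangle_density \<eta>) borel (stretch a)"

lemma sets_triangle_measure [simp]: "sets (triangle_measure \<eta> a) = sets borel"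
  and space_triangle_measure [simp]: "space (triangle_measure \<eta> a) = UNIV"
  by (simp_all add: triangle_measure_def)

lemma nn_integral_triangle_measure:
  assumes [measurable]: "h \<in> borel_measurable borel"
  shows "(\<integral>\<^sup>+x. h x \<partial>triangle_measure \<eta> a)
    = (\<integral>\<^sup>+z. ennreal (weight \<eta> z / mass \<eta>) * indicator triangle z * h (stretch a z) \<partial>lborel)"
proof -
  have "stretch a \<in> measurable (triangle_density \<eta>) borel"
    by (simp add: triangle_density_def)
  then have "(\<integral>\<^sup>+x. h x \<partial>triangle_measure \<eta> a) = (\<integral>\<^sup>+z. h (stretch a z) \<partial>triangle_density \<eta>)"
    unfolding triangle_measure_def by (intro nn_integral_distr) auto
  also have "\<dots> = (\<integral>\<^sup>+z. ennreal (weight \<eta> z / mass \<eta>) * indicator triangle z * h (stretch a z) \<partial>lborel)"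
    unfolding triangle_density_def by (intro nn_integral_density) auto
  finally show ?thesis .
qed

lemma prob_space_triangle_measure:
  assumes "0 \<le> \<eta>"
  shows "prob_space (triangle_measure \<eta> a)"
proof
  have "emeasure (triangle_measure \<eta> a) (space (triangle_measure \<eta> a))
      = (\<integral>\<^sup>+x. 1 \<partial>triangle_measure \<eta> a)"
    by simp
  also have "\<dots> = triangle_integral (\<lambda>z. (1 / mass \<eta>) * weight \<eta> z)"
    by (subst nn_integral_triangle_measure) (simp_all add: triangle_integral_def)
  also have "\<dots> = ennreal (1 / mass \<eta>) * ennreal (mass \<eta>)"
    using mass[OF assms] by (subst triangle_integral_cmult) auto
  also have "\<dots> = 1"
    using mass(2)[OF assms] by (simp flip: ennreal_mult')
  finally show "emeasure (triangle_measure \<eta> a) (space (triangle_measure \<eta> a)) = 1" .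
qed

text \<open>The density lies between exp (-3 \<eta>) / mass and 1 / mass on the triangle. In a
  Poincare quotient one bound is used for the variance and the other for the energy, so that the
  mass cancels and only exp (3 \<eta>) is lost.\<close>

lemma triangle_measure_bounds:
  fixes h :: "real^2 \<Rightarrow> real"
  assumes [measurable]: "h \<in> borel_measurable borel" and nonneg: "\<And>x. 0 \<le> h x" and \<eta>: "0 \<le> \<eta>"
  shows "(\<integral>\<^sup>+x. ennreal (h x) \<partial>triangle_measure \<eta> a)
      \<le> ennreal (1 / mass \<eta>) * triangle_integral (\<lambda>z. h (stretch a z))"
    and "ennreal (exp (- (3 * \<eta>)) / mass \<eta>) * triangle_integral (\<lambda>z. h (stretch a z))
      \<le> (\<integral>\<^sup>+x. ennreal (h x) \<partial>triangle_measure \<eta> a)"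
proof -
  have eq: "(\<integral>\<^sup>+x. ennreal (h x) \<partial>triangle_measure \<eta> a)
      = triangle_integral (\<lambda>z. weight \<eta> z / mass \<eta> * h (stretch a z))"
  proof -
    have "0 \<le> weight \<eta> z / mass \<eta>" for z
      using mass(2)[OF \<eta>] by (simp add: weight_def)
    then show ?thesis
      by (subst nn_integral_triangle_measure)
        (auto simp: triangle_integral_def ennreal_mult' simp del: times_divide_eq_left
          intro!: nn_integral_cong split: split_indicator)
  qed
  have m: "(\<lambda>z. h (stretch a z)) \<in> borel_measurable borel" by measurable
  have "triangle_integral (\<lambda>z. weight \<eta> z / mass \<eta> * h (stretch a z))
      \<le> triangle_integral (\<lambda>z. 1 / mass \<eta> * h (stretch a z))"
    using weight_bounds[OF _ \<eta>] mass[OF \<eta>] nonneg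
    by (intro triangle_integral_mono mult_right_mono divide_right_mono) auto
  also have "\<dots> = ennreal (1 / mass \<eta>) * triangle_integral (\<lambda>z. h (stretch a z))"
    using mass[OF \<eta>] m by (intro triangle_integral_cmult) auto
  finally show "(\<integral>\<^sup>+x. ennreal (h x) \<partial>triangle_measure \<eta> a)
      \<le> ennreal (1 / mass \<eta>) * triangle_integral (\<lambda>z. h (stretch a z))"
    unfolding eq .
  have "ennreal (exp (- (3 * \<eta>)) / mass \<eta>) * triangle_integral (\<lambda>z. h (stretch a z))
      = triangle_integral (\<lambda>z. exp (- (3 * \<eta>)) / mass \<eta> * h (stretch a z))"
    using mass[OF \<eta>] m by (intro triangle_integral_cmult[symmetric]) auto
  also have "\<dots> \<le> triangle_integral (\<lambda>z. weight \<eta> z / mass \<eta> * h (stretch a z))"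
    using weight_bounds[OF _ \<eta>] mass[OF \<eta>] nonneg
    by (intro triangle_integral_mono mult_right_mono divide_right_mono) auto
  finally show "ennreal (exp (- (3 * \<eta>)) / mass \<eta>) * triangle_integral (\<lambda>z. h (stretch a z))
      \<le> (\<integral>\<^sup>+x. ennreal (h x) \<partial>triangle_measure \<eta> a)"
    unfolding eq .
qed

lemma stretch_derivative:
  fixes f :: "real^2 \<Rightarrow> real"
  assumes "\<And>x. (f has_derivative (\<lambda>h. h $ 1 * f1 x + h $ 2 * f2 x)) (at x)"
  shows "((\<lambda>z. f (stretch a z)) has_derivative
    (\<lambda>h. fst h * f1 (stretch a z) + snd h * (a * f2 (stretch a z)))) (at z)"
proof -
  have "(stretch a has_derivative (\<lambda>h. vec2 (fst h) (a * snd h))) (at z)"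
    unfolding stretch_def[abs_def]
    by (intro has_derivative_vec2 has_derivative_fst has_derivative_snd has_derivative_mult_right has_derivative_ident)
  from has_derivative_compose[OF this assms] show ?thesis
    by (simp add: algebra_simps)
qed

text \<open>Perturbing the density by a factor in \<open>[exp (- 3 \<eta>), 1]\<close> costs a factor \<open>exp (3 \<eta>)\<close> in the
  Poincare constant.\<close>

lemma poincare_constant_triangle_le:
  assumes \<eta>: "0 \<le> \<eta>" and a: "a \<noteq> 0" and C: "0 \<le> C"
    and poincare: "\<And>g gs gt. (\<And>z. (g has_derivative (\<lambda>h. fst h * gs z + snd h * gt z)) (at z)) \<Longrightarrow>
      continuous_on UNIV gs \<Longrightarrow> continuous_on UNIV gt \<Longrightarrow>
      \<exists>\<alpha>. triangle_integral (\<lambda>z. (g z - \<alpha>)\<^sup>2)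
        \<le> ennreal C * triangle_integral (\<lambda>z. (gs z)\<^sup>2 + (gt z)\<^sup>2 / a\<^sup>2)"
  shows "poincare_constant (triangle_measure \<eta> a) \<le> ennreal (exp (3 * \<eta>) * C)"
  unfolding poincare_constant_def
proof (rule Inf_lower, rule CollectI, rule ballI)
  let ?\<mu> = "triangle_measure \<eta> a"
  interpret prob_space ?\<mu> by (rule prob_space_triangle_measure[OF \<eta>])
  fix f :: "real^2 \<Rightarrow> real" assume f: "f \<in> test_functions"
  obtain f1 f2 where c1: "continuous_on UNIV f1" and c2: "continuous_on UNIV f2"
    and der: "\<And>x. (f has_derivative (\<lambda>h. h $ 1 * f1 x + h $ 2 * f2 x)) (at x)"
    and grad: "\<And>x. (norm (gradient f x))\<^sup>2 = (f1 x)\<^sup>2 + (f2 x)\<^sup>2"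
    by (rule test_functions_C1[OF f]) (rule that)
  obtain B where B: "\<And>x. \<bar>f x\<bar> \<le> B" using test_functions_bounded[OF f] by blast
  have [measurable]: "f \<in> borel_measurable borel" "f1 \<in> borel_measurable borel" "f2 \<in> borel_measurable borel"
    using borel_measurable_continuous_onI test_functions_bounded(1)[OF f] c1 c2 by auto
  have cs: "continuous_on UNIV (\<lambda>z. f1 (stretch a z))" "continuous_on UNIV (\<lambda>z. a * f2 (stretch a z))"
    using continuous_on_compose2[OF c1 continuous_stretch] continuous_on_compose2[OF c2 continuous_stretch]
    by (auto intro!: continuous_intros)
  obtain \<alpha> where "triangle_integral (\<lambda>z. (f (stretch a z) - \<alpha>)\<^sup>2) \<le> ennreal C *
      triangle_integral (\<lambda>z. (f1 (stretch a z))\<^sup>2 + (a * f2 (stretch a z))\<^sup>2 / a\<^sup>2)"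
    using poincare[OF stretch_derivative[OF der] cs] by blast
  then have \<alpha>: "triangle_integral (\<lambda>z. (f (stretch a z) - \<alpha>)\<^sup>2) \<le> ennreal C *
      triangle_integral (\<lambda>z. (f1 (stretch a z))\<^sup>2 + (f2 (stretch a z))\<^sup>2)"
    using a by (simp add: power_mult_distrib)
  have "(\<integral>\<^sup>+x. ennreal (\<bar>f x - (\<integral>y. f y \<partial>?\<mu>)\<bar>\<^sup>2) \<partial>?\<mu>) \<le> (\<integral>\<^sup>+x. ennreal ((f x - \<alpha>)\<^sup>2) \<partial>?\<mu>)"
  proof -
    have "f \<in> borel_measurable ?\<mu>" unfolding triangle_measure_def by simp
    from nn_integral_variance_le[OF this B] show ?thesis by simp
  qed
  also have "\<dots> \<le> ennreal (1 / mass \<eta>) * triangle_integral (\<lambda>z. (f (stretch a z) - \<alpha>)\<^sup>2)"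
    by (rule triangle_measure_bounds(1)[OF _ _ \<eta>]) auto
  also have "\<dots> \<le> ennreal (1 / mass \<eta>) * (ennreal C *
      triangle_integral (\<lambda>z. (f1 (stretch a z))\<^sup>2 + (f2 (stretch a z))\<^sup>2))"
    by (intro mult_left_mono \<alpha>) simp
  also have "\<dots> = ennreal (exp (3 * \<eta>) * C) * (ennreal (exp (- (3 * \<eta>)) / mass \<eta>) *
      triangle_integral (\<lambda>z. (f1 (stretch a z))\<^sup>2 + (f2 (stretch a z))\<^sup>2))"
  proof -
    have "1 / mass \<eta> * C = (exp (3 * \<eta>) * C) * (exp (- (3 * \<eta>)) / mass \<eta>)"
      by (simp add: exp_minus)
    then have "ennreal (1 / mass \<eta>) * ennreal C = ennreal (exp (3 * \<eta>) * C) * ennreal (exp (- (3 * \<eta>)) / mass \<eta>)"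
      using mass(2)[OF \<eta>] C by (simp only: ennreal_mult[symmetric] divide_nonneg_pos mult_nonneg_nonneg exp_ge_zero zero_le_one)
    then show ?thesis by (simp only: mult.assoc[symmetric])
  qed
  also have "\<dots> \<le> ennreal (exp (3 * \<eta>) * C) * (\<integral>\<^sup>+x. ennreal ((f1 x)\<^sup>2 + (f2 x)\<^sup>2) \<partial>?\<mu>)"
    by (intro mult_left_mono triangle_measure_bounds(2)[OF _ _ \<eta>]) auto
  finally show "(\<integral>\<^sup>+x. ennreal (\<bar>f x - (\<integral>y. f y \<partial>?\<mu>)\<bar>\<^sup>2) \<partial>?\<mu>)
      \<le> ennreal (exp (3 * \<eta>) * C) * (\<integral>\<^sup>+x. ennreal ((norm (gradient f x))\<^sup>2) \<partial>?\<mu>)"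
    unfolding grad .
qed

text \<open>One test function bounds every admissible constant from below. The variance bound is
  assumed for all m because the mean that occurs is taken with respect to the weighted measure and
  is never computed.\<close>

lemma poincare_constant_triangle_ge:
  assumes \<eta>: "0 \<le> \<eta>" and f: "f \<in> test_functions"
    and A: "\<And>m. ennreal A \<le> triangle_integral (\<lambda>z. (f (stretch a z) - m)\<^sup>2)" "0 \<le> A"
    and B: "triangle_integral (\<lambda>z. (norm (gradient f (stretch a z)))\<^sup>2) \<le> ennreal B" "0 < B"
  shows "ennreal (exp (- (3 * \<eta>)) * A / B) \<le> poincare_constant (triangle_measure \<eta> a)"
  unfolding poincare_constant_def
proof (rule Inf_greatest)
  let ?\<mu> = "triangle_measure \<eta> a"
  fix C assume "C \<in> {C. \<forall>f\<in>test_functions. (\<integral>\<^sup>+x. ennreal (\<bar>f x - (\<integral>y. f y \<partial>?\<mu>)\<bar>\<^sup>2) \<partial>?\<mu>)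
      \<le> C * (\<integral>\<^sup>+x. ennreal ((norm (gradient f x))\<^sup>2) \<partial>?\<mu>)}"
  with f have C: "(\<integral>\<^sup>+x. ennreal (\<bar>f x - (\<integral>y. f y \<partial>?\<mu>)\<bar>\<^sup>2) \<partial>?\<mu>)
      \<le> C * (\<integral>\<^sup>+x. ennreal ((norm (gradient f x))\<^sup>2) \<partial>?\<mu>)" by blast
  obtain f1 f2 where c1: "continuous_on UNIV f1" and c2: "continuous_on UNIV f2"
    and der: "\<And>x. (f has_derivative (\<lambda>h. h $ 1 * f1 x + h $ 2 * f2 x)) (at x)"
    and grad: "\<And>x. (norm (gradient f x))\<^sup>2 = (f1 x)\<^sup>2 + (f2 x)\<^sup>2"
    by (rule test_functions_C1[OF f]) (rule that)
  have [measurable]: "f \<in> borel_measurable borel" "f1 \<in> borel_measurable borel" "f2 \<in> borel_measurable borel"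
    using borel_measurable_continuous_onI test_functions_bounded(1)[OF f] c1 c2 by auto
  note Z = mass(2)[OF \<eta>]
  have "ennreal (exp (- (3 * \<eta>)) / mass \<eta>) * ennreal A
      \<le> ennreal (exp (- (3 * \<eta>)) / mass \<eta>) * triangle_integral (\<lambda>z. (f (stretch a z) - (\<integral>y. f y \<partial>?\<mu>))\<^sup>2)"
    by (intro mult_left_mono A) simp
  also have "\<dots> \<le> (\<integral>\<^sup>+x. ennreal ((f x - (\<integral>y. f y \<partial>?\<mu>))\<^sup>2) \<partial>?\<mu>)"
    by (rule triangle_measure_bounds(2)[OF _ _ \<eta>]) auto
  also have "\<dots> \<le> C * (\<integral>\<^sup>+x. ennreal ((norm (gradient f x))\<^sup>2) \<partial>?\<mu>)"
    using C by simp
  also have "\<dots> \<le> C * (ennreal (1 / mass \<eta>) * triangle_integral (\<lambda>z. (norm (gradient f (stretch a z)))\<^sup>2))"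
    unfolding grad by (intro mult_left_mono triangle_measure_bounds(1)[OF _ _ \<eta>]) auto
  also have "\<dots> \<le> C * (ennreal (1 / mass \<eta>) * ennreal B)"
    by (intro mult_left_mono B) auto
  finally have le: "ennreal (exp (- (3 * \<eta>)) / mass \<eta> * A) \<le> C * ennreal (B / mass \<eta>)"
    using Z A(2) B(2) by (simp add: ennreal_mult'[symmetric])
  show "ennreal (exp (- (3 * \<eta>)) * A / B) \<le> C"
  proof (cases C)
    case (real c)
    then have "exp (- (3 * \<eta>)) / mass \<eta> * A \<le> c * (B / mass \<eta>)"
      using le Z B(2) by (simp add: ennreal_mult'[symmetric] ennreal_le_iff)
    then have "exp (- (3 * \<eta>)) * A \<le> c * B"
      using Z by (simp add: field_simps)
    then show ?thesis
      using real B(2) by (simp add: ennreal_le_iff field_simps)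
  qed simp
qed

subsection \<open>Log-concavity and optimal transport\<close>

lemma ereal_convex_restrict:
  fixes q :: "'a::real_vector \<Rightarrow> real"
  assumes K: "convex K" and q: "convex_on K q"
  shows "ereal_convex (\<lambda>x. if x \<in> K then ereal (q x) else \<infinity>)"
  unfolding ereal_convex_def
proof (intro allI impI)
  fix x y :: 'a and t :: real
  assume t: "0 < t \<and> t < 1"
  let ?W = "\<lambda>x. if x \<in> K then ereal (q x) else \<infinity>"
  show "?W ((1 - t) *\<^sub>R x + t *\<^sub>R y) \<le> ereal (1 - t) * ?W x + ereal t * ?W y"
  proof (cases "x \<in> K \<and> y \<in> K")
    case True
    then have "(1 - t) *\<^sub>R x + t *\<^sub>R y \<in> K" "q ((1 - t) *\<^sub>R x + t *\<^sub>R y) \<le> (1 - t) * q x + t * q y"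
      using t K q convex_onD[OF q, of t x y] by (auto simp: convex_def)
    then show ?thesis using True by simp
  next
    case False
    then show ?thesis using t by auto
  qed
qed

lemma lower_semicontinuous_restrict:
  fixes q :: "'a::topological_space \<Rightarrow> real"
  assumes K: "closed K" and q: "continuous_on UNIV q"
  shows "lower_semicontinuous (\<lambda>x. if x \<in> K then ereal (q x) else \<infinity>)"
  unfolding lower_semicontinuous_def
proof
  fix x
  let ?V = "\<lambda>x. if x \<in> K then ereal (q x) else \<infinity>"
  show "?V x \<le> Liminf (at x) ?V"
  proof (cases "x \<in> K")
    case True
    show ?thesis
      unfolding le_Liminf_iff
    proof (intro allI impI)
      fix y assume "y < ?V x"
      then have y: "y < ereal (q x)" using True by simp
      have "(q \<longlongrightarrow> q x) (at x)"
        using q by (simp add: continuous_on_def)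
      then have "((\<lambda>x. ereal (q x)) \<longlongrightarrow> ereal (q x)) (at x)"
        by (rule tendsto_ereal)
      then have "eventually (\<lambda>z. y < ereal (q z)) (at x)"
        using y by (rule order_tendstoD)
      then show "eventually (\<lambda>z. y < ?V z) (at x)"
        by eventually_elim (use y in auto)
    qed
  next
    case False
    have "eventually (\<lambda>z. z \<in> - K) (at x)"
      using K False by (intro eventually_at_topological[THEN iffD2]) (auto intro!: exI[of _ "- K"])
    then have "eventually (\<lambda>z. ?V z = \<infinity>) (at x)"
      by eventually_elim simp
    then have "\<infinity> \<le> Liminf (at x) ?V"
      by (intro Liminf_bounded) (auto elim: eventually_mono)
    then show ?thesis using False by simp
  qed
qed

lemma convex_on_power2_component:
  fixes k1 k2 c :: real
  assumes "0 \<le> k1" "0 \<le> k2" and K: "convex K"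
  shows "convex_on K (\<lambda>x :: real^2. k1 * (x $ 1)\<^sup>2 + k2 * (x $ 2)\<^sup>2 + c)"
proof (rule convex_onI)
  fix t :: real and x y :: "real^2"
  assume t: "0 < t" "t < 1"
  have sq: "((1 - t) * a + t * b)\<^sup>2 \<le> (1 - t) * a\<^sup>2 + t * b\<^sup>2" for a b :: real
  proof -
    have "(1 - t) * a\<^sup>2 + t * b\<^sup>2 - ((1 - t) * a + t * b)\<^sup>2 = (t * (1 - t)) * (a - b)\<^sup>2"
      by (simp add: power2_eq_square algebra_simps)
    moreover have "0 \<le> (t * (1 - t)) * (a - b)\<^sup>2" using t by simp
    ultimately show ?thesis by linarith
  qed
  have "k1 * ((1 - t) * x $ 1 + t * y $ 1)\<^sup>2 \<le> k1 * ((1 - t) * (x $ 1)\<^sup>2 + t * (y $ 1)\<^sup>2)"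
    "k2 * ((1 - t) * x $ 2 + t * y $ 2)\<^sup>2 \<le> k2 * ((1 - t) * (x $ 2)\<^sup>2 + t * (y $ 2)\<^sup>2)"
    using assms sq by (auto intro!: mult_left_mono)
  then show "k1 * (((1 - t) *\<^sub>R x + t *\<^sub>R y) $ 1)\<^sup>2 + k2 * (((1 - t) *\<^sub>R x + t *\<^sub>R y) $ 2)\<^sup>2 + c
      \<le> (1 - t) * (k1 * (x $ 1)\<^sup>2 + k2 * (x $ 2)\<^sup>2 + c) + t * (k1 * (y $ 1)\<^sup>2 + k2 * (y $ 2)\<^sup>2 + c)"
    by (simp add: algebra_simps)
qed (rule K)

lemma convex_triangle: "convex triangle"
proof -
  have eq: "triangle = {z. (0, -1) \<bullet> z \<le> 0} \<inter> {z. (1, 1) \<bullet> z \<le> 1} \<inter> {z. (-1, 1) \<bullet> z \<le> 1}"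
    by (auto simp: triangle_def inner_prod_def)
  show ?thesis unfolding eq by (intro convex_Int convex_halfspace_le)
qed

definition unstretch :: "real \<Rightarrow> real^2 \<Rightarrow> real \<times> real" where
  "unstretch a x = (x $ 1, x $ 2 / a)"

lemma continuous_unstretch: "continuous_on UNIV (unstretch a)"
  unfolding unstretch_def[abs_def] divide_inverse by (intro continuous_intros)

lemma triangle_measure_density:
  assumes a: "0 < a"
  shows "triangle_measure \<eta> a
    = density lborel (\<lambda>x. ennreal (weight \<eta> (unstretch a x) / (mass \<eta> * a)) * indicator triangle (unstretch a x))"
    (is "_ = density lborel ?d")
proof (rule measure_eqI)
  have [measurable]: "unstretch a \<in> borel_measurable borel"
    by (intro borel_measurable_continuous_onI continuous_unstretch)
  fix A assume "A \<in> sets (triangle_measure \<eta> a)"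
  then have [measurable]: "A \<in> sets borel" by simp
  let ?w = "\<lambda>z. ennreal (weight \<eta> z / mass \<eta>) * indicator triangle z * indicator A (stretch a z)"
  have "emeasure (density lborel ?d) A = (\<integral>\<^sup>+x. ?d x * indicator A x \<partial>lborel)"
    by (intro emeasure_density) auto
  also have "\<dots> = (\<integral>\<^sup>+z. ?d (vec2_pair z) * indicator A (vec2_pair z) \<partial>lborel)"
    by (intro nn_integral_real2) auto
  also have "\<dots> = ennreal \<bar>1 * a - 0 * 0\<bar> * (\<integral>\<^sup>+z. ?d (vec2_pair (1 * fst z + 0 * snd z + 0, 0 * fst z + a * snd z + 0))
      * indicator A (vec2_pair (1 * fst z + 0 * snd z + 0, 0 * fst z + a * snd z + 0)) \<partial>lborel)"
    using a by (intro nn_integral_affine_plane[symmetric]) auto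
  also have "\<dots> = ennreal a * (\<integral>\<^sup>+z. ?d (stretch a z) * indicator A (stretch a z) \<partial>lborel)"
    using a by (simp add: vec2_pair_def stretch_def)
  also have "\<dots> = (\<integral>\<^sup>+z. ennreal a * (?d (stretch a z) * indicator A (stretch a z)) \<partial>lborel)"
    by (rule nn_integral_cmult[symmetric]) measurable
  also have "\<dots> = (\<integral>\<^sup>+z. ?w z \<partial>lborel)"
  proof (intro nn_integral_cong)
    fix z
    have u: "unstretch a (stretch a z) = z"
      using a by (simp add: unstretch_def stretch_def)
    have "a * (weight \<eta> z / (mass \<eta> * a)) = weight \<eta> z / mass \<eta>" using a by simp
    then have "ennreal a * ennreal (weight \<eta> z / (mass \<eta> * a)) = ennreal (weight \<eta> z / mass \<eta>)"
      using a by (simp only: ennreal_mult'[symmetric] less_imp_le)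
    then show "ennreal a * (?d (stretch a z) * indicator A (stretch a z)) = ?w z"
      by (simp only: u mult.assoc[symmetric])
  qed
  also have "\<dots> = (\<integral>\<^sup>+x. indicator A x \<partial>triangle_measure \<eta> a)"
    by (subst nn_integral_triangle_measure) auto
  also have "\<dots> = emeasure (triangle_measure \<eta> a) A"
    by simp
  finally show "emeasure (triangle_measure \<eta> a) A = emeasure (density lborel ?d) A" by simp
qed simp

lemma exp_neg_infinity: "exp_neg \<infinity> = 0"
  unfolding exp_neg_def infinity_ereal_def by (simp only: ereal.case)

lemma strongly_log_concave_triangle_measure:
  assumes \<eta>: "0 < \<eta>" and a: "0 < a" "a\<^sup>2 \<le> 3"
  shows "strongly_log_concave (2 * \<eta>) (triangle_measure \<eta> a)"
proof -
  define K where "K = {x :: real^2. unstretch a x \<in> triangle}"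
  define c where "c = ln (mass \<eta> * a)"
  define q where "q = (\<lambda>x :: real^2. \<eta> * (x $ 1)\<^sup>2 + (3 * \<eta> / a\<^sup>2) * (x $ 2)\<^sup>2 + c)"
  define V where "V = (\<lambda>x. if x \<in> K then ereal (q x) else \<infinity>)"
  have Z: "0 < mass \<eta> * a" using mass(2)[of \<eta>] \<eta> a by simp
  have K: "convex K" "closed K"
  proof -
    have "linear (unstretch a)"
      by (rule linearI) (auto simp: unstretch_def add_divide_distrib)
    then show "convex K"
      unfolding K_def using convex_linear_vimage[OF _ convex_triangle] by (simp add: vimage_def)
    show "closed K"
      unfolding K_def using closed_vimage[OF closed_triangle continuous_unstretch] by (simp add: vimage_def)
  qed
  have "0 \<in> K" by (simp add: K_def unstretch_def triangle_def)
  then have "proper_fun V" unfolding proper_fun_def V_def by (auto intro!: exI[of _ 0])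
  moreover have "lower_semicontinuous V"
    unfolding V_def q_def by (intro lower_semicontinuous_restrict K continuous_intros)
  moreover have "ereal_convex (\<lambda>x. V x - ereal (2 * \<eta> * (norm x)\<^sup>2 / 2))"
  proof -
    \<comment> \<open>The first coordinate cancels completely, and the coefficient left for the
      second is nonnegative because a^2 <= 3; it is 0 for the equilateral triangle.\<close>
    have "(\<lambda>x. V x - ereal (2 * \<eta> * (norm x)\<^sup>2 / 2))
        = (\<lambda>x. if x \<in> K then ereal (0 * (x $ 1)\<^sup>2 + (\<eta> * (3 / a\<^sup>2 - 1)) * (x $ 2)\<^sup>2 + c) else \<infinity>)"
      by (auto simp: V_def q_def norm_real2 fun_eq_iff algebra_simps)
    moreover have "0 \<le> \<eta> * (3 / a\<^sup>2 - 1)" using \<eta> a by simp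
    ultimately show ?thesis
      using ereal_convex_restrict[OF K(1) convex_on_power2_component[OF _ _ K(1), of 0 "\<eta> * (3 / a\<^sup>2 - 1)" c]]
      by simp
  qed
  moreover have "triangle_measure \<eta> a = density lborel (\<lambda>x. exp_neg (V x))"
    unfolding triangle_measure_density[OF a(1)]
  proof (intro arg_cong[where f = "density lborel"] ext)
    fix x
    show "ennreal (weight \<eta> (unstretch a x) / (mass \<eta> * a)) * indicator triangle (unstretch a x) = exp_neg (V x)"
    proof (cases "x \<in> K")
      case True
      have "exp (- q x) = weight \<eta> (unstretch a x) / (mass \<eta> * a)"
      proof -
        have "- q x = - (\<eta> * ((x $ 1)\<^sup>2 + 3 * (x $ 2 / a)\<^sup>2)) - ln (mass \<eta> * a)"
          by (simp add: q_def c_def power_divide algebra_simps)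
        then show ?thesis
          using Z by (simp add: exp_diff weight_def unstretch_def)
      qed
      then show ?thesis using True by (simp add: V_def exp_neg_def K_def)
    qed (simp add: V_def exp_neg_infinity K_def)
  qed
  ultimately show ?thesis
    unfolding strongly_log_concave_def using prob_space_triangle_measure[of \<eta> a] \<eta> by auto
qed

text \<open>The identity \<open>(x - y)\<^sup>2 + (c - 1) x\<^sup>2 = (1 - 1 / c) y\<^sup>2 + (c x - y)\<^sup>2 / c\<close> in the second coordinate
  shows that the cost of a transport map exceeds a constant by a square that vanishes only for the
  linear map.\<close>

lemma brenier_map_diagonal:
  fixes \<mu> :: "(real^2) measure"
  assumes sets: "sets \<mu> = sets borel" and c: "1 \<le> c"
    and fin: "(\<integral>\<^sup>+x. ennreal ((x $ 2)\<^sup>2) \<partial>\<mu>) < \<infinity>"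
  defines "T \<equiv> (\<lambda>x :: real^2. vec2 (x $ 1) (c * x $ 2))"
  shows "brenier_map \<mu> (distr \<mu> borel T) T"
proof -
  have c0: "0 < c" using c by simp
  have comp [measurable]: "(\<lambda>x :: real^2. x $ i) \<in> borel_measurable borel" for i
    by (intro borel_measurable_continuous_onI continuous_intros)
  have Tm: "T \<in> measurable \<mu> borel"
    unfolding T_def measurable_cong_sets[OF sets refl]
    by (intro borel_measurable_continuous_onI continuous_intros)
  \<comment> \<open>\<open>K1\<close> depends only on \<mu> and \<open>K2\<close> only on the target
    law, so every transport map S has cost plus K1 equal to K2 plus the integral of
    \<open>dev S\<close>. The constants are added on both sides, never subtracted, because costs are
    \<open>ennreal\<close>; their finiteness permits the cancellations at the end.\<close>
  define K1 where "K1 = (\<integral>\<^sup>+x. ennreal ((c - 1) * (x $ 2)\<^sup>2) \<partial>\<mu>)"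
  define K2 where "K2 = (\<integral>\<^sup>+y. ennreal ((1 - 1 / c) * (y $ 2)\<^sup>2) \<partial>distr \<mu> borel T)"
  define dev where "dev = (\<lambda>S :: real^2 \<Rightarrow> real^2. \<lambda>x. (x $ 1 - S x $ 1)\<^sup>2 + (c * x $ 2 - S x $ 2)\<^sup>2 / c)"
  have m2: "(\<lambda>x. x $ 2) \<in> borel_measurable \<mu>" "(\<lambda>x. x $ 1) \<in> borel_measurable \<mu>"
    unfolding measurable_cong_sets[OF sets refl] by auto
  have scale: "(\<integral>\<^sup>+x. ennreal (k * (x $ 2)\<^sup>2) \<partial>\<mu>) < \<infinity>" if "0 \<le> k" for k
  proof -
    have "(\<integral>\<^sup>+x. ennreal (k * (x $ 2)\<^sup>2) \<partial>\<mu>) = ennreal k * (\<integral>\<^sup>+x. ennreal ((x $ 2)\<^sup>2) \<partial>\<mu>)"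
      using that m2 by (subst nn_integral_cmult[symmetric]) (auto simp: ennreal_mult')
    then show ?thesis using fin by (simp add: ennreal_mult_less_top)
  qed
  have K1: "K1 < \<infinity>" unfolding K1_def using c by (intro scale) simp
  have K2: "K2 < \<infinity>"
  proof -
    have "K2 = (\<integral>\<^sup>+x. ennreal ((1 - 1 / c) * (T x $ 2)\<^sup>2) \<partial>\<mu>)"
      unfolding K2_def by (rule nn_integral_distr[OF Tm]) measurable
    also have "\<dots> = (\<integral>\<^sup>+x. ennreal (((1 - 1 / c) * c\<^sup>2) * (x $ 2)\<^sup>2) \<partial>\<mu>)"
      by (simp add: T_def power_mult_distrib mult.assoc)
    also have "\<dots> < \<infinity>" using c by (intro scale) simp
    finally show ?thesis .
  qed
  have decomp: "transport_cost \<mu> S + K1 = K2 + (\<integral>\<^sup>+x. ennreal (dev S x) \<partial>\<mu>)"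
    and devm: "(\<lambda>x. dev S x) \<in> borel_measurable \<mu>"
    if S: "transport_map \<mu> (distr \<mu> borel T) S" for S
  proof -
    have Sm: "S \<in> measurable \<mu> borel" and Sd: "distr \<mu> borel S = distr \<mu> borel T"
      using S unfolding transport_map_def by auto
    have Sc: "(\<lambda>x. S x $ 1) \<in> borel_measurable \<mu>" "(\<lambda>x. S x $ 2) \<in> borel_measurable \<mu>"
      using measurable_compose[OF Sm comp] by auto
    show dm: "(\<lambda>x. dev S x) \<in> borel_measurable \<mu>"
      unfolding dev_def using Sc m2 by measurable
    have nm: "(\<lambda>x. ennreal ((norm (x - S x))\<^sup>2)) \<in> borel_measurable \<mu>"
      unfolding norm_real2 using Sc m2 by simp
    have "transport_cost \<mu> S + K1 = (\<integral>\<^sup>+x. ennreal ((norm (x - S x))\<^sup>2) + ennreal ((c - 1) * (x $ 2)\<^sup>2) \<partial>\<mu>)"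
      unfolding transport_cost_def K1_def using nm m2 by (intro nn_integral_add[symmetric]) auto
    also have "\<dots> = (\<integral>\<^sup>+x. ennreal ((1 - 1 / c) * (S x $ 2)\<^sup>2) + ennreal (dev S x) \<partial>\<mu>)"
    proof (intro nn_integral_cong)
      fix x
      have "(norm (x - S x))\<^sup>2 = (x $ 1 - S x $ 1)\<^sup>2 + (x $ 2 - S x $ 2)\<^sup>2"
        by (simp add: norm_real2)
      then have "(norm (x - S x))\<^sup>2 + (c - 1) * (x $ 2)\<^sup>2 = (1 - 1 / c) * (S x $ 2)\<^sup>2 + dev S x"
        unfolding dev_def using c0 by (simp only:) (simp add: power2_eq_square field_simps)
      moreover have "0 \<le> (c - 1) * (x $ 2)\<^sup>2" "0 \<le> (1 - 1 / c) * (S x $ 2)\<^sup>2" "0 \<le> dev S x"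
        using c by (auto simp: dev_def)
      ultimately show "ennreal ((norm (x - S x))\<^sup>2) + ennreal ((c - 1) * (x $ 2)\<^sup>2)
          = ennreal ((1 - 1 / c) * (S x $ 2)\<^sup>2) + ennreal (dev S x)"
        by (simp flip: ennreal_plus)
    qed
    also have "\<dots> = (\<integral>\<^sup>+x. ennreal ((1 - 1 / c) * (S x $ 2)\<^sup>2) \<partial>\<mu>) + (\<integral>\<^sup>+x. ennreal (dev S x) \<partial>\<mu>)"
      using Sc dm by (intro nn_integral_add) auto
    also have "(\<integral>\<^sup>+x. ennreal ((1 - 1 / c) * (S x $ 2)\<^sup>2) \<partial>\<mu>) = K2"
      unfolding K2_def Sd[symmetric] by (rule nn_integral_distr[OF Sm, symmetric]) measurable
    finally show "transport_cost \<mu> S + K1 = K2 + (\<integral>\<^sup>+x. ennreal (dev S x) \<partial>\<mu>)" .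
  qed
  have T: "transport_map \<mu> (distr \<mu> borel T) T"
    unfolding transport_map_def using Tm by simp
  have costT: "transport_cost \<mu> T + K1 = K2"
    using decomp[OF T] by (simp add: dev_def T_def)
  show ?thesis
    unfolding brenier_map_def optimal_transport_map_def
  proof (intro conjI allI impI T)
    fix S assume S: "transport_map \<mu> (distr \<mu> borel T) S"
    have "transport_cost \<mu> T + K1 \<le> transport_cost \<mu> S + K1"
      unfolding costT decomp[OF S] by simp
    then show "transport_cost \<mu> T \<le> transport_cost \<mu> S"
      using K1 by (auto simp: ennreal_add_left_cancel_le add.commute)
  next
    fix S
    assume "transport_map \<mu> (distr \<mu> borel T) S \<and> (\<forall>S'. transport_map \<mu> (distr \<mu> borel T) S' \<longrightarrow>
      transport_cost \<mu> S \<le> transport_cost \<mu> S')"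
    then have S: "transport_map \<mu> (distr \<mu> borel T) S" and "transport_cost \<mu> S \<le> transport_cost \<mu> T"
      using T by auto
    then have "transport_cost \<mu> S + K1 \<le> transport_cost \<mu> T + K1" by (intro add_right_mono)
    then have "K2 + (\<integral>\<^sup>+x. ennreal (dev S x) \<partial>\<mu>) \<le> K2 + 0"
      unfolding decomp[OF S] costT by simp
    then have "(\<integral>\<^sup>+x. ennreal (dev S x) \<partial>\<mu>) = 0"
      using K2 by (simp only: ennreal_add_left_cancel_le) auto
    then have "AE x in \<mu>. ennreal (dev S x) = 0"
      using devm[OF S] by (subst (asm) nn_integral_0_iff_AE) auto
    then show "AE x in \<mu>. S x = T x"
    proof eventually_elim
      case (elim x)
      then have "dev S x \<le> 0" by (simp add: ennreal_eq_0_iff)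
      moreover have "0 \<le> dev S x" using c0 by (simp add: dev_def)
      ultimately have "dev S x = 0" by linarith
      then have "(x $ 1 - S x $ 1)\<^sup>2 = 0" "(c * x $ 2 - S x $ 2)\<^sup>2 / c = 0"
        unfolding dev_def using c0 by (auto simp: add_nonneg_eq_0_iff)
      then show ?case using c0 by (simp add: T_def vec_eq_iff forall_2)
    qed
  qed
qed

subsection \<open>Compactly supported smooth functions\<close>

text \<open>With y = 1 / x, the derivative of p(y) exp (- y) in x is y^2 (p - p')(y) exp (- y). So
  this family, flat at 0, is closed under differentiation; p = 1 is the usual ingredient of smooth
  cutoffs.\<close>

definition flat_exp :: "real poly \<Rightarrow> real \<Rightarrow> real" where
  "flat_exp p x = (if x > 0 then poly p (1 / x) * exp (- (1 / x)) else 0)"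

lemma poly_times_exp_tendsto_0: "((\<lambda>y :: real. poly p y * exp (- y)) \<longlongrightarrow> 0) at_top"
proof -
  have "((\<lambda>y. \<Sum>i\<le>degree p. coeff p i * (y ^ i / exp y)) \<longlongrightarrow> (\<Sum>i\<le>degree p. coeff p i * 0)) at_top"
    by (intro tendsto_sum tendsto_mult tendsto_const tendsto_power_div_exp_0)
  moreover have "(\<lambda>y. \<Sum>i\<le>degree p. coeff p i * (y ^ i / exp y)) = (\<lambda>y. poly p y * exp (- y))"
    by (simp add: fun_eq_iff poly_altdef sum_distrib_right exp_minus divide_inverse mult.assoc)
  ultimately show ?thesis by simp
qed

lemma flat_exp_derivative:
  "(flat_exp p has_real_derivative flat_exp ([:0, 0, 1:] * (p - pderiv p)) x) (at x)"
proof -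
  consider "x < 0" | "x = 0" | "x > 0" by linarith
  then show ?thesis
  proof cases
    case 1
    have "((\<lambda>x. 0) has_real_derivative 0) (at x)" by simp
    then have "(flat_exp p has_real_derivative 0) (at x)"
      by (rule has_field_derivative_transform_within_open[where S = "{..<0}"])
        (use 1 in \<open>auto simp: flat_exp_def\<close>)
    then show ?thesis using 1 by (simp add: flat_exp_def)
  next
    case 3
    have "((\<lambda>x. poly p (1 / x) * exp (- (1 / x))) has_real_derivative
        poly p (1 / x) * (exp (- (1 / x)) * (1 / x\<^sup>2)) + poly (pderiv p) (1 / x) * (- 1 / x\<^sup>2) * exp (- (1 / x))) (at x)"
      using 3 by (auto intro!: derivative_eq_intros DERIV_chain2[OF poly_DERIV] simp: power2_eq_square field_simps)
    then have "(flat_exp p has_real_derivative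
        poly p (1 / x) * (exp (- (1 / x)) * (1 / x\<^sup>2)) + poly (pderiv p) (1 / x) * (- 1 / x\<^sup>2) * exp (- (1 / x))) (at x)"
      by (rule has_field_derivative_transform_within_open[where S = "{0<..}"])
        (use 3 in \<open>auto simp: flat_exp_def\<close>)
    then show ?thesis using 3 by (simp add: flat_exp_def power2_eq_square field_simps)
  next
    case 2
    have "((\<lambda>h. (flat_exp p h - flat_exp p 0) / h) \<longlongrightarrow> 0) (at 0)"
    proof (rule filterlim_split_at)
      have "eventually (\<lambda>h :: real. h < 0) (at_left 0)"
        by (auto simp: eventually_at_left_field intro!: exI[of _ "-1"])
      then have "eventually (\<lambda>h. 0 = (flat_exp p h - flat_exp p 0) / h) (at_left 0)"
        by eventually_elim (simp add: flat_exp_def)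
      then show "((\<lambda>h. (flat_exp p h - flat_exp p 0) / h) \<longlongrightarrow> 0) (at_left 0)"
        by (rule Lim_transform_eventually[OF tendsto_const])
      \<comment> \<open>With y = 1 / h the difference quotient at 0 is y p(y) exp (- y), and
        \<open>pCons 0 p\<close> is the polynomial y p(y).\<close>
      have "((\<lambda>h. poly (pCons 0 p) (inverse h) * exp (- inverse h)) \<longlongrightarrow> 0) (at_right 0)"
        by (rule filterlim_compose[OF poly_times_exp_tendsto_0 filterlim_inverse_at_top_right])
      moreover have "eventually (\<lambda>h :: real. 0 < h) (at_right 0)"
        by (rule eventually_at_right_less)
      then have "eventually (\<lambda>h. poly (pCons 0 p) (inverse h) * exp (- inverse h)
          = (flat_exp p h - flat_exp p 0) / h) (at_right 0)"
        by eventually_elim (simp add: flat_exp_def field_simps)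
      ultimately show "((\<lambda>h. (flat_exp p h - flat_exp p 0) / h) \<longlongrightarrow> 0) (at_right 0)"
        by (rule Lim_transform_eventually)
    qed
    then show ?thesis using 2 by (simp add: has_field_derivative_iff flat_exp_def)
  qed
qed

text \<open>The \<open>C_k\<close> conditions for all \<open>k\<close> follow from membership in a set of functions that contains the
  partial derivatives of its members.\<close>

inductive_set smooth_functions :: "('a::euclidean_space \<Rightarrow> real) set" where
  const: "(\<lambda>x. c) \<in> smooth_functions"
| inner: "(\<lambda>x. x \<bullet> v) \<in> smooth_functions"
| flat: "g \<in> smooth_functions \<Longrightarrow> (\<lambda>x. flat_exp p (g x)) \<in> smooth_functions"
| add: "f \<in> smooth_functions \<Longrightarrow> g \<in> smooth_functions \<Longrightarrow> (\<lambda>x. f x + g x) \<in> smooth_functions"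
| mult: "f \<in> smooth_functions \<Longrightarrow> g \<in> smooth_functions \<Longrightarrow> (\<lambda>x. f x * g x) \<in> smooth_functions"
| inverse: "g \<in> smooth_functions \<Longrightarrow> (\<And>x. g x \<noteq> 0) \<Longrightarrow> (\<lambda>x. inverse (g x)) \<in> smooth_functions"

lemma smooth_functions_derivative:
  assumes "f \<in> smooth_functions"
  shows "\<exists>D. (\<forall>x. (f has_derivative D x) (at x)) \<and> (\<forall>b. (\<lambda>x. D x b) \<in> smooth_functions)"
  using assms
proof induction
  case (const c)
  show ?case
    by (rule exI[of _ "\<lambda>x h. 0"]) (auto intro: smooth_functions.const)
next
  case (inner v)
  show ?case
    by (rule exI[of _ "\<lambda>x h. h \<bullet> v"]) (auto intro!: derivative_eq_intros smooth_functions.const)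
next
  case (flat g p)
  then obtain D where D: "\<And>x. (g has_derivative D x) (at x)" "\<And>b. (\<lambda>x. D x b) \<in> smooth_functions" by blast
  let ?q = "[:0, 0, 1:] * (p - pderiv p)"
  have "((\<lambda>x. flat_exp p (g x)) has_derivative (\<lambda>h. flat_exp ?q (g x) * D x h)) (at x)" for x
    using has_derivative_compose[OF D(1) flat_exp_derivative[unfolded has_field_derivative_def]] .
  moreover have "(\<lambda>x. flat_exp ?q (g x) * D x b) \<in> smooth_functions" for b
    by (intro smooth_functions.mult smooth_functions.flat flat.hyps D)
  ultimately show ?case
    by (intro exI[of _ "\<lambda>x h. flat_exp ?q (g x) * D x h"]) blast
next
  case (add f g)
  then obtain D E where D: "\<And>x. (f has_derivative D x) (at x)" "\<And>b. (\<lambda>x. D x b) \<in> smooth_functions"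
    and E: "\<And>x. (g has_derivative E x) (at x)" "\<And>b. (\<lambda>x. E x b) \<in> smooth_functions" by blast
  have "((\<lambda>x. f x + g x) has_derivative (\<lambda>h. D x h + E x h)) (at x)" for x
    by (intro has_derivative_add D E)
  moreover have "(\<lambda>x. D x b + E x b) \<in> smooth_functions" for b
    by (intro smooth_functions.add D E)
  ultimately show ?case
    by (intro exI[of _ "\<lambda>x h. D x h + E x h"]) blast
next
  case (mult f g)
  then obtain D E where D: "\<And>x. (f has_derivative D x) (at x)" "\<And>b. (\<lambda>x. D x b) \<in> smooth_functions"
    and E: "\<And>x. (g has_derivative E x) (at x)" "\<And>b. (\<lambda>x. E x b) \<in> smooth_functions" by blast
  have "((\<lambda>x. f x * g x) has_derivative (\<lambda>h. f x * E x h + D x h * g x)) (at x)" for x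
    by (intro has_derivative_mult D E)
  moreover have "(\<lambda>x. f x * E x b + D x b * g x) \<in> smooth_functions" for b
    by (intro smooth_functions.add smooth_functions.mult mult.hyps D E)
  ultimately show ?case
    by (intro exI[of _ "\<lambda>x h. f x * E x h + D x h * g x"]) blast
next
  case (inverse g)
  then obtain D where D: "\<And>x. (g has_derivative D x) (at x)" "\<And>b. (\<lambda>x. D x b) \<in> smooth_functions" by blast
  have "((\<lambda>x. inverse (g x)) has_derivative (\<lambda>h. - (inverse (g x) * D x h * inverse (g x)))) (at x)" for x
    using has_derivative_compose[OF D(1) has_derivative_inverse'[OF inverse.hyps(2)]] by simp
  moreover have "(\<lambda>x. - (inverse (g x) * D x b * inverse (g x))) \<in> smooth_functions" for b
  proof -
    have "(\<lambda>x. (-1) * (inverse (g x) * D x b * inverse (g x))) \<in> smooth_functions"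
      by (intro smooth_functions.const smooth_functions.mult smooth_functions.inverse inverse.hyps D)
    then show ?thesis by simp
  qed
  ultimately show ?case
    by (intro exI[of _ "\<lambda>x h. - (inverse (g x) * D x h * inverse (g x))"]) blast
qed

lemma smooth_functions_C_k: "f \<in> smooth_functions \<Longrightarrow> C_k k f"
proof (induction k arbitrary: f)
  case 0
  then show ?case
    using smooth_functions_derivative[OF 0]
    by (auto intro!: continuous_at_imp_continuous_on intro: has_derivative_continuous)
next
  case (Suc k)
  obtain D where D: "\<And>x. (f has_derivative D x) (at x)" "\<And>b. (\<lambda>x. D x b) \<in> smooth_functions"
    using smooth_functions_derivative[OF Suc.prems] by blast
  have "frechet_derivative f (at x) = D x" for x
    using frechet_derivative_at[OF D(1)] by simp
  then show ?case
    using D Suc.IH by (auto simp: differentiable_on_def differentiable_def)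
qed

lemma smooth_functions_norm2: "(\<lambda>x :: 'a::euclidean_space. (norm x)\<^sup>2) \<in> smooth_functions"
proof -
  have "(\<lambda>x :: 'a. \<Sum>b\<in>B. (x \<bullet> b) * (x \<bullet> b)) \<in> smooth_functions" if "finite B" for B :: "'a set"
    using that
  proof induction
    case (insert b B)
    then show ?case
      by (simp add: smooth_functions.add smooth_functions.mult smooth_functions.inner)
  qed (simp add: smooth_functions.const)
  from this[OF finite_Basis] show ?thesis
    by (simp add: euclidean_inner[symmetric] power2_norm_eq_inner)
qed

text \<open>The quotient u / (u + v), where u is positive exactly for |x|^2 < 5 and v exactly for
  |x|^2 > 4. These two regions cover the space, so the denominator never vanishes; the quotient is 1
  where v = 0 and 0 where u = 0.\<close>

lemma cutoff_exists:
  "\<exists>w \<in> smooth_functions. (\<forall>x :: 'a::euclidean_space. (norm x)\<^sup>2 < 4 \<longrightarrow> w x = 1) \<and>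
    (\<forall>x. (norm x)\<^sup>2 \<ge> 5 \<longrightarrow> w x = (0 :: real))"
proof -
  let ?u = "\<lambda>x :: 'a. flat_exp 1 (5 + (-1) * (norm x)\<^sup>2)"
  let ?v = "\<lambda>x :: 'a. flat_exp 1 ((norm x)\<^sup>2 + (-4))"
  have u: "?u \<in> smooth_functions" and v: "?v \<in> smooth_functions"
    by (intro smooth_functions.flat smooth_functions.add smooth_functions.mult smooth_functions.const
        smooth_functions_norm2)+
  have nonneg: "0 \<le> flat_exp 1 y" and positive: "0 < y \<Longrightarrow> 0 < flat_exp 1 y" for y
    by (simp_all add: flat_exp_def)
  have pos: "?u x + ?v x \<noteq> 0" for x
  proof (cases "(norm x)\<^sup>2 < 5")
    case True
    then have "0 < ?u x" by (intro positive) simp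
    then show ?thesis using nonneg[of "(norm x)\<^sup>2 + (-4)"] by linarith
  next
    case False
    then have "0 < ?v x" by (intro positive) simp
    then show ?thesis using nonneg[of "5 + (-1) * (norm x)\<^sup>2"] by linarith
  qed
  have "(\<lambda>x. ?u x * inverse (?u x + ?v x)) \<in> smooth_functions"
    by (intro smooth_functions.mult smooth_functions.inverse smooth_functions.add u v pos)
  then show ?thesis
  proof (rule bexI[rotated], intro conjI allI impI)
    show "?u x * inverse (?u x + ?v x) = 1" if "(norm x)\<^sup>2 < 4" for x
      using that by (simp add: flat_exp_def)
    show "?u x * inverse (?u x + ?v x) = 0" if "(norm x)\<^sup>2 \<ge> 5" for x
      using that by (simp add: flat_exp_def)
  qed
qed

text \<open>A polynomial has no compact support, but the cutoff changes it only outside an open disc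
  of radius 2. Values and gradients at the points of that disc are those of the polynomial.\<close>

lemma test_function_extension:
  fixes g :: "real^2 \<Rightarrow> real"
  assumes g: "g \<in> smooth_functions"
    and der: "\<And>x. (g has_derivative (\<lambda>h. h $ 1 * g1 x + h $ 2 * g2 x)) (at x)"
  obtains f where "f \<in> test_functions" "\<And>x. (norm x)\<^sup>2 < 4 \<Longrightarrow> f x = g x"
    "\<And>x. (norm x)\<^sup>2 < 4 \<Longrightarrow> (norm (gradient f x))\<^sup>2 = (g1 x)\<^sup>2 + (g2 x)\<^sup>2"
proof -
  obtain w :: "real^2 \<Rightarrow> real" where w: "w \<in> smooth_functions"
    and one: "\<And>x. (norm x)\<^sup>2 < 4 \<Longrightarrow> w x = 1" and zero: "\<And>x. (norm x)\<^sup>2 \<ge> 5 \<Longrightarrow> w x = 0"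
    using cutoff_exists by blast
  define f where "f = (\<lambda>x. w x * g x)"
  have "f \<in> smooth_functions" unfolding f_def by (intro smooth_functions.mult w g)
  moreover have "compact (closure {x. f x \<noteq> 0})"
  proof -
    have "norm x \<le> 3" if "f x \<noteq> 0" for x
    proof (rule ccontr)
      assume "\<not> norm x \<le> 3"
      then have "3\<^sup>2 \<le> (norm x)\<^sup>2" by (intro power_mono) auto
      then show False using that zero[of x] by (simp add: f_def)
    qed
    then have "bounded {x. f x \<noteq> 0}" by (auto simp: bounded_iff)
    then show ?thesis by (simp add: compact_closure)
  qed
  ultimately have f: "f \<in> test_functions"
    unfolding test_functions_def using smooth_functions_C_k by blast
  have eq: "f x = g x" if "(norm x)\<^sup>2 < 4" for x
    using one[OF that] by (simp add: f_def)
  have grad: "(norm (gradient f x))\<^sup>2 = (g1 x)\<^sup>2 + (g2 x)\<^sup>2" if x: "(norm x)\<^sup>2 < 4" for x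
  proof -
    have "open {x :: real^2. (norm x)\<^sup>2 < 4}"
      by (intro open_Collect_less continuous_intros)
    then have "(f has_derivative (\<lambda>h. h $ 1 * g1 x + h $ 2 * g2 x)) (at x)"
      using has_derivative_transform_within_open[OF der] x eq by (metis (mono_tags, lifting) mem_Collect_eq)
    then have fd: "GDERIV f x :> vec2 (g1 x) (g2 x)"
      by (simp add: gderiv_def inner_real2)
    have "gradient f x = vec2 (g1 x) (g2 x)"
      unfolding gradient_def
    proof (rule the_equality)
      show "GDERIV f x :> vec2 (g1 x) (g2 x)" by (rule fd)
      fix D assume "GDERIV f x :> D"
      then have "(\<lambda>h. h \<bullet> D) = (\<lambda>h. h \<bullet> vec2 (g1 x) (g2 x))"
        using fd has_derivative_unique unfolding gderiv_def by blast
      then show "D = vec2 (g1 x) (g2 x)"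
        by (metis inner_commute vector_eq_rdot)
    qed
    then show ?thesis by (simp add: norm_real2)
  qed
  show ?thesis by (rule that[OF f eq grad])
qed

subsection \<open>The trial function on the midpoint triangle\<close>

text \<open>The trial function \<open>s (8 - 16 t\<^sup>2 + 7 t\<^sup>3) - 3 s\<^sup>3\<close> is, up to rounding of the coefficients, the
  Rayleigh-Ritz optimum in the span of \<open>s\<close>, \<open>s\<^sup>3\<close>, \<open>s t\<^sup>2\<close> and \<open>s t\<^sup>3\<close>.\<close>

lemma trial_variance:
  "triangle_integral (\<lambda>z. (fst z * (8 - 16 * (snd z)\<^sup>2 + 7 * (snd z) ^ 3) - 3 * (fst z) ^ 3 - m)\<^sup>2)
    = ennreal (5693 / 945 + m\<^sup>2)"
proof -
  let ?\<alpha> = "\<lambda>t :: real. 8 - 16 * t\<^sup>2 + 7 * t ^ 3"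
  \<comment> \<open>\<open>?H\<close> is a primitive in s of the expanded square. The terms linear
    in m are odd in s, so their primitives are even and drop out of \<open>?K\<close>: the trial
    function has mean zero. \<open>?L\<close> is a primitive of \<open>?K\<close>.\<close>
  let ?H = "\<lambda>s t. (?\<alpha> t)\<^sup>2 * s ^ 3 / 3 - 6 * ?\<alpha> t * s ^ 5 / 5 + 9 * s ^ 7 / 7
    - m * ?\<alpha> t * s\<^sup>2 + 3 * m * s ^ 4 / 2 + m\<^sup>2 * s"
  let ?K = "\<lambda>t. 2734/105 + (-50) * t + (-2134/15) * t ^ 2 + (2186/5) * t ^ 3 + (-310/3) * t ^ 4 + (-12802/15) * t ^ 5 + (1296) * t ^ 6 + (-88372/105) * t ^ 7 + (3962/15) * t ^ 8 + (-98/3) * t ^ 9 + 2 * m\<^sup>2 * (1 - t)"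
  let ?L = "\<lambda>t. (2734/105) * t + (-25) * t ^ 2 + (-2134/45) * t ^ 3 + (1093/10) * t ^ 4 + (-62/3) * t ^ 5 + (-6401/45) * t ^ 6 + (1296/7) * t ^ 7 + (-22093/210) * t ^ 8 + (3962/135) * t ^ 9 + (-49/15) * t ^ 10 + m\<^sup>2 * (2 * t - t\<^sup>2)"
  have "triangle_integral (\<lambda>z. (\<lambda>s t. (s * ?\<alpha> t - 3 * s ^ 3 - m)\<^sup>2) (fst z) (snd z)) = ennreal (?L 1 - ?L 0)"
  proof (rule triangle_integral_FTC[where H = ?H and K = ?K])
    show "((\<lambda>s. ?H s t) has_real_derivative (s * ?\<alpha> t - 3 * s ^ 3 - m)\<^sup>2) (at s)" for s t
      by (rule derivative_eq_intros refl | simp)+ (simp add: power2_eq_square power_numeral_reduce algebra_simps add_divide_distrib diff_divide_distrib)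
    show "?K t = ?H (1 - t) t - ?H (- (1 - t)) t" for t
      by (simp add: power2_eq_square power_numeral_reduce algebra_simps add_divide_distrib diff_divide_distrib)
    show "(?L has_real_derivative ?K t) (at t)" for t
      by (rule DERIV_cong, (rule derivative_intros)+) (simp add: power2_eq_square power_numeral_reduce algebra_simps)
  qed (auto intro!: continuous_intros)
  then show ?thesis by simp
qed

text \<open>The weight \<beta> = 1 / a^2 of the squared t-derivative accounts for the stretching of
  the height to a, so one computation serves every height.\<close>

lemma trial_energy:
  assumes "0 \<le> \<beta>"
  shows "triangle_integral (\<lambda>z. (8 - 16 * (snd z)\<^sup>2 + 7 * (snd z) ^ 3 - 9 * (fst z)\<^sup>2)\<^sup>2
      + \<beta> * (fst z * (21 * (snd z)\<^sup>2 - 32 * snd z))\<^sup>2)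
    = ennreal (1481 / 60 + \<beta> * (217 / 36))"
proof -
  let ?\<alpha> = "\<lambda>t :: real. 8 - 16 * t\<^sup>2 + 7 * t ^ 3"
  let ?\<delta> = "\<lambda>t :: real. 21 * t\<^sup>2 - 32 * t"
  let ?H = "\<lambda>s t. (?\<alpha> t)\<^sup>2 * s - 6 * ?\<alpha> t * s ^ 3 + 81 * s ^ 5 / 5 + \<beta> * (?\<delta> t)\<^sup>2 * s ^ 3 / 3"
  let ?K = "\<lambda>t. 322/5 + (-2) * t + (-284) * t ^ 2 + (-152) * t ^ 3 + (1278) * t ^ 4 + (-7182/5) * t ^ 5 + (630) * t ^ 6 + (-98) * t ^ 7 + \<beta> * ((2048/3) * t ^ 2 + (-2944) * t ^ 3 + (5030) * t ^ 4 + (-12758/3) * t ^ 5 + (1778) * t ^ 6 + (-294) * t ^ 7)"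
  let ?L = "\<lambda>t. (322/5) * t + (-1) * t ^ 2 + (-284/3) * t ^ 3 + (-38) * t ^ 4 + (1278/5) * t ^ 5 + (-1197/5) * t ^ 6 + (90) * t ^ 7 + (-49/4) * t ^ 8 + \<beta> * ((2048/9) * t ^ 3 + (-736) * t ^ 4 + (1006) * t ^ 5 + (-6379/9) * t ^ 6 + (254) * t ^ 7 + (-147/4) * t ^ 8)"
  have "triangle_integral (\<lambda>z. (\<lambda>s t. (?\<alpha> t - 9 * s\<^sup>2)\<^sup>2 + \<beta> * (s * ?\<delta> t)\<^sup>2) (fst z) (snd z)) = ennreal (?L 1 - ?L 0)"
  proof (rule triangle_integral_FTC[where H = ?H and K = ?K])
    show "0 \<le> (?\<alpha> t - 9 * s\<^sup>2)\<^sup>2 + \<beta> * (s * ?\<delta> t)\<^sup>2" for s t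
      using assms by simp
    show "((\<lambda>s. ?H s t) has_real_derivative (?\<alpha> t - 9 * s\<^sup>2)\<^sup>2 + \<beta> * (s * ?\<delta> t)\<^sup>2) (at s)" for s t
      by (rule derivative_eq_intros refl | simp)+ (simp add: power2_eq_square power_numeral_reduce algebra_simps add_divide_distrib diff_divide_distrib)
    show "?K t = ?H (1 - t) t - ?H (- (1 - t)) t" for t
      by (simp add: power2_eq_square power_numeral_reduce algebra_simps add_divide_distrib diff_divide_distrib)
    show "(?L has_real_derivative ?K t) (at t)" for t
      by (rule DERIV_cong, (rule derivative_intros)+) (simp add: power2_eq_square power_numeral_reduce algebra_simps)
  qed (auto intro!: continuous_intros)
  then show ?thesis by simp
qed

lemma stretch_norm_less:
  assumes "z \<in> triangle" "0 \<le> a" "a\<^sup>2 < 3"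
  shows "(norm (stretch a z))\<^sup>2 < 4"
proof -
  obtain s t where z: "z = (s, t)" by (cases z)
  have st: "0 \<le> t" "t \<le> 1" "\<bar>s\<bar> \<le> 1"
    using assms(1) by (auto simp: triangle_def z)
  have "s\<^sup>2 \<le> 1" "t\<^sup>2 \<le> 1" using st by (auto simp: abs_square_le_1 power_le_one)
  moreover have "(a * t)\<^sup>2 \<le> a\<^sup>2" using \<open>t\<^sup>2 \<le> 1\<close> mult_left_mono[of "t\<^sup>2" 1 "a\<^sup>2"] by (simp add: power_mult_distrib)
  ultimately show ?thesis using assms(3) by (simp add: norm_real2 stretch_def z)
qed

text \<open>The trial polynomial is transplanted by t = x2 / a; the fraction is its Rayleigh
  quotient, and m^2 >= 0 is dropped from the variance. The bound a^2 < 3 keeps the triangle inside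
  the disc on which the cutoff is 1.\<close>

lemma poincare_constant_midpoint_ge:
  assumes \<eta>: "0 \<le> \<eta>" and a: "0 < a" "a\<^sup>2 < 3"
  shows "ennreal (exp (- (3 * \<eta>)) * (5693 / 945) / (1481 / 60 + 1 / a\<^sup>2 * (217 / 36)))
    \<le> poincare_constant (triangle_measure \<eta> a)"
proof -
  define g where "g = (\<lambda>x :: real^2. x $ 1 * (8 - 16 * (x $ 2 / a)\<^sup>2 + 7 * (x $ 2 / a) ^ 3) - 3 * (x $ 1) ^ 3)"
  define g1 where "g1 = (\<lambda>x :: real^2. 8 - 16 * (x $ 2 / a)\<^sup>2 + 7 * (x $ 2 / a) ^ 3 - 9 * (x $ 1)\<^sup>2)"
  define g2 where "g2 = (\<lambda>x :: real^2. x $ 1 * (21 * (x $ 2 / a)\<^sup>2 - 32 * (x $ 2 / a)) / a)"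
  have coord: "(\<lambda>x :: real^2. x $ 1) \<in> smooth_functions" "(\<lambda>x :: real^2. x $ 2) \<in> smooth_functions"
    using smooth_functions.inner[of "vec2 1 0"] smooth_functions.inner[of "vec2 0 1"]
    by (simp_all add: inner_real2)
  have "g = (\<lambda>x. x $ 1 * (8 + ((-16 / a\<^sup>2) * (x $ 2 * x $ 2) + (7 / a ^ 3) * (x $ 2 * (x $ 2 * x $ 2))))
      + (-3) * (x $ 1 * (x $ 1 * x $ 1)))"
    by (simp add: g_def fun_eq_iff power2_eq_square power3_eq_cube field_simps)
  then have smooth: "g \<in> smooth_functions"
    by (simp only:) (intro smooth_functions.add smooth_functions.mult smooth_functions.const coord)
  have der: "(g has_derivative (\<lambda>h. h $ 1 * g1 x + h $ 2 * g2 x)) (at x)" for x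
  proof -
    have c: "((\<lambda>x :: real^2. x $ i) has_derivative (\<lambda>h. h $ i)) (at x)" for i
      by (intro bounded_linear_imp_has_derivative bounded_linear_vec_nth)
    show ?thesis
      unfolding g_def g1_def g2_def using a
      by (auto intro!: derivative_eq_intros c simp: fun_eq_iff power2_eq_square power3_eq_cube field_simps)
  qed
  obtain f where f: "f \<in> test_functions" and fg: "\<And>x. (norm x)\<^sup>2 < 4 \<Longrightarrow> f x = g x"
    and grad: "\<And>x. (norm x)\<^sup>2 < 4 \<Longrightarrow> (norm (gradient f x))\<^sup>2 = (g1 x)\<^sup>2 + (g2 x)\<^sup>2"
    using test_function_extension[OF smooth der] by blast
  have near: "(norm (stretch a z))\<^sup>2 < 4" if "z \<in> triangle" for z
    using stretch_norm_less[OF that _ a(2)] a by simp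
  have cong: "triangle_integral h = triangle_integral k" if "\<And>z. z \<in> triangle \<Longrightarrow> h z = k z" for h k
    using that unfolding triangle_integral_def by (intro nn_integral_cong) (auto split: split_indicator)
  have vals: "g (stretch a z) = fst z * (8 - 16 * (snd z)\<^sup>2 + 7 * (snd z) ^ 3) - 3 * (fst z) ^ 3"
    "g1 (stretch a z) = 8 - 16 * (snd z)\<^sup>2 + 7 * (snd z) ^ 3 - 9 * (fst z)\<^sup>2"
    "g2 (stretch a z) = fst z * (21 * (snd z)\<^sup>2 - 32 * snd z) / a" for z
    using a by (simp_all add: g_def g1_def g2_def stretch_def)
  have var: "triangle_integral (\<lambda>z. (f (stretch a z) - m)\<^sup>2) = ennreal (5693 / 945 + m\<^sup>2)" for m
    by (subst trial_variance[symmetric], intro cong) (simp add: fg[OF near] vals)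
  have "triangle_integral (\<lambda>z. (norm (gradient f (stretch a z)))\<^sup>2) = ennreal (1481 / 60 + 1 / a\<^sup>2 * (217 / 36))"
    by (subst trial_energy[symmetric], simp, intro cong) (simp add: grad[OF near] vals power_divide)
  moreover have "0 < 1481 / 60 + 1 / a\<^sup>2 * (217 / 36)" using a by (simp add: add_pos_pos)
  ultimately show ?thesis
    using var by (intro poincare_constant_triangle_ge[OF \<eta> f]) (auto intro: ennreal_leI)
qed

section \<open>The Wasserstein midpoint and the numerical comparison\<close>

lemma ennreal_sqrt_mono: "c \<le> d \<Longrightarrow> ennreal_sqrt c \<le> ennreal_sqrt d"
proof (cases d)
  case (real r)
  assume "c \<le> d"
  then show ?thesis
    using real by (cases c) (auto simp: ennreal_sqrt_def top_unique intro!: ennreal_leI)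
qed (simp add: ennreal_sqrt_def)

lemma ennreal_sqrt_ennreal: "0 \<le> r \<Longrightarrow> ennreal_sqrt (ennreal r) = ennreal (sqrt r)"
  by (simp add: ennreal_sqrt_def)

text \<open>The average of the identity and the stretch by c is the stretch by (1 + c) / 2, so the
  midpoint stays in the same family of measures.\<close>

lemma wasserstein_midpoint_triangles:
  assumes \<eta>: "0 \<le> \<eta>" and c: "1 \<le> c"
  shows "wasserstein_midpoint (triangle_measure \<eta> 1) (triangle_measure \<eta> c) (triangle_measure \<eta> ((1 + c) / 2))"
proof -
  let ?T = "\<lambda>x :: real^2. vec2 (x $ 1) (c * x $ 2)"
  have distr: "distr (triangle_measure \<eta> 1) borel h = triangle_measure \<eta> a"
    if "h \<in> borel_measurable borel" "\<And>z. h (stretch 1 z) = stretch a z" for h a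
    unfolding triangle_measure_def
    by (subst distr_distr) (use that in \<open>auto simp: comp_def triangle_density_def\<close>)
  have Tm: "?T \<in> borel_measurable borel"
    by (intro borel_measurable_continuous_onI continuous_intros)
  have fin: "(\<integral>\<^sup>+x. ennreal ((x $ 2)\<^sup>2) \<partial>triangle_measure \<eta> 1) < \<infinity>"
  proof -
    have "(\<integral>\<^sup>+x. ennreal ((x $ 2)\<^sup>2) \<partial>triangle_measure \<eta> 1)
        \<le> ennreal (1 / mass \<eta>) * triangle_integral (\<lambda>z. (stretch 1 z $ 2)\<^sup>2)"
      by (rule triangle_measure_bounds(1)[OF _ _ \<eta>])
        (auto intro!: borel_measurable_continuous_onI continuous_intros)
    also have "triangle_integral (\<lambda>z. (stretch 1 z $ 2)\<^sup>2) \<le> triangle_integral (\<lambda>z. 1)"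
      by (intro triangle_integral_mono) (auto simp: stretch_def triangle_def abs_square_le_1)
    finally show ?thesis
      by (simp add: triangle_integral_one mult_left_mono order_le_less_trans[OF _ ennreal_less_top])
  qed
  have "brenier_map (triangle_measure \<eta> 1) (triangle_measure \<eta> c) ?T"
    using brenier_map_diagonal[OF _ c fin] distr[OF Tm, of c] by (simp add: stretch_def)
  moreover have "triangle_measure \<eta> ((1 + c) / 2)
      = distr (triangle_measure \<eta> 1) borel (\<lambda>x. (1 / 2) *\<^sub>R x + (1 / 2) *\<^sub>R ?T x)"
    by (rule distr[symmetric])
      (auto intro!: borel_measurable_continuous_onI continuous_intros
        simp: stretch_def vec_eq_iff forall_2 field_simps)
  ultimately show ?thesis unfolding wasserstein_midpoint_def by blast
qed

theorem propositionA1: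
  shows "\<exists>(\<kappa>::real) (\<mu>0::(real^2) measure) (\<mu>1::(real^2) measure) (\<mu>half::(real^2) measure).
    0 < \<kappa> \<and> strongly_log_concave \<kappa> \<mu>0 \<and> strongly_log_concave \<kappa> \<mu>1 \<and>
    wasserstein_midpoint \<mu>0 \<mu>1 \<mu>half \<and>
    ennreal_sqrt (poincare_constant \<mu>half) >
      ennreal (1/2) * ennreal_sqrt (poincare_constant \<mu>0)
      + ennreal (1/2) * ennreal_sqrt (poincare_constant \<mu>1)"
proof -
  \<comment> \<open>Small enough that the loss exp (3 \<eta>) at the endpoints and exp (- 3 \<eta>)
    at the midpoint stays well below the margin.\<close>
  define \<eta> :: real where "\<eta> = 1 / 10000"
  define m :: real where "m = (1 + sqrt 3) / 2"
  have \<eta>: "0 < \<eta>" "0 \<le> \<eta>" by (simp_all add: \<eta>_def)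
  have sqrt3: "1.732 < sqrt 3" "sqrt 3 < 1.7321"
    by (rule real_less_rsqrt real_less_lsqrt; simp add: power2_eq_square)+
  have sqrt2: "sqrt 2 < 1.41422"
    by (rule real_less_lsqrt) (simp_all add: power2_eq_square)
  have m: "0 < m" "m\<^sup>2 < 3" "1 / m\<^sup>2 = 4 - 2 * sqrt 3"
  proof -
    have m2: "m\<^sup>2 = (2 + sqrt 3) / 2"
      by (simp add: m_def power_divide power2_sum)
    show "0 < m" "m\<^sup>2 < 3" using sqrt3 unfolding m2 by (simp_all add: m_def)
    \<comment> \<open>Rationalising 1 / m^2 makes the energy of the trial function linear in sqrt 3,
      so decimal bounds for sqrt 3 suffice.\<close>
    have "(2 + sqrt 3) * (4 - 2 * sqrt 3) = 2" by (simp add: algebra_simps)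
    then show "1 / m\<^sup>2 = 4 - 2 * sqrt 3"
      unfolding m2 using sqrt3 by (simp add: field_simps)
  qed
  define e where "e = exp (3 * \<eta>)"
  have e: "1 \<le> e" "e \<le> 1.0004"
  proof -
    show "1 \<le> e" by (simp add: e_def \<eta>_def)
    have "exp (3 * \<eta>) \<le> 1 + 3 * \<eta> + (3 * \<eta>)\<^sup>2"
      by (rule exp_bound) (simp_all add: \<eta>_def)
    then show "e \<le> 1.0004" by (simp add: e_def \<eta>_def power2_eq_square)
  qed
  \<comment> \<open>Replacing pi by 3.141 enlarges both square roots by a factor below
    1.0002.\<close>
  have w: "0 < (3.141 :: real)" "3.141 < pi" using pi_approx by simp_all
  let ?A = "e * (2 / 3.141\<^sup>2)" and ?B = "e * (9 / (4 * 3.141\<^sup>2))"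
    and ?C = "exp (- (3 * \<eta>)) * (5693 / 945) / (1481 / 60 + 1 / m\<^sup>2 * (217 / 36))"
  have P0: "poincare_constant (triangle_measure \<eta> 1) \<le> ennreal ?A"
    unfolding e_def
  proof (rule poincare_constant_triangle_le[OF \<eta>(2)])
    fix g gs gt :: "real \<times> real \<Rightarrow> real"
    assume "\<And>z. (g has_derivative (\<lambda>h. fst h * gs z + snd h * gt z)) (at z)"
      "continuous_on UNIV gs" "continuous_on UNIV gt"
    from poincare_right_triangle[OF this w]
    show "\<exists>\<alpha>. triangle_integral (\<lambda>z. (g z - \<alpha>)\<^sup>2)
        \<le> ennreal (2 / 3.141\<^sup>2) * triangle_integral (\<lambda>z. (gs z)\<^sup>2 + (gt z)\<^sup>2 / 1\<^sup>2)"
      by simp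
  qed simp_all
  have P1: "poincare_constant (triangle_measure \<eta> (sqrt 3)) \<le> ennreal ?B"
    unfolding e_def
  proof (rule poincare_constant_triangle_le[OF \<eta>(2)])
    fix g gs gt :: "real \<times> real \<Rightarrow> real"
    assume "\<And>z. (g has_derivative (\<lambda>h. fst h * gs z + snd h * gt z)) (at z)"
      "continuous_on UNIV gs" "continuous_on UNIV gt"
    from poincare_equilateral_triangle[OF this w]
    show "\<exists>\<alpha>. triangle_integral (\<lambda>z. (g z - \<alpha>)\<^sup>2)
        \<le> ennreal (9 / (4 * 3.141\<^sup>2)) * triangle_integral (\<lambda>z. (gs z)\<^sup>2 + (gt z)\<^sup>2 / (sqrt 3)\<^sup>2)"
      by simp
  qed simp_all
  have Pm: "ennreal ?C \<le> poincare_constant (triangle_measure \<eta> m)"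
    by (rule poincare_constant_midpoint_ge[OF \<eta>(2) m(1,2)])
  have C: "0.21572 \<le> ?C"
  proof -
    define d where "d = 1481 / 60 + (4 - 2 * sqrt 3) * (217 / 36)"
    have d: "0 < d" "d \<le> 27.9143" using sqrt3 unfolding d_def by (simp_all add: field_simps)
    have "0.21572 \<le> (1 / 1.0004) * ((5693 / 945) / 27.9143 :: real)" by simp
    also have "\<dots> \<le> (1 / e) * ((5693 / 945) / d)"
      using e d by (intro mult_mono divide_left_mono) auto
    also have "\<dots> = ?C"
      by (simp add: e_def d_def exp_minus m(3) inverse_eq_divide)
    finally show ?thesis .
  qed
  have sqe: "sqrt e \<le> 1.0002" using e by (intro real_le_lsqrt) (auto simp: power2_eq_square)
  have "1 / 2 * sqrt ?A + 1 / 2 * sqrt ?B = sqrt e * ((sqrt 2 + 3 / 2) / (2 * 3.141))"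
  proof -
    have "sqrt (2 / 3.141\<^sup>2) = sqrt 2 / 3.141"
      by (simp add: real_sqrt_divide)
    moreover have "sqrt (9 / (4 * 3.141\<^sup>2)) = (3 / 2) / 3.141"
    proof -
      have "9 / (4 * 3.141\<^sup>2) = ((3 / 2) / 3.141 :: real)\<^sup>2" by (simp add: power2_eq_square)
      then show ?thesis by (simp only: real_sqrt_abs) simp
    qed
    ultimately show ?thesis
      unfolding real_sqrt_mult[of e] by (simp only:) (simp add: field_simps)
  qed
  also have "\<dots> \<le> 1.0002 * ((1.41422 + 3 / 2) / (2 * 3.141))"
    using sqe sqrt2 e by (intro mult_mono) auto
  \<comment> \<open>The left side is about 0.46399, the right side about 0.46446.\<close>
  also have "\<dots> < sqrt 0.21572"
    by (rule real_less_rsqrt) (simp add: power2_eq_square)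
  also have "\<dots> \<le> sqrt ?C" using C by simp
  finally have less: "1 / 2 * sqrt ?A + 1 / 2 * sqrt ?B < sqrt ?C" .
  have "ennreal (1/2) * ennreal_sqrt (poincare_constant (triangle_measure \<eta> 1))
      + ennreal (1/2) * ennreal_sqrt (poincare_constant (triangle_measure \<eta> (sqrt 3)))
    \<le> ennreal (1/2) * ennreal_sqrt (ennreal ?A) + ennreal (1/2) * ennreal_sqrt (ennreal ?B)"
    by (intro add_mono mult_left_mono ennreal_sqrt_mono P0 P1) auto
  also have "\<dots> = ennreal (1 / 2 * sqrt ?A + 1 / 2 * sqrt ?B)"
  proof -
    have half: "ennreal (1/2) * ennreal_sqrt (ennreal x) = ennreal (1 / 2 * sqrt x)" if "0 \<le> x" for x
      unfolding ennreal_sqrt_ennreal[OF that] by (rule ennreal_mult'[symmetric]) simp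
    have "0 \<le> ?A" "0 \<le> ?B" using e by simp_all
    then show ?thesis
      unfolding half[OF \<open>0 \<le> ?A\<close>] half[OF \<open>0 \<le> ?B\<close>]
      by (intro ennreal_plus[symmetric]) (simp_all only: real_sqrt_ge_zero mult_nonneg_nonneg zero_le_divide_1_iff zero_le_numeral)
  qed
  also have "\<dots> < ennreal (sqrt ?C)"
    using less e by (subst ennreal_less_iff) auto
  also have "\<dots> = ennreal_sqrt (ennreal ?C)"
    by (rule ennreal_sqrt_ennreal[symmetric], rule order_trans[OF _ C]) simp
  also have "\<dots> \<le> ennreal_sqrt (poincare_constant (triangle_measure \<eta> m))"
    by (intro ennreal_sqrt_mono Pm)
  finally have main: "ennreal (1/2) * ennreal_sqrt (poincare_constant (triangle_measure \<eta> 1))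
      + ennreal (1/2) * ennreal_sqrt (poincare_constant (triangle_measure \<eta> (sqrt 3)))
    < ennreal_sqrt (poincare_constant (triangle_measure \<eta> m))" .
  have "wasserstein_midpoint (triangle_measure \<eta> 1) (triangle_measure \<eta> (sqrt 3)) (triangle_measure \<eta> m)"
    unfolding m_def using sqrt3 by (intro wasserstein_midpoint_triangles \<eta>) simp
  moreover have "strongly_log_concave (2 * \<eta>) (triangle_measure \<eta> 1)"
    "strongly_log_concave (2 * \<eta>) (triangle_measure \<eta> (sqrt 3))"
    by (intro strongly_log_concave_triangle_measure \<eta>; simp)+
  ultimately show ?thesis using \<eta>(1) main by (intro exI[of _ "2 * \<eta>"]) auto
qed

end
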